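(* Let $n\ge1$ be an integer. Let $X_1=(\Omega_1,\Sigma_1,\mu_1)$ and $X_2=(\Omega_2,\Sigma_2,\mu_2)$ be two measure spaces, where $\Omega_1$ is a Polish space and $\Sigma_1$ is its Borel $\sigma$-algebra, and where $\mu_1$ and $\mu_2$ are measures with finite support satisfying $\mu_1(\Omega_1)=\mu_2(\Omega_2)<+\infty$. Let $A:L^2(X_1,\mathbb{R}^n)\to L^2(X_2,\mathbb{R}^n)$ be a continuous linear operator such that (i) $\|A\|\le 1$; (ii) for every $v_0\in\mathbb{R}^n$, $A$ sends the constant function $\Omega_1\ni s\mapsto v_0$ to the constant function $\Omega_2\ni t\mapsto v_0$. Let $\{f_s\}_{s\in\Omega_1}$ and $\{g_t\}_{t\in\Omega_2}$ be two families of Borel functions from $\mathbb{R}^n$ to $\mathbb{R}\cup\{+\infty\}$ such that (iii) $(s,x)\mapsto f_s(x)$ is $\Sigma_1\otimes\mathcal{B}_{\mathbb{R}^n}$-measurable and $(t,x)\mapsto g_t(x)$ is $\Sigma_2\otimes\mathcal{B}_{\mathbb{R}^n}$-measurable; (iv) the functions $s\mapsto\log\bigl(\int_{\mathbb{R}^n}e^{-f_s(x)}\,dx\bigr)$ and $t\mapsto\log\bigl(\int_{\mathbb{R}^n}e^{-g_t(x)}\,dx\bigr)$ are semi-integrable with respect to $\mu_1$ and $\mu_2$ respectively. If for every $\alpha\in L^2(X_1,\mathbb{R}^n)$ we have \[ \int_{\Omega_2}g_t\bigl((A\alpha)(t)\bigr)\,d\mu_2(t)\le\int_{\Omega_1}f_s(\alpha(s))\,d\mu_1(s),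 \] then \[ \int_{\Omega_2}-\log\Bigl(\int_{\mathbb{R}^n}e^{-g_t(x)}\,dx\Bigr)\,d\mu_2(t)\le\int_{\Omega_1}-\log\Bigl(\int_{\mathbb{R}^n}e^{-f_s(x)}\,dx\Bigr)\,d\mu_1(s). \]
   Context: A measure with finite support is a finite combination $\sum_i c_i\delta_{s_i}$ of Dirac masses with $c_i>0$, so the integrals over $\Omega_1,\Omega_2$ are finite weighted sums. $|\cdot|$ is the Euclidean norm on $\mathbb{R}^n$, $\mathcal{B}_{\mathbb{R}^n}$ is the Borel $\sigma$-algebra of $\mathbb{R}^n$. The $L^2$-norms of $\mathbb{R}^n$-valued functions are computed with respect to $|\cdot|$ and the measures $\mu_1,\mu_2$, and $\|A\|$ is the corresponding operator norm. An extended-real measurable function $F$ on a measure space with measure $\mu$ is called $\mu$-semi-integrable if at least one of $F^+=\max(F,0)$, $F^-=\max(-F,0)$ is $\mu$-integrable; its integral is then well defined in $[-\infty,+\infty]$. Conventions: $e^{-\infty}=0$, $\log 0=-\infty$, $\log(+\infty)=+\infty$. *)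

theory Defs
  imports "HOL-Probability.Probability"
begin

text \<open>
  A measure of finite support is a finite combination of Dirac masses with positive real
  coefficients; \<^term>\<open>return M s\<close> is the Dirac mass at \<open>s\<close> on the sigma-algebra of \<open>M\<close>.
\<close>

definition finitely_supported :: "'a measure \<Rightarrow> bool" where
  "finitely_supported M \<longleftrightarrow>
     (\<exists>S (c :: 'a \<Rightarrow> real). finite S \<and> S \<subseteq> space M \<and> (\<forall>s\<in>S. 0 < c s) \<and>
        (\<forall>B\<in>sets M. emeasure M B = (\<Sum>s\<in>S. ennreal (c s) * emeasure (return M s) B)))"

text \<open>
  Elements of \<open>L\<^sup>2\<close> are handled through representatives: \<open>L2 M\<close> is the set of measurable
  square-integrable functions, and the points of the Hilbert space are its classes modulo
  almost-everywhere equality.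
\<close>

definition L2 :: "'a measure \<Rightarrow> ('a \<Rightarrow> 'b :: euclidean_space) set" where
  "L2 M = {\<alpha> \<in> borel_measurable M. integrable M (\<lambda>s. (norm (\<alpha> s))\<^sup>2)}"

definition L2_norm :: "'a measure \<Rightarrow> ('a \<Rightarrow> 'b :: euclidean_space) \<Rightarrow> real" where
  "L2_norm M \<alpha> = sqrt (LINT s|M. (norm (\<alpha> s))\<^sup>2)"

text \<open>
  A map on representatives is a linear operator between the \<open>L\<^sup>2\<close> spaces if it descends to
  classes and is linear there. Every operator between the spaces of classes arises in this way,
  by choosing representatives.
\<close>

definition L2_linear ::
    "'a measure \<Rightarrow> 'c measure \<Rightarrow> (('a \<Rightarrow> 'b :: euclidean_space) \<Rightarrow> ('c \<Rightarrow> 'd :: euclidean_space)) \<Rightarrow> bool"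
  where
  "L2_linear M N A \<longleftrightarrow>
     (\<forall>\<alpha>\<in>L2 M. A \<alpha> \<in> L2 N) \<and>
     (\<forall>\<alpha>\<in>L2 M. \<forall>\<beta>\<in>L2 M. (AE s in M. \<alpha> s = \<beta> s) \<longrightarrow> (AE t in N. A \<alpha> t = A \<beta> t)) \<and>
     (\<forall>\<alpha>\<in>L2 M. \<forall>\<beta>\<in>L2 M. AE t in N. A (\<lambda>s. \<alpha> s + \<beta> s) t = A \<alpha> t + A \<beta> t) \<and>
     (\<forall>r. \<forall>\<alpha>\<in>L2 M. AE t in N. A (\<lambda>s. r *\<^sub>R \<alpha> s) t = r *\<^sub>R A \<alpha> t)"

definition L2_continuous ::
    "'a measure \<Rightarrow> 'c measure \<Rightarrow> (('a \<Rightarrow> 'b :: euclidean_space) \<Rightarrow> ('c \<Rightarrow> 'd :: euclidean_space)) \<Rightarrow> bool"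
  where
  "L2_continuous M N A \<longleftrightarrow>
     (\<forall>\<alpha>\<in>L2 M. \<forall>\<epsilon>>0. \<exists>\<delta>>0. \<forall>\<beta>\<in>L2 M.
        L2_norm M (\<lambda>s. \<beta> s - \<alpha> s) < \<delta> \<longrightarrow> L2_norm N (\<lambda>t. A \<beta> t - A \<alpha> t) < \<epsilon>)"

text \<open>
  The operator norm, in the form of \<^const>\<open>onorm\<close> (which is only available for operators between
  normed types). The supremum is over a bounded set when \<open>A\<close> is linear and continuous.
\<close>

definition L2_onorm ::
    "'a measure \<Rightarrow> 'c measure \<Rightarrow> (('a \<Rightarrow> 'b :: euclidean_space) \<Rightarrow> ('c \<Rightarrow> 'd :: euclidean_space)) \<Rightarrow> real"
  where
  "L2_onorm M N A = (SUP \<alpha>\<in>L2 M. L2_norm N (A \<alpha>) / L2_norm M \<alpha>)"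

text \<open>
  Integration of extended-real functions. Since \<^const>\<open>e2ennreal\<close> sends negative numbers to \<open>0\<close>,
  \<open>e2ennreal (F s)\<close> and \<open>e2ennreal (- F s)\<close> are the positive and negative parts of \<open>F\<close>. The
  difference of their integrals is meaningful if \<open>F\<close> is semi-integrable.
\<close>

definition semi_integrable :: "'a measure \<Rightarrow> ('a \<Rightarrow> ereal) \<Rightarrow> bool" where
  "semi_integrable M F \<longleftrightarrow> F \<in> borel_measurable M \<and>
     ((\<integral>\<^sup>+s. e2ennreal (F s) \<partial>M) < \<infinity> \<or> (\<integral>\<^sup>+s. e2ennreal (- F s) \<partial>M) < \<infinity>)"

definition ereal_integral :: "'a measure \<Rightarrow> ('a \<Rightarrow> ereal) \<Rightarrow> ereal" where
  "ereal_integral M F =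
     enn2ereal (\<integral>\<^sup>+s. e2ennreal (F s) \<partial>M) - enn2ereal (\<integral>\<^sup>+s. e2ennreal (- F s) \<partial>M)"

definition ereal_exp :: "ereal \<Rightarrow> ennreal" where
  "ereal_exp x =
     (if x = \<infinity> then \<infinity> else if x = -\<infinity> then 0 else ennreal (exp (real_of_ereal x)))"

definition ennreal_ln :: "ennreal \<Rightarrow> ereal" where
  "ennreal_ln x = (if x = 0 then -\<infinity> else if x = \<infinity> then \<infinity> else ereal (ln (enn2real x)))"

end

theory Submission
  imports Defs
begin

text \<open>
For finite combinations of Dirac masses the theorem is an inequality between finitely many
functions. There are points \<open>s \<in> S\<close> and \<open>t \<in> T\<close> with weights \<open>c s\<close> and \<open>d t\<close> of the same total,
and \<open>A\<close> is a linear map of configurations \<open>x = (x s)\<close> that fixes the constant ones and satisfies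
\<open>\<Sum> d t |(A x) t|\<^sup>2 \<le> \<Sum> c s |x s|\<^sup>2\<close>. With \<open>u s = - f s\<close> and \<open>v t = - g t\<close> the hypothesis reads
\<open>\<Sum> c s * u s (x s) \<le> \<Sum> d t * v t ((A x) t)\<close> for every \<open>x\<close>, and the claim is
\<open>\<Sum> c s * ln (\<integral> exp (u s)) \<le> \<Sum> d t * ln (\<integral> exp (v t))\<close>.

The reason is that the hypothesis is preserved when \<open>u s\<close> and \<open>v t\<close> evolve by
\<open>w \<mapsto> ln (P \<tau> (exp w))\<close>, where \<open>P\<close> is the heat semigroup (\<open>heat\<close> below). This is Borell's
stochastic argument, carried out in discrete time. For a standard Gaussian vector \<open>Z\<close>, translating
the Gaussian measure and using Jensen's inequality gives, for every drift \<open>k\<close>,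
\<open>ln (E exp (v (y + \<surd>\<delta> Z))) \<ge> E v (y + \<surd>\<delta> Z + \<delta> k) - \<delta> |k|\<^sup>2 / 2\<close> (\<open>heat_exp_lower\<close>).
For \<open>u\<close> of class \<open>C\<^sup>1\<^sup>,\<^sup>1\<close> the drift \<open>k = \<nabla>u x\<close> attains equality up to an error \<open>O(\<delta>\<^sup>2)\<close>
(\<open>heat_exp_upper\<close>). Take the drifts \<open>k s = \<nabla>(u s) (x s)\<close> for the functions \<open>u s\<close> and the drifts
\<open>(A k) t\<close> for the functions \<open>v t\<close>. Since \<open>A\<close> fixes constants, adding the increment \<open>\<surd>\<delta> Z\<close> to all
the \<open>x s\<close> adds it to all the \<open>(A x) t\<close>, so the hypothesis can be averaged over \<open>Z\<close>; since \<open>A\<close> is a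
contraction, the quadratic cost on the side of \<open>T\<close> is at most the one on the side of \<open>S\<close>. One step
of length \<open>\<delta>\<close> thus loses only \<open>O(\<delta>\<^sup>2)\<close> (\<open>one_step\<close>), and \<open>\<tau> / \<delta>\<close> steps lose \<open>O(\<delta>)\<close>
(\<open>heat_flow_mollified\<close>).

The bound \<open>O(\<delta>\<^sup>2)\<close> has to be uniform along the flow. For bounded functions it is enough to mollify
the initial data by \<open>P \<epsilon>\<close>, which respects the hypothesis because a common Gaussian translation does;
the \<open>C\<^sup>1\<^sup>,\<^sup>1\<close> bounds then survive \<open>exp\<close>, \<open>P \<tau>\<close> and \<open>ln\<close>, and \<open>\<epsilon>\<close> tends to \<open>0\<close> by convergence in
\<open>L\<^sup>1\<close>. General functions are clamped to bounded intervals whose endpoints are chosen such that the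
hypothesis is not destroyed (\<open>clamp_sums_le\<close>).

At the configuration \<open>x = 0\<close> and time \<open>\<tau>\<close> this compares integrals against \<open>exp (- |x|\<^sup>2 / (2 \<tau>))\<close>;
the normalising constants cancel because the two total masses agree, and \<open>\<tau> \<rightarrow> \<infinity>\<close> gives the
Lebesgue integrals (\<open>log_integral_inequality\<close>).
\<close>

section \<open>The standard Gaussian measure\<close>

lemma nn_integral_lborel_affine:
  fixes f :: "'a::euclidean_space \<Rightarrow> ennreal"
  assumes [measurable]: "f \<in> borel_measurable borel" and "c \<noteq> 0"
  shows "(\<integral>\<^sup>+x. f x \<partial>lborel) = ennreal (\<bar>c\<bar> ^ DIM('a)) * (\<integral>\<^sup>+x. f (t + c *\<^sub>R x) \<partial>lborel)"
  by (subst lborel_affine[OF assms(2), of t])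
     (simp add: nn_integral_density nn_integral_distr nn_integral_cmult)

definition gauss_density :: "'a::euclidean_space \<Rightarrow> real" where
  "gauss_density z = exp (- (norm z)\<^sup>2 / 2) / sqrt (2 * pi) ^ DIM('a)"

definition gauss :: "'a::euclidean_space measure" where
  "gauss = density lborel (\<lambda>z. ennreal (gauss_density z))"

lemma gauss_density_pos: "0 < gauss_density z"
  by (simp add: gauss_density_def)

lemma gauss_density_nonneg [simp]: "0 \<le> gauss_density z"
  using gauss_density_pos less_imp_le by blast

lemma gauss_density_measurable [measurable]: "gauss_density \<in> borel_measurable borel"
  by (simp add: gauss_density_def[abs_def])

lemma sets_gauss [simp, measurable_cong]: "sets gauss = sets borel"
  by (simp add: gauss_def)

lemma space_gauss [simp]: "space gauss = UNIV"
  by (simp add: gauss_def)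

lemma nn_integral_gauss:
  fixes f :: "'a::euclidean_space \<Rightarrow> ennreal"
  assumes "f \<in> borel_measurable borel"
  shows "(\<integral>\<^sup>+z. f z \<partial>gauss) = (\<integral>\<^sup>+z. ennreal (gauss_density z) * f z \<partial>lborel)"
  unfolding gauss_def using assms by (subst nn_integral_density) auto

lemma gauss_density_prod:
  "gauss_density (z::'a::euclidean_space) = (\<Prod>b\<in>Basis. std_normal_density (z \<bullet> b))"
proof -
  have "(norm z)\<^sup>2 = (\<Sum>b\<in>Basis. (z \<bullet> b)\<^sup>2)"
    by (subst power2_norm_eq_inner) (simp add: euclidean_inner[of z z] power2_eq_square)
  then show ?thesis
    by (simp add: gauss_density_def std_normal_density_def prod_dividef exp_sum[symmetric]
          sum_negf sum_divide_distrib)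
qed

lemma nn_integral_gauss_density: "(\<integral>\<^sup>+z. ennreal (gauss_density (z::'a::euclidean_space)) \<partial>lborel) = 1"
proof -
  have "(\<integral>\<^sup>+z. ennreal (gauss_density (z::'a)) \<partial>lborel)
      = (\<integral>\<^sup>+z. (\<Prod>b\<in>Basis. ennreal (std_normal_density ((z::'a) \<bullet> b))) \<partial>lborel)"
    by (simp add: gauss_density_prod prod_ennreal)
  also have "\<dots> = (\<Prod>b\<in>(Basis::'a set). \<integral>\<^sup>+x. ennreal (std_normal_density x) \<partial>lborel)"
    by (rule nn_integral_lborel_prod) auto
  also have "(\<integral>\<^sup>+x. ennreal (std_normal_density x) \<partial>lborel) = 1"
    by (subst nn_integral_eq_integral) auto
  finally show ?thesis by simp
qed

lemma prob_space_gauss: "prob_space (gauss :: 'a::euclidean_space measure)"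
  by standard (simp add: gauss_def emeasure_density nn_integral_gauss_density)

interpretation gauss: prob_space "gauss :: 'a::euclidean_space measure"
  by (rule prob_space_gauss)

interpretation gauss_pair: pair_prob_space "gauss :: 'a::euclidean_space measure" "gauss :: 'b::euclidean_space measure"
  by (simp add: pair_prob_space_def pair_sigma_finite_def prob_space_gauss gauss.sigma_finite_measure_axioms)

lemma gauss_integrable_bounded:
  fixes f :: "'a::euclidean_space \<Rightarrow> 'b::{banach, second_countable_topology}"
  assumes "f \<in> borel_measurable borel" "\<And>x. norm (f x) \<le> B"
  shows "integrable gauss f"
  by (rule gauss.integrable_const_bound[of f B]) (use assms in auto)

lemma gauss_density_shift:
  "gauss_density (z + k) * exp (k \<bullet> z + (norm k)\<^sup>2 / 2) = gauss_density (z::'a::euclidean_space)"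
proof -
  have "(norm (z + k))\<^sup>2 = (norm z)\<^sup>2 + 2 * (k \<bullet> z) + (norm k)\<^sup>2"
    by (simp add: power2_norm_eq_inner inner_simps inner_commute)
  then show ?thesis
    by (simp add: gauss_density_def mult_exp_exp field_simps)
qed

text \<open>
The Cameron--Martin formula for a single Gaussian vector: completing the square turns the density at
\<open>z + k\<close> into the density at \<open>z\<close> times an exponential of a linear function.
\<close>

lemma gauss_shift_measure:
  "distr (density gauss (\<lambda>z. ennreal (exp (- (k \<bullet> z) - (norm k)\<^sup>2 / 2)))) borel (\<lambda>z. z + k)
    = (gauss :: 'a::euclidean_space measure)"
proof (rule measure_eqI)
  fix B :: "'a set"
  assume "B \<in> sets (distr (density gauss (\<lambda>z. ennreal (exp (- (k \<bullet> z) - (norm k)\<^sup>2 / 2)))) borel (\<lambda>z. z + k))"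
  then have [measurable]: "B \<in> sets borel" by simp
  have e: "gauss_density z * exp (- (k \<bullet> z) - (norm k)\<^sup>2 / 2) = gauss_density (z + k)" for z
    by (subst gauss_density_shift[of z k, symmetric]) (simp add: exp_diff exp_minus exp_add)
  have "emeasure (distr (density gauss (\<lambda>z. ennreal (exp (- (k \<bullet> z) - (norm k)\<^sup>2 / 2)))) borel (\<lambda>z. z + k)) B
      = (\<integral>\<^sup>+z. indicator B z \<partial>(distr (density gauss (\<lambda>z. ennreal (exp (- (k \<bullet> z) - (norm k)\<^sup>2 / 2)))) borel (\<lambda>z. z + k)))"
    by simp
  also have "\<dots> = (\<integral>\<^sup>+z. ennreal (exp (- (k \<bullet> z) - (norm k)\<^sup>2 / 2)) * indicator B (z + k) \<partial>gauss)"
    by (subst nn_integral_distr) (auto simp: nn_integral_density)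
  also have "\<dots> = (\<integral>\<^sup>+z. ennreal (gauss_density (z + k)) * indicator B (z + k) \<partial>lborel)"
    by (subst nn_integral_gauss) (simp_all add: e mult.assoc[symmetric] ennreal_mult[symmetric])
  also have "\<dots> = (\<integral>\<^sup>+z. ennreal (gauss_density z) * indicator B z \<partial>lborel)"
    by (subst (2) nn_integral_lborel_affine[of _ 1 k]) (simp_all add: add.commute)
  also have "\<dots> = emeasure gauss B"
    by (subst nn_integral_gauss[symmetric]) auto
  finally show "emeasure (distr (density gauss (\<lambda>z. ennreal (exp (- (k \<bullet> z) - (norm k)\<^sup>2 / 2)))) borel (\<lambda>z. z + k)) B
     = emeasure gauss B" .
qed simp

lemma gauss_shift:
  fixes f :: "'a::euclidean_space \<Rightarrow> 'b::{banach, second_countable_topology}"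
  assumes [measurable]: "f \<in> borel_measurable borel"
  shows "(\<integral>z. exp (- (k \<bullet> z) - (norm k)\<^sup>2 / 2) *\<^sub>R f (z + k) \<partial>gauss) = (\<integral>z. f z \<partial>gauss)"
  by (subst (2) gauss_shift_measure[of k, symmetric])
     (simp add: integral_distr integral_density)

lemma gauss_shift_integrable:
  fixes f :: "'a::euclidean_space \<Rightarrow> 'b::{banach, second_countable_topology}"
  assumes [measurable]: "f \<in> borel_measurable borel" and "integrable gauss f"
  shows "integrable gauss (\<lambda>z. exp (- (k \<bullet> z) - (norm k)\<^sup>2 / 2) *\<^sub>R f (z + k))"
  using assms(2) by (subst (asm) gauss_shift_measure[of k, symmetric])
     (simp add: integrable_distr_eq integrable_density)

text \<open>
All error terms below are dominated by \<open>exp (|z|\<^sup>2 / 4)\<close>. Its integral is finite because multiplying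
by it turns the density into that of a Gaussian of variance \<open>2\<close>, up to normalisation.
\<close>

lemma gauss_exp_sq_integrable:
  "integrable gauss (\<lambda>z::'a::euclidean_space. exp ((norm z)\<^sup>2 / 4))"
proof -
  have e: "gauss_density z * exp ((norm z)\<^sup>2 / 4) = gauss_density ((1 / sqrt 2) *\<^sub>R z)" for z :: 'a
    by (simp add: gauss_density_def mult_exp_exp power_mult_distrib power_divide field_simps)
  have "(\<integral>\<^sup>+z. ennreal (exp ((norm z)\<^sup>2 / 4)) \<partial>(gauss::'a measure))
      = (\<integral>\<^sup>+z. ennreal (gauss_density ((1 / sqrt 2) *\<^sub>R (z::'a))) \<partial>lborel)"
    by (subst nn_integral_gauss) (simp_all add: e ennreal_mult[symmetric])
  also have "\<dots> = ennreal (sqrt 2 ^ DIM('a)) * (\<integral>\<^sup>+z. ennreal (gauss_density (z::'a)) \<partial>lborel)"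
    by (subst nn_integral_lborel_affine[of _ "sqrt 2" 0]) simp_all
  also have "\<dots> < \<infinity>" by (simp add: nn_integral_gauss_density)
  finally show ?thesis by (simp add: integrable_iff_bounded)
qed

text \<open>
The value of this integral depends on the space only, hence the type argument.
\<close>

definition gauss_exp_moment :: "'a::euclidean_space itself \<Rightarrow> real" where
  "gauss_exp_moment _ = (\<integral>z. exp ((norm (z::'a))\<^sup>2 / 4) \<partial>gauss)"

lemma gauss_exp_moment_nonneg: "0 \<le> gauss_exp_moment TYPE('a::euclidean_space)"
  unfolding gauss_exp_moment_def by (rule integral_nonneg_AE) auto

lemma gauss_integrable_dom:
  fixes f :: "'a::euclidean_space \<Rightarrow> 'b::{banach, second_countable_topology}"
  assumes [measurable]: "f \<in> borel_measurable borel"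
    and "\<And>z. norm (f z) \<le> C * exp ((norm z)\<^sup>2 / 4)"
  shows "integrable gauss f" "norm (integral\<^sup>L gauss f) \<le> C * gauss_exp_moment TYPE('a)"
proof -
  have i: "integrable gauss (\<lambda>z::'a. C * exp ((norm z)\<^sup>2 / 4))"
    by (intro integrable_mult_right gauss_exp_sq_integrable)
  show f: "integrable gauss f"
    by (rule Bochner_Integration.integrable_bound[OF i]) (use assms(2) in \<open>auto intro: order_trans[OF _ abs_ge_self]\<close>)
  have "norm (integral\<^sup>L gauss f) \<le> (\<integral>z. norm (f z) \<partial>gauss)" by (rule integral_norm_bound)
  also have "\<dots> \<le> (\<integral>z. C * exp ((norm (z::'a))\<^sup>2 / 4) \<partial>gauss)"
    by (rule Bochner_Integration.integral_mono) (use f i assms(2) in auto)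
  finally show "norm (integral\<^sup>L gauss f) \<le> C * gauss_exp_moment TYPE('a)" by (simp add: gauss_exp_moment_def)
qed

lemma norm_le_exp_sq: "norm z \<le> exp ((norm z)\<^sup>2 / 4)"
proof -
  have "norm z \<le> 1 + (norm z)\<^sup>2 / 4"
    using zero_le_power2[of "norm z - 2"] by (simp add: power2_eq_square algebra_simps)
  also have "\<dots> \<le> exp ((norm z)\<^sup>2 / 4)" by (rule exp_ge_add_one_self)
  finally show ?thesis .
qed

lemma gauss_id_integrable: "integrable gauss (\<lambda>z::'a::euclidean_space. z)"
  by (rule gauss_integrable_dom(1)[of _ 1]) (auto simp: norm_le_exp_sq)

lemma gauss_uminus: "distr gauss borel uminus = (gauss :: 'a::euclidean_space measure)"
proof (rule measure_eqI)
  fix B :: "'a set" assume "B \<in> sets (distr gauss borel uminus)"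
  then have [measurable]: "B \<in> sets borel" by simp
  have "emeasure (distr gauss borel uminus) B = (\<integral>\<^sup>+z. indicator B z \<partial>distr gauss borel uminus)"
    by simp
  also have "\<dots> = (\<integral>\<^sup>+z. ennreal (gauss_density (- z)) * indicator B (- z) \<partial>lborel)"
    by (subst nn_integral_distr) (simp_all add: nn_integral_gauss gauss_density_def)
  also have "\<dots> = (\<integral>\<^sup>+z. ennreal (gauss_density z) * indicator B z \<partial>lborel)"
    by (subst (2) nn_integral_lborel_affine[of _ "-1" 0]) simp_all
  also have "\<dots> = emeasure gauss B"
    by (subst nn_integral_gauss[symmetric]) auto
  finally show "emeasure (distr gauss borel uminus) B = emeasure gauss B" .
qed simp

lemma gauss_mean: "(\<integral>z. (z::'a::euclidean_space) \<partial>gauss) = 0"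
proof -
  have "(\<integral>z. (z::'a) \<partial>gauss) = (\<integral>z. (z::'a) \<partial>(distr gauss borel uminus))"
    by (simp add: gauss_uminus)
  also have "\<dots> = - (\<integral>z. (z::'a) \<partial>gauss)" by (simp add: integral_distr)
  finally show ?thesis by (metis add.inverse_neutral neg_equal_iff_equal eq_neg_iff_add_eq_0 scaleR_2 scaleR_eq_0_iff zero_neq_numeral)
qed

text \<open>
The rotation \<open>(z, w) \<mapsto> (a z + b w, b z - a w)\<close> leaves \<open>|z|\<^sup>2 + |w|\<^sup>2\<close> unchanged; the identity is this fact
with \<open>w\<close> eliminated in favour of \<open>y = a z + b w\<close>.
\<close>

lemma gauss_density_rotate:
  fixes z y :: "'a::euclidean_space"
  assumes ab: "a\<^sup>2 + b\<^sup>2 = 1" and b: "b > 0"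
  shows "gauss_density z * gauss_density ((1 / b) *\<^sub>R (y - a *\<^sub>R z))
       = gauss_density y * gauss_density ((1 / b) *\<^sub>R (z - a *\<^sub>R y))"
proof -
  have n: "(norm (y - a *\<^sub>R z))\<^sup>2 = (norm y)\<^sup>2 - 2 * a * (y \<bullet> z) + a\<^sup>2 * (norm z)\<^sup>2" for y z :: 'a
    by (simp only: power2_norm_eq_inner) (simp add: inner_simps inner_commute power2_eq_square algebra_simps)
  have a2: "a\<^sup>2 = 1 - b\<^sup>2" using ab by simp
  have "(norm z)\<^sup>2 + (norm ((1 / b) *\<^sub>R (y - a *\<^sub>R z)))\<^sup>2 = (norm y)\<^sup>2 + (norm ((1 / b) *\<^sub>R (z - a *\<^sub>R y)))\<^sup>2"
    using b by (simp add: power_mult_distrib power_divide n a2 inner_commute) (simp add: field_simps)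
  then have "- (norm z)\<^sup>2 / 2 + - (norm ((1 / b) *\<^sub>R (y - a *\<^sub>R z)))\<^sup>2 / 2
     = - (norm y)\<^sup>2 / 2 + - (norm ((1 / b) *\<^sub>R (z - a *\<^sub>R y)))\<^sup>2 / 2" by argo
  then show ?thesis
    unfolding gauss_density_def times_divide_times_eq mult_exp_exp by (simp only:)
qed

text \<open>
Stability of the Gaussian law, which is what makes \<open>heat\<close> a semigroup. In the double integral, \<open>w\<close> is
replaced by \<open>y = a z + b w\<close>; after exchanging the integrals, the integral over \<open>z\<close> is that of a
Gaussian density centred at \<open>a y\<close>.
\<close>

lemma gauss_rotate_measure:
  assumes ab: "a\<^sup>2 + b\<^sup>2 = 1" and b: "b > 0"
  shows "distr (gauss \<Otimes>\<^sub>M gauss) borel (\<lambda>(z, w). a *\<^sub>R z + b *\<^sub>R w) = (gauss :: 'a::euclidean_space measure)"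
proof (rule measure_eqI)
  fix B :: "'a set" assume "B \<in> sets (distr (gauss \<Otimes>\<^sub>M gauss) borel (\<lambda>(z, w). a *\<^sub>R z + b *\<^sub>R w))"
  then have [measurable]: "B \<in> sets borel" by simp
  have inner: "(\<integral>\<^sup>+w. ennreal (gauss_density w) * indicator B (a *\<^sub>R z + b *\<^sub>R w) \<partial>lborel)
    = ennreal ((1/b)^DIM('a)) * (\<integral>\<^sup>+y. ennreal (gauss_density ((1/b) *\<^sub>R (y - a *\<^sub>R z))) * indicator B y \<partial>lborel)" for z
    using b by (subst nn_integral_lborel_affine[of _ "1/b" "- (a/b) *\<^sub>R z"]) (simp_all add: algebra_simps)
  have outer: "ennreal ((1/b)^DIM('a)) * (\<integral>\<^sup>+z. ennreal (gauss_density ((1/b) *\<^sub>R (z - a *\<^sub>R y))) \<partial>lborel)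
    = (\<integral>\<^sup>+z. ennreal (gauss_density (z::'a)) \<partial>lborel)" for y :: 'a
    using b nn_integral_lborel_affine[of "\<lambda>z::'a. ennreal (gauss_density z)" "1/b" "- (a/b) *\<^sub>R y"]
    by (simp add: algebra_simps)
  have "emeasure (distr (gauss \<Otimes>\<^sub>M gauss) borel (\<lambda>(z, w). a *\<^sub>R z + b *\<^sub>R w)) B
    = (\<integral>\<^sup>+p. indicator B p \<partial>distr (gauss \<Otimes>\<^sub>M gauss) borel (\<lambda>(z, w). a *\<^sub>R z + b *\<^sub>R (w::'a)))"
    by simp
  also have "\<dots> = (\<integral>\<^sup>+p. indicator B (a *\<^sub>R fst p + b *\<^sub>R snd p) \<partial>(gauss \<Otimes>\<^sub>M gauss))"
    by (subst nn_integral_distr) (auto simp: case_prod_beta')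
  also have "\<dots> = (\<integral>\<^sup>+z. \<integral>\<^sup>+w. indicator B (a *\<^sub>R z + b *\<^sub>R w) \<partial>gauss \<partial>gauss)"
    by (subst gauss.nn_integral_fst[symmetric]) auto
  also have "\<dots> = (\<integral>\<^sup>+z. ennreal (gauss_density z) * (\<integral>\<^sup>+w. ennreal (gauss_density w) * indicator B (a *\<^sub>R z + b *\<^sub>R w) \<partial>lborel) \<partial>lborel)"
    by (simp add: nn_integral_gauss)
  also have "\<dots> = (\<integral>\<^sup>+z. ennreal (gauss_density z) * (ennreal ((1/b)^DIM('a)) * (\<integral>\<^sup>+y. ennreal (gauss_density ((1/b) *\<^sub>R (y - a *\<^sub>R z))) * indicator B y \<partial>lborel)) \<partial>lborel)"
    by (simp only: inner)
  also have "\<dots> = (\<integral>\<^sup>+z. \<integral>\<^sup>+y. ennreal ((1/b)^DIM('a)) * ennreal (gauss_density z * gauss_density ((1/b) *\<^sub>R (y - a *\<^sub>R z))) * indicator B y \<partial>lborel \<partial>lborel)"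
    by (simp add: nn_integral_cmult[symmetric] ennreal_mult ac_simps)
  also have "\<dots> = (\<integral>\<^sup>+y. \<integral>\<^sup>+z. ennreal ((1/b)^DIM('a)) * ennreal (gauss_density z * gauss_density ((1/b) *\<^sub>R (y - a *\<^sub>R z))) * indicator B y \<partial>lborel \<partial>lborel)"
    by (rule lborel_pair.Fubini') simp
  also have "\<dots> = (\<integral>\<^sup>+y. ennreal (gauss_density y) * indicator B y * (ennreal ((1/b)^DIM('a)) * (\<integral>\<^sup>+z. ennreal (gauss_density ((1/b) *\<^sub>R (z - a *\<^sub>R y))) \<partial>lborel)) \<partial>lborel)"
    by (simp add: gauss_density_rotate[OF ab b] nn_integral_cmult[symmetric] ennreal_mult ac_simps)
  also have "\<dots> = (\<integral>\<^sup>+y. ennreal (gauss_density y) * indicator B y * (\<integral>\<^sup>+z. ennreal (gauss_density (z::'a)) \<partial>lborel) \<partial>lborel)"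
    by (simp only: outer)
  also have "\<dots> = emeasure gauss B"
    by (simp add: nn_integral_gauss_density nn_integral_gauss[symmetric])
  finally show "emeasure (distr (gauss \<Otimes>\<^sub>M gauss) borel (\<lambda>(z, w). a *\<^sub>R z + b *\<^sub>R w)) B = emeasure gauss B" .
qed simp

section \<open>The heat semigroup and the variational estimates for one time step\<close>

text \<open>
Brownian motion runs at unit speed here, so this is the flow of \<open>\<partial>\<^sub>t = \<Delta> / 2\<close>. The time enters through a
rescaling of a fixed Gaussian vector, so that \<open>t = 0\<close> is included and gives the identity.
\<close>

definition heat :: "real \<Rightarrow> ('a::euclidean_space \<Rightarrow> 'b::{banach, second_countable_topology}) \<Rightarrow> 'a \<Rightarrow> 'b" where
  "heat t f x = (\<integral>z. f (x + sqrt t *\<^sub>R z) \<partial>gauss)"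

lemma measure_gauss_UNIV [simp]: "measure gauss UNIV = 1"
  using gauss.prob_space by simp

lemma heat_measurable [measurable]:
  fixes f :: "'a::euclidean_space \<Rightarrow> 'b::{banach, second_countable_topology}"
  assumes [measurable]: "f \<in> borel_measurable borel"
  shows "heat t f \<in> borel_measurable borel"
  unfolding heat_def[abs_def] by (rule gauss.borel_measurable_lebesgue_integral) simp

lemma heat_integrable:
  fixes f :: "'a::euclidean_space \<Rightarrow> 'b::{banach, second_countable_topology}"
  assumes [measurable]: "f \<in> borel_measurable borel" and "\<And>x. norm (f x) \<le> B"
  shows "integrable gauss (\<lambda>z. f (x + sqrt t *\<^sub>R z))"
  by (rule gauss_integrable_bounded[of _ B]) (use assms in auto)

lemma heat_norm_le:
  fixes f :: "'a::euclidean_space \<Rightarrow> 'b::{banach, second_countable_topology}"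
  assumes [measurable]: "f \<in> borel_measurable borel" and "\<And>x. norm (f x) \<le> B"
  shows "norm (heat t f x) \<le> B"
proof -
  have "norm (heat t f x) \<le> (\<integral>z. norm (f (x + sqrt t *\<^sub>R z)) \<partial>gauss)"
    unfolding heat_def by (rule integral_norm_bound)
  also have "\<dots> \<le> (\<integral>z. B \<partial>(gauss::'a measure))"
    by (rule Bochner_Integration.integral_mono) (use heat_integrable[OF assms] assms in auto)
  finally show ?thesis by (simp)
qed

lemma heat_mono:
  fixes f g :: "'a::euclidean_space \<Rightarrow> real"
  assumes "f \<in> borel_measurable borel" "\<And>x. norm (f x) \<le> B"
    and "g \<in> borel_measurable borel" "\<And>x. norm (g x) \<le> C" and "\<And>x. f x \<le> g x"
  shows "heat t f x \<le> heat t g x"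
  unfolding heat_def
  by (rule Bochner_Integration.integral_mono)
    (use heat_integrable[OF assms(1,2)] heat_integrable[OF assms(3,4)] assms(5) in auto)

lemma heat_const [simp]: "heat t (\<lambda>_. c) x = c"
  by (simp add: heat_def)

lemma heat_0 [simp]: "heat 0 f = f"
  by (rule ext) (simp add: heat_def)

lemma heat_heat:
  fixes f :: "'a::euclidean_space \<Rightarrow> 'b::{banach, second_countable_topology}"
  assumes f[measurable]: "f \<in> borel_measurable borel" and B: "\<And>x. norm (f x) \<le> B"
    and st: "0 \<le> s" "0 \<le> t"
  shows "heat s (heat t f) = heat (s + t) f"
proof (cases "t = 0")
  case False
  \<comment> \<open>The sum of the two increments is \<open>\<surd>(s + t) (a z + b w)\<close> with \<open>a\<^sup>2 + b\<^sup>2 = 1\<close>.\<close>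
  define a where "a = sqrt (s / (s + t))"
  define b where "b = sqrt (t / (s + t))"
  have ab: "a\<^sup>2 + b\<^sup>2 = 1" "b > 0"
    using st False by (auto simp: a_def b_def add_divide_distrib[symmetric])
  have s: "sqrt (s + t) * a = sqrt s" "sqrt (s + t) * b = sqrt t"
    using st False by (auto simp: a_def b_def real_sqrt_mult[symmetric])
  show ?thesis
  proof
    fix x
    have "heat s (heat t f) x = (\<integral>z. (\<integral>w. f (x + sqrt s *\<^sub>R z + sqrt t *\<^sub>R w) \<partial>gauss) \<partial>gauss)"
      by (simp add: heat_def)
    also have "\<dots> = (\<integral>p. f (x + sqrt s *\<^sub>R fst p + sqrt t *\<^sub>R snd p) \<partial>(gauss \<Otimes>\<^sub>M gauss))"
      by (subst gauss_pair.integral_fst'[symmetric])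
        (auto intro!: gauss_pair.P.integrable_const_bound[of _ B] B simp: case_prod_beta')
    also have "\<dots> = (\<integral>p. f (x + sqrt (s + t) *\<^sub>R p) \<partial>distr (gauss \<Otimes>\<^sub>M gauss) borel (\<lambda>(z, w). a *\<^sub>R z + b *\<^sub>R w))"
      by (subst integral_distr) (simp_all add: case_prod_beta' scaleR_add_right s add.assoc)
    also have "\<dots> = heat (s + t) f x"
      by (simp add: gauss_rotate_measure[OF ab] heat_def)
    finally show "heat s (heat t f) x = heat (s + t) f x" .
  qed
qed simp

lemma exp_bounded_measurable:
  fixes v :: "'a::euclidean_space \<Rightarrow> real"
  assumes [measurable]: "v \<in> borel_measurable borel" and "\<And>x. \<bar>v x\<bar> \<le> B"
  shows "(\<lambda>x. exp (v x)) \<in> borel_measurable borel" "norm (exp (v x)) \<le> exp B"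
  using assms(2)[of x] by auto

text \<open>
Both variational estimates start from this rewriting of \<open>E exp (v (y + \<surd>\<delta> Z))\<close> as \<open>E exp W\<close>: the
Gaussian vector is translated by \<open>\<surd>\<delta> h\<close>, and the density of the translated law is put into the
exponent \<open>W\<close>. The mean of \<open>W\<close> is the gain of the drift \<open>h\<close> minus its cost.
\<close>

lemma heat_exp_tilt:
  fixes v :: "'a::euclidean_space \<Rightarrow> real" and y h :: 'a
  assumes [measurable]: "v \<in> borel_measurable borel" and B: "\<And>x. \<bar>v x\<bar> \<le> B" and d: "0 \<le> \<delta>"
  defines "W \<equiv> \<lambda>z. v (y + \<delta> *\<^sub>R h + sqrt \<delta> *\<^sub>R z) - sqrt \<delta> * (h \<bullet> z) - \<delta> / 2 * (norm h)\<^sup>2"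
  shows "integrable gauss W" "integrable gauss (\<lambda>z. exp (W z))"
    "(\<integral>z. W z \<partial>gauss) = heat \<delta> v (y + \<delta> *\<^sub>R h) - \<delta> / 2 * (norm h)\<^sup>2"
    "(\<integral>z. exp (W z) \<partial>gauss) = heat \<delta> (\<lambda>x. exp (v x)) y"
proof -
  \<comment> \<open>Translating \<open>z\<close> by \<open>k\<close> moves the argument \<open>y + \<surd>\<delta> z\<close> by \<open>\<delta> h\<close>.\<close>
  define k where "k = sqrt \<delta> *\<^sub>R h"
  have k: "(norm k)\<^sup>2 = \<delta> * (norm h)\<^sup>2" "k \<bullet> z = sqrt \<delta> * (h \<bullet> z)" "sqrt \<delta> *\<^sub>R k = \<delta> *\<^sub>R h" for z
    using d by (auto simp: k_def power_mult_distrib)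
  have iv: "integrable gauss (\<lambda>z. v (y + \<delta> *\<^sub>R h + sqrt \<delta> *\<^sub>R z))"
    by (rule heat_integrable[of _ B]) (use B in auto)
  have ih: "integrable gauss (\<lambda>z. h \<bullet> z)"
    using gauss_id_integrable by (rule integrable_inner_right)
  show "integrable gauss W"
    unfolding W_def using iv ih by (auto intro!: Bochner_Integration.integrable_diff integrable_mult_right)
  have "(\<integral>z. h \<bullet> z \<partial>gauss) = h \<bullet> (\<integral>z. z \<partial>gauss)"
    by (rule integral_inner_right) (use gauss_id_integrable in auto)
  then have h0: "(\<integral>z. h \<bullet> z \<partial>gauss) = 0" by (simp add: gauss_mean)
  show "(\<integral>z. W z \<partial>gauss) = heat \<delta> v (y + \<delta> *\<^sub>R h) - \<delta> / 2 * (norm h)\<^sup>2"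
    unfolding W_def using iv ih
    by (simp add: heat_def h0)
  have e: "exp (W z) = exp (- (k \<bullet> z) - (norm k)\<^sup>2 / 2) *\<^sub>R exp (v (y + sqrt \<delta> *\<^sub>R (z + k)))" for z
    by (simp add: W_def k scaleR_add_right mult_exp_exp algebra_simps)
  have i: "integrable gauss (\<lambda>z. exp (v (y + sqrt \<delta> *\<^sub>R z)))"
    by (rule heat_integrable[where f="\<lambda>x. exp (v x)" and B="exp B"]) (use exp_bounded_measurable[OF assms(1) B] in auto)
  show "integrable gauss (\<lambda>z. exp (W z))"
    unfolding e by (rule gauss_shift_integrable[OF _ i]) measurable
  show "(\<integral>z. exp (W z) \<partial>gauss) = heat \<delta> (\<lambda>x. exp (v x)) y"
    unfolding e heat_def by (rule gauss_shift) measurable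
qed

lemma heat_exp_pos:
  fixes v :: "'a::euclidean_space \<Rightarrow> real"
  assumes [measurable]: "v \<in> borel_measurable borel" and B: "\<And>x. \<bar>v x\<bar> \<le> B"
  shows "exp (- B) \<le> heat t (\<lambda>x. exp (v x)) y" "heat t (\<lambda>x. exp (v x)) y \<le> exp B"
proof -
  have "heat t (\<lambda>_. exp (- B)) y \<le> heat t (\<lambda>x. exp (v x)) y"
    by (rule heat_mono[of _ "exp (-B)" _ "exp B"])
      (use exp_bounded_measurable[OF assms(1) B] B in \<open>auto simp: abs_le_iff minus_le_iff\<close>)
  then show "exp (- B) \<le> heat t (\<lambda>x. exp (v x)) y" by simp
  show "heat t (\<lambda>x. exp (v x)) y \<le> exp B"
    using heat_norm_le[of "\<lambda>x. exp (v x)" "exp B" t y] exp_bounded_measurable[OF assms(1) B] by auto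
qed

text \<open>
Jensen's inequality for \<open>exp W\<close>, where \<open>W\<close> is the tilted exponent of \<open>heat_exp_tilt\<close>. As the drift is
arbitrary, it may later be chosen as the image of other drifts under the operator.
\<close>

lemma heat_exp_lower:
  fixes v :: "'a::euclidean_space \<Rightarrow> real"
  assumes v: "v \<in> borel_measurable borel" "\<And>x. \<bar>v x\<bar> \<le> B" and d: "0 \<le> \<delta>"
  shows "heat \<delta> v (y + \<delta> *\<^sub>R h) - \<delta> / 2 * (norm h)\<^sup>2 \<le> ln (heat \<delta> (\<lambda>x. exp (v x)) y)"
proof -
  define W where "W = (\<lambda>z. v (y + \<delta> *\<^sub>R h + sqrt \<delta> *\<^sub>R z) - sqrt \<delta> * (h \<bullet> z) - \<delta> / 2 * (norm h)\<^sup>2)"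
  have W: "integrable gauss W" "integrable gauss (\<lambda>z. exp (W z))"
    "(\<integral>z. W z \<partial>gauss) = heat \<delta> v (y + \<delta> *\<^sub>R h) - \<delta> / 2 * (norm h)\<^sup>2"
    "(\<integral>z. exp (W z) \<partial>gauss) = heat \<delta> (\<lambda>x. exp (v x)) y"
    unfolding W_def by (rule heat_exp_tilt[OF v d])+
  define m where "m = (\<integral>z. W z \<partial>gauss)"
  \<comment> \<open>The tangent of \<open>exp\<close> at \<open>m\<close> lies below \<open>exp\<close>.\<close>
  have "(\<integral>z. exp m * (1 + (W z - m)) \<partial>gauss) \<le> (\<integral>z. exp (W z) \<partial>gauss)"
  proof (rule Bochner_Integration.integral_mono)
    show "exp m * (1 + (W z - m)) \<le> exp (W z)" for z
      using mult_left_mono[OF exp_ge_add_one_self[of "W z - m"], of "exp m"]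
      by (simp add: mult_exp_exp)
  qed (use W in auto)
  moreover have "(\<integral>z. exp m * (1 + (W z - m)) \<partial>gauss) = exp m"
    using W(1) by (simp add: m_def)
  ultimately have "exp m \<le> heat \<delta> (\<lambda>x. exp (v x)) y" using W(4) by simp
  then have "m \<le> ln (heat \<delta> (\<lambda>x. exp (v x)) y)"
    by (intro ln_ge_iff[THEN iffD2]) (use exp_gt_zero[of m] in linarith)+
  then show ?thesis using W(3) by (simp add: m_def)
qed

lemma exp_second_order:
  fixes r :: real
  shows "\<bar>exp r - 1 - r\<bar> \<le> r\<^sup>2 * exp \<bar>r\<bar>"
proof -
  obtain t where t: "\<bar>t\<bar> \<le> \<bar>r\<bar>" "exp r = (\<Sum>m<2. r ^ m / fact m) + exp t / fact 2 * r ^ 2"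
    using Maclaurin_exp_le[of r 2] by blast
  then have "\<bar>exp r - 1 - r\<bar> = r\<^sup>2 * (exp t / 2)" by (simp add: numeral_2_eq_2)
  also have "\<dots> \<le> r\<^sup>2 * exp \<bar>r\<bar>"
  proof (rule mult_left_mono)
    have "exp t \<le> exp \<bar>r\<bar>" using t by auto
    then show "exp t / 2 \<le> exp \<bar>r\<bar>" using exp_gt_zero[of t] by linarith
  qed simp
  finally show ?thesis .
qed

text \<open>
A quantitative form of the class \<open>C\<^sup>1\<^sup>,\<^sup>1\<close>: \<open>h\<close> is the gradient of \<open>u\<close>, and one constant bounds it and the
second-order Taylor remainder everywhere. The gradient is required to be measurable so that it can be
averaged against a Gaussian.
\<close>

definition C11 :: "real \<Rightarrow> ('a::euclidean_space \<Rightarrow> real) \<Rightarrow> ('a \<Rightarrow> 'a) \<Rightarrow> bool" where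
  "C11 L u h \<longleftrightarrow> 0 \<le> L \<and> u \<in> borel_measurable borel \<and> h \<in> borel_measurable borel
     \<and> (\<forall>x. norm (h x) \<le> L) \<and> (\<forall>x y. \<bar>u (x + y) - u x - h x \<bullet> y\<bar> \<le> L * (norm y)\<^sup>2)"

text \<open>
The converse of \<open>heat_exp_lower\<close> up to \<open>O(\<delta>\<^sup>2)\<close> for the drift given by the gradient. With this
drift the linear terms of \<open>W\<close> cancel against the Taylor expansion of \<open>u\<close>, so \<open>W\<close> differs from the
constant \<open>u x\<close> by only \<open>O(\<delta> (1 + |z|\<^sup>2))\<close>. Therefore \<open>ln (E exp W)\<close> and \<open>E W\<close> differ by the variance-like
quantity \<open>E ((W - u x)\<^sup>2)\<close>, which is \<open>O(\<delta>\<^sup>2)\<close>.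
\<close>

lemma heat_exp_upper:
  fixes u :: "'a::euclidean_space \<Rightarrow> real"
  assumes C: "C11 L u h" and B: "\<And>x. \<bar>u x\<bar> \<le> B"
    and d: "0 \<le> \<delta>" "\<delta> \<le> 1" "(2 * L + 2 * L ^ 3 + L\<^sup>2) * \<delta> \<le> 1 / 8"
  shows "ln (heat \<delta> (\<lambda>x. exp (u x)) x)
    \<le> heat \<delta> u (x + \<delta> *\<^sub>R h x) - \<delta> / 2 * (norm (h x))\<^sup>2
      + 128 * (2 * L + 2 * L ^ 3 + L\<^sup>2)\<^sup>2 * exp (1 / 4) * gauss_exp_moment TYPE('a) * \<delta>\<^sup>2"
proof -
  define a where "a = 2 * L + 2 * L ^ 3 + L\<^sup>2"
  have [measurable]: "u \<in> borel_measurable borel" and L: "0 \<le> L" "norm (h x) \<le> L"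
    and R: "\<And>y. \<bar>u (x + y) - u x - h x \<bullet> y\<bar> \<le> L * (norm y)\<^sup>2" using C by (auto simp: C11_def)
  define W where "W = (\<lambda>z. u (x + \<delta> *\<^sub>R h x + sqrt \<delta> *\<^sub>R z) - sqrt \<delta> * (h x \<bullet> z) - \<delta> / 2 * (norm (h x))\<^sup>2)"
  have um: "u \<in> borel_measurable borel" by measurable
  have W: "integrable gauss W" "integrable gauss (\<lambda>z. exp (W z))"
    "(\<integral>z. W z \<partial>gauss) = heat \<delta> u (x + \<delta> *\<^sub>R h x) - \<delta> / 2 * (norm (h x))\<^sup>2"
    "(\<integral>z. exp (W z) \<partial>gauss) = heat \<delta> (\<lambda>x. exp (u x)) x"
    unfolding W_def by (rule heat_exp_tilt[OF um B d(1)])+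
  have a0: "0 \<le> a" using L by (simp add: a_def)
  have Rz: "\<bar>W z - u x\<bar> \<le> a * \<delta> * (1 + (norm z)\<^sup>2)" for z
  proof -
    let ?y = "\<delta> *\<^sub>R h x + sqrt \<delta> *\<^sub>R z"
    have e: "W z - u x = (u (x + ?y) - u x - h x \<bullet> ?y) + \<delta> / 2 * (norm (h x))\<^sup>2"
      by (simp add: W_def inner_add_right power2_norm_eq_inner add.assoc)
    have h2: "(norm (h x))\<^sup>2 \<le> L\<^sup>2" using L by (simp add: power_mono)
    have "(norm ?y)\<^sup>2 \<le> (norm (\<delta> *\<^sub>R h x) + norm (sqrt \<delta> *\<^sub>R z))\<^sup>2"
      by (intro power_mono norm_triangle_ineq) simp
    also have "\<dots> \<le> 2 * (norm (\<delta> *\<^sub>R h x))\<^sup>2 + 2 * (norm (sqrt \<delta> *\<^sub>R z))\<^sup>2"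
      using sum_squares_bound[of "norm (\<delta> *\<^sub>R h x)" "norm (sqrt \<delta> *\<^sub>R z)"]
      by (simp only: power2_sum)
    also have "\<dots> = 2 * \<delta>\<^sup>2 * (norm (h x))\<^sup>2 + 2 * \<delta> * (norm z)\<^sup>2"
      using d by (simp add: power_mult_distrib)
    also have "\<dots> \<le> 2 * \<delta> * L\<^sup>2 + 2 * \<delta> * (norm z)\<^sup>2"
    proof -
      have "\<delta>\<^sup>2 * (norm (h x))\<^sup>2 \<le> \<delta> * L\<^sup>2"
        using d h2 by (intro mult_mono) (auto simp: power2_eq_square mult_left_le)
      then show ?thesis by simp
    qed
    finally have y: "(norm ?y)\<^sup>2 \<le> 2 * \<delta> * L\<^sup>2 + 2 * \<delta> * (norm z)\<^sup>2" .
    have "\<bar>W z - u x\<bar> \<le> L * (norm ?y)\<^sup>2 + \<delta> / 2 * (norm (h x))\<^sup>2"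
      unfolding e using R[of ?y] d by (intro order_trans[OF abs_triangle_ineq] add_mono) auto
    also have "\<dots> \<le> L * (2 * \<delta> * L\<^sup>2 + 2 * \<delta> * (norm z)\<^sup>2) + \<delta> * L\<^sup>2"
      using y h2 L d by (intro add_mono mult_left_mono mult_mono) auto
    also have "\<dots> \<le> a * \<delta> * (1 + (norm z)\<^sup>2)"
    proof -
      have "0 \<le> 2 * L * \<delta> + (2 * L ^ 3 * \<delta> + L\<^sup>2 * \<delta>) * (norm z)\<^sup>2" using L d by simp
      then show ?thesis by (simp add: a_def algebra_simps power2_eq_square power3_eq_cube)
    qed
    finally show ?thesis .
  qed
  define K where "K = 128 * a\<^sup>2 * exp (1 / 4)"
  have q: "(W z - u x)\<^sup>2 * exp \<bar>W z - u x\<bar> \<le> K * \<delta>\<^sup>2 * exp ((norm z)\<^sup>2 / 4)" for z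
  proof -
    define s where "s = 1 + (norm z)\<^sup>2"
    have s: "0 \<le> s" by (simp add: s_def)
    have r: "\<bar>W z - u x\<bar> \<le> a * \<delta> * s" using Rz by (simp add: s_def)
    \<comment> \<open>The smallness of \<open>\<delta>\<close> leaves half of the exponent \<open>s / 4\<close> for the factor \<open>s\<^sup>2\<close>.\<close>
    have r8: "a * \<delta> * s \<le> s / 8"
      using mult_right_mono[OF d(3) s] by (simp add: a_def)
    have "(s / 8)\<^sup>2 \<le> 2 * exp (s / 8)"
      using exp_lower_Taylor_quadratic[of "s / 8"] s by (simp add: power2_eq_square field_simps)
    then have s2: "s\<^sup>2 \<le> 128 * exp (s / 8)" by (simp add: power2_eq_square)
    have "(W z - u x)\<^sup>2 * exp \<bar>W z - u x\<bar> \<le> (a * \<delta> * s)\<^sup>2 * exp (s / 8)"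
      using r r8 by (intro mult_mono) (auto simp: abs_le_square_iff[symmetric] intro: order_trans)
    also have "\<dots> = (a * \<delta>)\<^sup>2 * (s\<^sup>2 * exp (s / 8))" by (simp add: power_mult_distrib)
    also have "\<dots> \<le> (a * \<delta>)\<^sup>2 * (128 * exp (s / 8) * exp (s / 8))"
      using s2 by (intro mult_left_mono mult_right_mono) auto
    also have "\<dots> = K * \<delta>\<^sup>2 * exp ((norm z)\<^sup>2 / 4)"
      by (simp add: K_def s_def power_mult_distrib mult_exp_exp add_divide_distrib mult.assoc)
    finally show ?thesis .
  qed
  have iR: "integrable gauss (\<lambda>z. 1 + (W z - u x))" using W(1) by auto
  have [measurable]: "W \<in> borel_measurable borel" using W(1) by (simp add: borel_measurable_integrable[of gauss, simplified])
  have "norm (\<integral>z. exp (W z - u x) - (1 + (W z - u x)) \<partial>gauss) \<le> K * \<delta>\<^sup>2 * gauss_exp_moment TYPE('a)"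
  proof (rule gauss_integrable_dom(2))
    show "norm (exp (W z - u x) - (1 + (W z - u x))) \<le> K * \<delta>\<^sup>2 * exp ((norm z)\<^sup>2 / 4)" for z
      using exp_second_order[of "W z - u x"] q[of z] unfolding real_norm_def by linarith
  qed measurable
  moreover have ie: "integrable gauss (\<lambda>z. exp (W z - u x))" using W(2) by (simp add: exp_diff)
  moreover have "(\<integral>z. exp (W z - u x) - (1 + (W z - u x)) \<partial>gauss)
     = heat \<delta> (\<lambda>x. exp (u x)) x * exp (- u x) - (1 + ((\<integral>z. W z \<partial>gauss) - u x))"
    using W(1,2) ie iR
    by (subst Bochner_Integration.integral_diff)
       (simp_all add: W(4)[symmetric] exp_minus exp_diff divide_inverse)
  ultimately have "heat \<delta> (\<lambda>x. exp (u x)) x * exp (- u x)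
      \<le> 1 + ((\<integral>z. W z \<partial>gauss) - u x + K * \<delta>\<^sup>2 * gauss_exp_moment TYPE('a))" by (simp add: abs_le_iff)
  also have "\<dots> \<le> exp ((\<integral>z. W z \<partial>gauss) - u x + K * \<delta>\<^sup>2 * gauss_exp_moment TYPE('a))"
    by (rule exp_ge_add_one_self)
  finally have "heat \<delta> (\<lambda>x. exp (u x)) x \<le> exp ((\<integral>z. W z \<partial>gauss) + K * \<delta>\<^sup>2 * gauss_exp_moment TYPE('a))"
    by (simp add: exp_add exp_diff exp_minus field_simps)
  moreover have "0 < heat \<delta> (\<lambda>x. exp (u x)) x"
    using heat_exp_pos(1)[OF um B, of \<delta> x] by (meson exp_gt_zero order_less_le_trans)
  ultimately have "ln (heat \<delta> (\<lambda>x. exp (u x)) x) \<le> (\<integral>z. W z \<partial>gauss) + K * \<delta>\<^sup>2 * gauss_exp_moment TYPE('a)"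
    using ln_le_cancel_iff ln_exp exp_gt_zero by metis
  then show ?thesis using W(3) by (simp add: K_def a_def mult_ac)
qed

section \<open>Regularity along the heat flow\<close>

text \<open>
For increments of length at most \<open>1\<close> the gradient and the remainder give the bound, for longer ones
the boundedness of \<open>u\<close> does.
\<close>

lemma C11_lipschitz:
  assumes C: "C11 L u h" and B: "\<And>x. \<bar>u x\<bar> \<le> B"
  shows "\<bar>u (x + y) - u x\<bar> \<le> (2 * L + 2 * B) * norm y"
proof (cases "norm y \<le> 1")
  case True
  have L: "0 \<le> L" "norm (h x) \<le> L" "\<bar>u (x + y) - u x - h x \<bullet> y\<bar> \<le> L * (norm y)\<^sup>2"
    using C by (auto simp: C11_def)
  have B0: "0 \<le> B" using B[of x] by linarith
  have "\<bar>h x \<bullet> y\<bar> \<le> L * norm y"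
    using Cauchy_Schwarz_ineq2[of "h x" y] mult_right_mono[OF L(2), of "norm y"] by auto
  moreover have "L * (norm y)\<^sup>2 \<le> L * norm y"
    using True L(1) by (intro mult_left_mono) (auto simp: power2_eq_square mult_left_le)
  moreover have "0 \<le> B * norm y" using B0 by simp
  ultimately show ?thesis using L(3) by (simp add: algebra_simps)
next
  case False
  have L: "0 \<le> L" using C by (auto simp: C11_def)
  have B0: "0 \<le> B" using B[of x] by linarith
  have "\<bar>u (x + y) - u x\<bar> \<le> 2 * B" using B[of x] B[of "x + y"] by linarith
  also have "\<dots> \<le> (2 * L + 2 * B) * 1" using L by simp
  also have "\<dots> \<le> (2 * L + 2 * B) * norm y"
    using False L B0 by (intro mult_left_mono) auto
  finally show ?thesis .
qed

lemma C11_lipschitz_sq: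
  assumes C: "C11 L u h" and B: "\<And>x. \<bar>u x\<bar> \<le> B"
  shows "(u (x + y) - u x)\<^sup>2 \<le> (2 * L + 2 * B)\<^sup>2 * (norm y)\<^sup>2"
  using power_mono[OF C11_lipschitz[OF assms, of x y] abs_ge_zero, of 2]
  by (simp add: power_mult_distrib)

lemma C11_exp:
  assumes C: "C11 L u h" and B: "\<And>x. \<bar>u x\<bar> \<le> B"
  shows "C11 (exp B * L + exp B * ((2 * L + 2 * B)\<^sup>2 * exp (2 * B) + L)) (\<lambda>x. exp (u x)) (\<lambda>x. exp (u x) *\<^sub>R h x)"
proof -
  have L: "0 \<le> L" and [measurable]: "u \<in> borel_measurable borel" "h \<in> borel_measurable borel"
    using C by (auto simp: C11_def)
  have eB: "exp (u x) \<le> exp B" for x using B[of x] by simp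
  have n: "norm (h x) \<le> L" for x using C by (auto simp: C11_def)
  define K where "K = (2 * L + 2 * B)\<^sup>2"
  have K: "0 \<le> K" by (simp add: K_def)
  have n1: "norm (exp (u x) *\<^sub>R h x) \<le> exp B * L + exp B * (K * exp (2 * B) + L)" for x
  proof -
    have "norm (exp (u x) *\<^sub>R h x) \<le> exp B * L"
      using eB[of x] n[of x] by (simp add: mult_mono)
    also have "\<dots> \<le> exp B * L + exp B * (K * exp (2 * B) + L)" using L K by simp
    finally show ?thesis .
  qed
  have n2: "\<bar>exp (u (x + y)) - exp (u x) - (exp (u x) *\<^sub>R h x) \<bullet> y\<bar>
     \<le> (exp B * L + exp B * (K * exp (2 * B) + L)) * (norm y)\<^sup>2" for x y
  proof -
    define d where "d = u (x + y) - u x"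
    have d1: "d\<^sup>2 \<le> K * (norm y)\<^sup>2" using C11_lipschitz_sq[OF assms, of x y] by (simp add: d_def K_def)
    have d2: "\<bar>d\<bar> \<le> 2 * B" using B[of x] B[of "x + y"] by (simp add: d_def)
    have d3: "\<bar>d - h x \<bullet> y\<bar> \<le> L * (norm y)\<^sup>2" using C by (auto simp: C11_def d_def)
    have "\<bar>exp d - 1 - d\<bar> \<le> K * (norm y)\<^sup>2 * exp (2 * B)"
      using exp_second_order[of d] mult_mono[OF d1, of "exp \<bar>d\<bar>" "exp (2 * B)"] d2 K by auto
    then have "\<bar>exp d - 1 - h x \<bullet> y\<bar> \<le> K * (norm y)\<^sup>2 * exp (2 * B) + L * (norm y)\<^sup>2"
      using d3 by linarith
    then have "\<bar>exp d - 1 - h x \<bullet> y\<bar> \<le> (K * exp (2 * B) + L) * (norm y)\<^sup>2"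
      by (simp add: algebra_simps)
    moreover have "\<bar>exp (u (x + y)) - exp (u x) - (exp (u x) *\<^sub>R h x) \<bullet> y\<bar> = exp (u x) * \<bar>exp d - 1 - h x \<bullet> y\<bar>"
    proof -
      have "exp (u (x + y)) = exp (u x) * exp d" by (simp add: d_def mult_exp_exp)
      then have "exp (u (x + y)) - exp (u x) - (exp (u x) *\<^sub>R h x) \<bullet> y = exp (u x) * (exp d - 1 - h x \<bullet> y)"
        by (simp add: algebra_simps)
      then show ?thesis by (simp add: abs_mult)
    qed
    ultimately have "\<bar>exp (u (x + y)) - exp (u x) - (exp (u x) *\<^sub>R h x) \<bullet> y\<bar> \<le> exp B * ((K * exp (2 * B) + L) * (norm y)\<^sup>2)"
      using eB[of x] by (simp add: mult_mono)
    moreover have "0 \<le> exp B * L * (norm y)\<^sup>2" using L by simp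
    ultimately show ?thesis by (simp add: algebra_simps)
  qed
  show ?thesis unfolding C11_def K_def[symmetric] using n1 n2 L K by auto
qed

text \<open>
The constant does not deteriorate with time, because the estimates are averages of the initial ones.
This is what makes the error bounds uniform along the flow.
\<close>

lemma C11_heat:
  fixes u :: "'a::euclidean_space \<Rightarrow> real"
  assumes C: "C11 L u h" and B: "\<And>x. \<bar>u x\<bar> \<le> B"
  shows "C11 L (heat t u) (heat t h)"
proof -
  have L: "0 \<le> L" and um: "u \<in> borel_measurable borel" and hm: "h \<in> borel_measurable borel"
    and hL: "\<And>x. norm (h x) \<le> L"
    and R: "\<And>x y. \<bar>u (x + y) - u x - h x \<bullet> y\<bar> \<le> L * (norm y)\<^sup>2"
    using C by (auto simp: C11_def)
  note um[measurable] hm[measurable]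
  have "\<bar>heat t u (x + y) - heat t u x - heat t h x \<bullet> y\<bar> \<le> L * (norm y)\<^sup>2" for x y
  proof -
    have iu: "integrable gauss (\<lambda>z. u (x + sqrt t *\<^sub>R z))" for x
      by (rule heat_integrable[OF um]) (use B in auto)
    have ih: "integrable gauss (\<lambda>z. h (x + sqrt t *\<^sub>R z))"
      by (rule heat_integrable[OF hm hL])
    have iuy: "integrable gauss (\<lambda>z. u (x + sqrt t *\<^sub>R z + y))"
      using iu[of "x + y"] by (simp add: ac_simps)
    have huy: "heat t u (x + y) = (\<integral>z. u (x + sqrt t *\<^sub>R z + y) \<partial>gauss)"
      by (simp add: heat_def ac_simps)
    have ihy: "integrable gauss (\<lambda>z. h (x + sqrt t *\<^sub>R z) \<bullet> y)"
      using ih by (rule integrable_inner_left)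
    have "(\<integral>z. h (x + sqrt t *\<^sub>R z) \<bullet> y \<partial>gauss) = heat t h x \<bullet> y"
      unfolding heat_def by (rule integral_inner_left) (use ih in auto)
    then have "heat t u (x + y) - heat t u x - heat t h x \<bullet> y
      = (\<integral>z. u (x + sqrt t *\<^sub>R z + y) - u (x + sqrt t *\<^sub>R z) - h (x + sqrt t *\<^sub>R z) \<bullet> y \<partial>gauss)"
      using iuy iu[of x] ihy unfolding huy by (simp add: heat_def)
    also have "\<bar>\<dots>\<bar> \<le> L * (norm y)\<^sup>2"
    proof -
      have i: "integrable gauss (\<lambda>z. u (x + sqrt t *\<^sub>R z + y) - u (x + sqrt t *\<^sub>R z) - h (x + sqrt t *\<^sub>R z) \<bullet> y)"
        using iuy iu[of x] ihy by (intro Bochner_Integration.integrable_diff)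
      have "norm (\<integral>z. u (x + sqrt t *\<^sub>R z + y) - u (x + sqrt t *\<^sub>R z) - h (x + sqrt t *\<^sub>R z) \<bullet> y \<partial>gauss)
        \<le> (\<integral>z. norm (u (x + sqrt t *\<^sub>R z + y) - u (x + sqrt t *\<^sub>R z) - h (x + sqrt t *\<^sub>R z) \<bullet> y) \<partial>gauss)"
        by (rule integral_norm_bound)
      also have "\<dots> \<le> (\<integral>z. L * (norm y)\<^sup>2 \<partial>(gauss :: 'a measure))"
        by (rule Bochner_Integration.integral_mono) (use i R in auto)
      finally show ?thesis by simp
    qed
    finally show ?thesis by simp
  qed
  then show ?thesis using L heat_norm_le[OF hm hL] by (auto simp: C11_def)
qed

lemma ln_second_order:
  fixes r :: real assumes "0 < r"
  shows "\<bar>ln r - (r - 1)\<bar> \<le> (r - 1)\<^sup>2 / r"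
proof -
  have "ln r \<le> r - 1" using ln_le_minus_one[OF assms] .
  moreover have "ln (1 / r) \<le> 1 / r - 1" using ln_le_minus_one[of "1 / r"] assms by simp
  then have "1 - 1 / r \<le> ln r" using assms by (simp add: ln_div)
  moreover have "(r - 1) - (1 - 1 / r) = (r - 1)\<^sup>2 / r" using assms by (simp add: field_simps power2_eq_square)
  ultimately show ?thesis by linarith
qed

lemma C11_ln:
  assumes C: "C11 L F h" and B: "\<And>x. \<bar>F x\<bar> \<le> B" and m: "0 < m" "\<And>x. m \<le> F x"
  shows "C11 (L / m + (2 * L + 2 * B)\<^sup>2 / m\<^sup>2) (\<lambda>x. ln (F x)) (\<lambda>x. (1 / F x) *\<^sub>R h x)"
proof -
  have L: "0 \<le> L" and [measurable]: "F \<in> borel_measurable borel" "h \<in> borel_measurable borel"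
    using C by (auto simp: C11_def)
  have n: "norm (h x) \<le> L" for x using C by (auto simp: C11_def)
  have F: "0 < F x" for x using m(2)[of x] m(1) by linarith
  define K where "K = (2 * L + 2 * B)\<^sup>2"
  have K: "0 \<le> K" by (simp add: K_def)
  have n1: "norm ((1 / F x) *\<^sub>R h x) \<le> L / m + K / m\<^sup>2" for x
  proof -
    have "norm ((1 / F x) *\<^sub>R h x) = norm (h x) / F x" using F[of x] by simp
    also have "\<dots> \<le> L / m" using n[of x] m L by (intro frac_le) auto
    also have "\<dots> \<le> L / m + K / m\<^sup>2" using K by simp
    finally show ?thesis .
  qed
  have n2: "\<bar>ln (F (x + y)) - ln (F x) - ((1 / F x) *\<^sub>R h x) \<bullet> y\<bar> \<le> (L / m + K / m\<^sup>2) * (norm y)\<^sup>2" for x y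
  proof -
    define r where "r = F (x + y) / F x"
    have r: "0 < r" using F by (simp add: r_def)
    have "(r - 1)\<^sup>2 / r = (F (x + y) - F x)\<^sup>2 / (F x * F (x + y))"
      using F[of x] F[of "x + y"] by (simp add: r_def power2_eq_square field_simps)
    also have "\<dots> \<le> (K * (norm y)\<^sup>2) / (m * m)"
      using C11_lipschitz_sq[OF C B, of x y] m by (intro frac_le mult_mono) (auto simp: K_def F less_imp_le)
    finally have 1: "\<bar>ln r - (r - 1)\<bar> \<le> K * (norm y)\<^sup>2 / m\<^sup>2"
      using ln_second_order[OF r] by (simp add: power2_eq_square)
    have "\<bar>(r - 1) - ((1 / F x) *\<^sub>R h x) \<bullet> y\<bar> = \<bar>F (x + y) - F x - h x \<bullet> y\<bar> / F x"
    proof -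
      have "(r - 1) - ((1 / F x) *\<^sub>R h x) \<bullet> y = (F (x + y) - F x - h x \<bullet> y) / F x"
        using F[of x] by (simp add: r_def field_simps)
      then show ?thesis using F[of x] by simp
    qed
    also have "\<dots> \<le> L * (norm y)\<^sup>2 / m"
      using C m L by (intro frac_le) (auto simp: C11_def)
    finally have 2: "\<bar>(r - 1) - ((1 / F x) *\<^sub>R h x) \<bullet> y\<bar> \<le> L * (norm y)\<^sup>2 / m" .
    have "ln (F (x + y)) - ln (F x) = ln r"
      using F[of x] F[of "x + y"] by (simp add: r_def ln_div)
    then have "\<bar>ln (F (x + y)) - ln (F x) - ((1 / F x) *\<^sub>R h x) \<bullet> y\<bar> \<le> K * (norm y)\<^sup>2 / m\<^sup>2 + L * (norm y)\<^sup>2 / m"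
      using 1 2 by linarith
    then show ?thesis by (simp add: algebra_simps)
  qed
  show ?thesis unfolding C11_def K_def[symmetric] using n1 n2 L K m by auto
qed

text \<open>
Second-order expansion, in the translation \<open>k\<close>, of the density ratio in the Cameron--Martin formula.
\<close>

lemma gauss_tilt_remainder:
  fixes k z :: "'a::euclidean_space"
  assumes "norm k \<le> 1"
  shows "\<bar>exp (k \<bullet> z - (norm k)\<^sup>2 / 2) - 1 - k \<bullet> z\<bar> \<le> 3 * exp 6 * (norm k)\<^sup>2 * exp ((norm z)\<^sup>2 / 4)"
proof -
  define a where "a = k \<bullet> z - (norm k)\<^sup>2 / 2"
  define s where "s = norm z + 1"
  have s: "1 \<le> s" by (simp add: s_def)
  have k2: "(norm k)\<^sup>2 \<le> norm k" using assms by (simp add: power2_eq_square mult_left_le)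
  have "\<bar>a\<bar> \<le> norm k * norm z + norm k"
    using Cauchy_Schwarz_ineq2[of k z] k2 zero_le_power2[of "norm k"] unfolding a_def by linarith
  then have a: "\<bar>a\<bar> \<le> norm k * s" by (simp add: s_def algebra_simps)
  then have a': "\<bar>a\<bar> \<le> s" using mult_right_mono[OF assms, of s] s by linarith
  have "s\<^sup>2 \<le> 2 * exp s" using exp_lower_Taylor_quadratic[of s] s by (simp add: field_simps)
  have "a\<^sup>2 * exp \<bar>a\<bar> \<le> (norm k * s)\<^sup>2 * exp s"
    using a a' s by (intro mult_mono) (auto simp: abs_le_square_iff[symmetric] intro: order_trans)
  also have "\<dots> = (norm k)\<^sup>2 * (s\<^sup>2 * exp s)" by (simp add: power_mult_distrib)
  also have "\<dots> \<le> (norm k)\<^sup>2 * (2 * exp s * exp s)"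
    using \<open>s\<^sup>2 \<le> 2 * exp s\<close> by (intro mult_left_mono mult_right_mono) auto
  finally have 1: "a\<^sup>2 * exp \<bar>a\<bar> \<le> 2 * (norm k)\<^sup>2 * exp (2 * s)"
    by (simp add: mult.assoc mult.left_commute flip: exp_add)
  have "\<bar>exp a - 1 - k \<bullet> z\<bar> \<le> \<bar>exp a - 1 - a\<bar> + (norm k)\<^sup>2 / 2"
    using zero_le_power2[of "norm k"] unfolding a_def by linarith
  also have "\<dots> \<le> 2 * (norm k)\<^sup>2 * exp (2 * s) + (norm k)\<^sup>2 * exp (2 * s)"
    using exp_second_order[of a] 1 s mult_left_mono[of 1 "exp (2 * s)" "(norm k)\<^sup>2"] zero_le_power2[of "norm k"]
    by (intro add_mono) auto
  also have "\<dots> = 3 * (norm k)\<^sup>2 * exp (2 * s)" by simp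
  \<comment> \<open>\<open>2 |z| \<le> 4 + |z|\<^sup>2 / 4\<close>, and \<open>2 * s = 2 |z| + 2\<close>.\<close>
  also have "\<dots> \<le> 3 * (norm k)\<^sup>2 * exp (6 + (norm z)\<^sup>2 / 4)"
    using zero_le_power2[of "norm z - 4"]
    by (intro mult_left_mono) (simp_all add: s_def power2_eq_square algebra_simps)
  finally show ?thesis by (simp add: a_def exp_add mult_ac)
qed

text \<open>
Mollification makes bounded functions \<open>C\<^sup>1\<^sup>,\<^sup>1\<close>: by the Cameron--Martin formula, a translation of the
argument can be moved onto the Gaussian density, which is smooth. The gradient is therefore
\<open>E (u (x + \<surd>\<epsilon> Z) Z) / \<surd>\<epsilon>\<close>.
\<close>

lemma heat_C11:
  fixes u :: "'a::euclidean_space \<Rightarrow> real"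
  assumes um[measurable]: "u \<in> borel_measurable borel" and B: "\<And>x. \<bar>u x\<bar> \<le> B" and e: "0 < \<epsilon>"
  shows "\<exists>L h. C11 L (heat \<epsilon> u) h"
proof -
  define M where "M = gauss_exp_moment TYPE('a)"
  have M: "0 \<le> M" by (simp add: M_def gauss_exp_moment_nonneg)
  have B0: "0 \<le> B" using B[of 0] by linarith
  define h0 where "h0 x = (\<integral>z. u (x + sqrt \<epsilon> *\<^sub>R z) *\<^sub>R z \<partial>gauss)" for x
  define h where "h x = (1 / sqrt \<epsilon>) *\<^sub>R h0 x" for x
  have [measurable]: "h0 \<in> borel_measurable borel"
    unfolding h0_def[abs_def] by (rule gauss.borel_measurable_lebesgue_integral) simp
  have bd: "norm (u (x + sqrt \<epsilon> *\<^sub>R z) *\<^sub>R z) \<le> B * exp ((norm z)\<^sup>2 / 4)" for x z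
    using B[of "x + sqrt \<epsilon> *\<^sub>R z"] norm_le_exp_sq[of z] B0 by (simp add: mult_mono)
  have ih: "integrable gauss (\<lambda>z. u (x + sqrt \<epsilon> *\<^sub>R z) *\<^sub>R z)" for x
    by (rule gauss_integrable_dom(1)[OF _ bd]) measurable
  have nh0: "norm (h0 x) \<le> B * M" for x
    unfolding h0_def M_def by (rule gauss_integrable_dom(2)[OF _ bd]) measurable
  define L0 where "L0 = B * (3 * exp 6) * M + 2 * B + B * M"
  define L where "L = B * M / sqrt \<epsilon> + L0 / \<epsilon>"
  have L0: "0 \<le> L0" "0 \<le> B * M" using B0 M by (auto simp: L0_def)
  have R: "\<bar>heat \<epsilon> u (x + y) - heat \<epsilon> u x - h x \<bullet> y\<bar> \<le> L0 / \<epsilon> * (norm y)\<^sup>2" for x y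
  proof -
    define k where "k = (1 / sqrt \<epsilon>) *\<^sub>R y"
    have k: "h x \<bullet> y = h0 x \<bullet> k" "sqrt \<epsilon> *\<^sub>R k = y" "(norm k)\<^sup>2 = (norm y)\<^sup>2 / \<epsilon>"
      using e by (auto simp: k_def h_def power_mult_distrib power_divide)
    have "\<bar>heat \<epsilon> u (x + y) - heat \<epsilon> u x - h0 x \<bullet> k\<bar> \<le> L0 * (norm k)\<^sup>2"
    proof (cases "norm k \<le> 1")
      case True
      have iu: "integrable gauss (\<lambda>z. u (x + sqrt \<epsilon> *\<^sub>R z))" for x
        by (rule heat_integrable[OF um]) (use B in auto)
      have s: "heat \<epsilon> u (x + y) = (\<integral>z. exp (k \<bullet> z - (norm k)\<^sup>2 / 2) *\<^sub>R u (x + sqrt \<epsilon> *\<^sub>R z) \<partial>gauss)"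
        using gauss_shift[of "\<lambda>z. u (x + y + sqrt \<epsilon> *\<^sub>R z)" "- k"]
        by (simp add: heat_def k(2)[symmetric] algebra_simps)
      have si: "integrable gauss (\<lambda>z. exp (k \<bullet> z - (norm k)\<^sup>2 / 2) *\<^sub>R u (x + sqrt \<epsilon> *\<^sub>R z))"
        using gauss_shift_integrable[OF _ iu[of "x + y"], of "- k"]
        by (simp add: k(2)[symmetric] algebra_simps)
      have "(\<integral>z. (u (x + sqrt \<epsilon> *\<^sub>R z) *\<^sub>R z) \<bullet> k \<partial>gauss) = h0 x \<bullet> k"
        unfolding h0_def by (rule integral_inner_left) (use ih in auto)
      moreover have "integrable gauss (\<lambda>z. (u (x + sqrt \<epsilon> *\<^sub>R z) *\<^sub>R z) \<bullet> k)"
        using ih by (rule integrable_inner_left)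
      ultimately have "heat \<epsilon> u (x + y) - heat \<epsilon> u x - h0 x \<bullet> k
        = (\<integral>z. exp (k \<bullet> z - (norm k)\<^sup>2 / 2) *\<^sub>R u (x + sqrt \<epsilon> *\<^sub>R z) - u (x + sqrt \<epsilon> *\<^sub>R z) - (u (x + sqrt \<epsilon> *\<^sub>R z) *\<^sub>R z) \<bullet> k \<partial>gauss)"
        unfolding s using iu[of x] si by (simp add: heat_def)
      also have "\<dots> = (\<integral>z. u (x + sqrt \<epsilon> *\<^sub>R z) * (exp (k \<bullet> z - (norm k)\<^sup>2 / 2) - 1 - k \<bullet> z) \<partial>gauss)"
        by (intro Bochner_Integration.integral_cong) (auto simp: algebra_simps inner_commute)
      also have "norm \<dots> \<le> B * (3 * exp 6 * (norm k)\<^sup>2) * M"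
        unfolding M_def
      proof (rule gauss_integrable_dom(2))
        show "norm (u (x + sqrt \<epsilon> *\<^sub>R z) * (exp (k \<bullet> z - (norm k)\<^sup>2 / 2) - 1 - k \<bullet> z))
          \<le> B * (3 * exp 6 * (norm k)\<^sup>2) * exp ((norm z)\<^sup>2 / 4)" for z
          unfolding real_norm_def abs_mult mult.assoc[of B]
          using B[of "x + sqrt \<epsilon> *\<^sub>R z"] gauss_tilt_remainder[OF True, of z] B0
          by (intro mult_mono) auto
      qed measurable
      also have "\<dots> = B * (3 * exp 6) * M * (norm k)\<^sup>2" by simp
      also have "\<dots> \<le> L0 * (norm k)\<^sup>2"
        unfolding L0_def using B0 M by (intro mult_right_mono) auto
      finally show ?thesis by simp
    next
      case False
      have k1: "norm k \<le> (norm k)\<^sup>2" "1 \<le> (norm k)\<^sup>2"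
        using False by (auto simp: self_le_power)
      have "\<bar>heat \<epsilon> u x\<bar> \<le> B" for x using heat_norm_le[OF um, of B \<epsilon> x] B by auto
      from this[of x] this[of "x + y"]
      have "\<bar>heat \<epsilon> u (x + y) - heat \<epsilon> u x - h0 x \<bullet> k\<bar> \<le> 2 * B + norm (h0 x) * norm k"
        using Cauchy_Schwarz_ineq2[of "h0 x" k] by linarith
      also have "\<dots> \<le> 2 * B * (norm k)\<^sup>2 + (B * M) * (norm k)\<^sup>2"
        using nh0[of x] k1 B0 L0(2) mult_left_mono[OF k1(2), of "2 * B"]
        by (intro add_mono mult_mono[of "norm (h0 x)"]) auto
      also have "\<dots> \<le> L0 * (norm k)\<^sup>2"
        unfolding L0_def using B0 M by (simp add: algebra_simps)
      finally show ?thesis .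
    qed
    then show ?thesis by (simp add: k)
  qed
  have "C11 L (heat \<epsilon> u) h"
    unfolding C11_def
  proof (intro conjI allI)
    show "0 \<le> L" using L0 e by (simp add: L_def)
    show "heat \<epsilon> u \<in> borel_measurable borel" by measurable
    show "h \<in> borel_measurable borel" unfolding h_def[abs_def] by measurable
    show "norm (h x) \<le> L" for x
    proof -
      have "norm (h x) \<le> B * M / sqrt \<epsilon>" using nh0[of x] e by (simp add: h_def divide_right_mono)
      also have "\<dots> \<le> L" using L0 e by (simp add: L_def)
      finally show ?thesis .
    qed
    show "\<bar>heat \<epsilon> u (x + y) - heat \<epsilon> u x - h x \<bullet> y\<bar> \<le> L * (norm y)\<^sup>2" for x y
    proof -
      have "L0 / \<epsilon> * (norm y)\<^sup>2 \<le> L * (norm y)\<^sup>2"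
        using L0 e by (intro mult_right_mono) (auto simp: L_def)
      then show ?thesis using R[of x y] by linarith
    qed
  qed
  then show ?thesis by blast
qed

text \<open>
One constant serves all times \<open>t\<close>, as it depends only on the \<open>C\<^sup>1\<^sup>,\<^sup>1\<close> bound of the initial data and on
the bounds \<open>exp (- B)\<close> and \<open>exp B\<close>, which are preserved by the flow.
\<close>

lemma ln_heat_exp_C11:
  fixes u :: "'a::euclidean_space \<Rightarrow> real"
  assumes um: "u \<in> borel_measurable borel" and B: "\<And>x. \<bar>u x\<bar> \<le> B" and e: "0 < \<epsilon>"
  shows "\<exists>L. \<forall>t. \<exists>h. C11 L (\<lambda>x. ln (heat t (\<lambda>x. exp (heat \<epsilon> u x)) x)) h"
proof -
  obtain L0 h0 where 0: "C11 L0 (heat \<epsilon> u) h0" using heat_C11[OF assms] by blast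
  have B0: "\<bar>heat \<epsilon> u x\<bar> \<le> B" for x using heat_norm_le[OF um, of B \<epsilon> x] B by auto
  have m0: "heat \<epsilon> u \<in> borel_measurable borel" using um by measurable
  obtain L1 h1 where 1: "C11 L1 (\<lambda>x. exp (heat \<epsilon> u x)) h1" using C11_exp[OF 0 B0] by blast
  have 2: "C11 L1 (heat t (\<lambda>x. exp (heat \<epsilon> u x))) (heat t h1)" for t
    by (rule C11_heat[OF 1, of "exp B"]) (use exp_bounded_measurable[OF m0 B0] in auto)
  have pos: "exp (- B) \<le> heat t (\<lambda>x. exp (heat \<epsilon> u x)) y" "heat t (\<lambda>x. exp (heat \<epsilon> u x)) y \<le> exp B" for t y
    using heat_exp_pos[OF m0 B0] by auto
  have ab: "\<bar>heat t (\<lambda>x. exp (heat \<epsilon> u x)) y\<bar> \<le> exp B" for t y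
    using pos(1)[of t y] pos(2)[of t y] exp_gt_zero[of "- B"] by linarith
  show ?thesis
    by (intro exI allI, rule C11_ln[OF 2 ab exp_gt_zero pos(1)])
qed

section \<open>The inequality along the heat flow\<close>

lemma C11_mono: "C11 L u h \<Longrightarrow> L \<le> L' \<Longrightarrow> C11 L' u h"
  unfolding C11_def by (meson mult_right_mono order_trans zero_le_power2)

text \<open>
The finite-dimensional content of the hypotheses: a linear contraction between two weighted sums of
copies of a Euclidean space that fixes the constant configurations.
\<close>

locale translation_contraction =
  fixes S :: "'s set" and T :: "'t set" and c :: "'s \<Rightarrow> real" and d :: "'t \<Rightarrow> real"
    and A :: "('s \<Rightarrow> 'a::euclidean_space) \<Rightarrow> 't \<Rightarrow> 'a"
  assumes finite_S: "finite S" and finite_T: "finite T"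
    and c_pos: "\<And>s. s \<in> S \<Longrightarrow> 0 < c s" and d_pos: "\<And>t. t \<in> T \<Longrightarrow> 0 < d t"
    and mass: "(\<Sum>s\<in>S. c s) = (\<Sum>t\<in>T. d t)"
    and A_add: "\<And>x y t. t \<in> T \<Longrightarrow> A (\<lambda>s. x s + y s) t = A x t + A y t"
    and A_scaleR: "\<And>r x t. t \<in> T \<Longrightarrow> A (\<lambda>s. r *\<^sub>R x s) t = r *\<^sub>R A x t"
    and A_const: "\<And>v t. t \<in> T \<Longrightarrow> A (\<lambda>_. v) t = v"
    and A_contr: "\<And>x. (\<Sum>t\<in>T. d t * (norm (A x t))\<^sup>2) \<le> (\<Sum>s\<in>S. c s * (norm (x s))\<^sup>2)"
begin

text \<open>
Averaging the hypothesis over a common Gaussian translation of all points. As \<open>A\<close> is additive and fixes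
constants, the same translation appears at every point on the side of \<open>T\<close>.
\<close>

lemma heat_ineq:
  assumes u: "\<And>s. s \<in> S \<Longrightarrow> u s \<in> borel_measurable borel" "\<And>s x. s \<in> S \<Longrightarrow> \<bar>u s x\<bar> \<le> B"
    and v: "\<And>t. t \<in> T \<Longrightarrow> v t \<in> borel_measurable borel" "\<And>t x. t \<in> T \<Longrightarrow> \<bar>v t x\<bar> \<le> B"
    and le: "\<And>x. (\<Sum>s\<in>S. c s * u s (x s)) \<le> (\<Sum>t\<in>T. d t * v t (A x t)) + E"
  shows "(\<Sum>s\<in>S. c s * heat \<delta> (u s) (x s)) \<le> (\<Sum>t\<in>T. d t * heat \<delta> (v t) (A x t)) + E"
proof -
  have iu: "integrable gauss (\<lambda>z. u s (x s + sqrt \<delta> *\<^sub>R z))" if "s \<in> S" for s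
    by (rule heat_integrable[of _ B]) (use u that in auto)
  have iv: "integrable gauss (\<lambda>z. v t (A x t + sqrt \<delta> *\<^sub>R z))" if "t \<in> T" for t
    by (rule heat_integrable[of _ B]) (use v that in auto)
  have "(\<Sum>s\<in>S. c s * heat \<delta> (u s) (x s)) = (\<integral>z. (\<Sum>s\<in>S. c s * u s (x s + sqrt \<delta> *\<^sub>R z)) \<partial>gauss)"
    unfolding heat_def using iu by (subst Bochner_Integration.integral_sum) auto
  also have "\<dots> \<le> (\<integral>z. (\<Sum>t\<in>T. d t * v t (A x t + sqrt \<delta> *\<^sub>R z)) + E \<partial>gauss)"
  proof (rule Bochner_Integration.integral_mono)
    fix z :: 'a
    have "A (\<lambda>s. x s + sqrt \<delta> *\<^sub>R z) t = A x t + sqrt \<delta> *\<^sub>R z" if "t \<in> T" for t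
      using A_add[OF that, of x "\<lambda>_. sqrt \<delta> *\<^sub>R z"] A_const[OF that] by simp
    then show "(\<Sum>s\<in>S. c s * u s (x s + sqrt \<delta> *\<^sub>R z)) \<le> (\<Sum>t\<in>T. d t * v t (A x t + sqrt \<delta> *\<^sub>R z)) + E"
      using le[of "\<lambda>s. x s + sqrt \<delta> *\<^sub>R z"] by simp
  qed (use iu iv in auto)
  also have "\<dots> = (\<Sum>t\<in>T. d t * heat \<delta> (v t) (A x t)) + E"
    unfolding heat_def using iv
    by (subst Bochner_Integration.integral_add) (auto simp: Bochner_Integration.integral_sum)
  finally show ?thesis .
qed

text \<open>
The heart of the proof. The drifts on the side of \<open>S\<close> are the gradients, for which
\<open>heat_exp_upper\<close> is sharp; those on the side of \<open>T\<close> are their image under \<open>A\<close>, which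
\<open>heat_exp_lower\<close> permits because it accepts any drift. The contraction property compares the costs.
\<close>

lemma one_step:
  assumes u: "\<And>s. s \<in> S \<Longrightarrow> C11 L (u s) (h s)" "\<And>s x. s \<in> S \<Longrightarrow> \<bar>u s x\<bar> \<le> B"
    and v: "\<And>t. t \<in> T \<Longrightarrow> v t \<in> borel_measurable borel" "\<And>t x. t \<in> T \<Longrightarrow> \<bar>v t x\<bar> \<le> B"
    and le: "\<And>x. (\<Sum>s\<in>S. c s * u s (x s)) \<le> (\<Sum>t\<in>T. d t * v t (A x t)) + E"
    and \<delta>: "0 \<le> \<delta>" "\<delta> \<le> 1" "(2 * L + 2 * L ^ 3 + L\<^sup>2) * \<delta> \<le> 1 / 8"
  defines "K \<equiv> 128 * (2 * L + 2 * L ^ 3 + L\<^sup>2)\<^sup>2 * exp (1 / 4) * gauss_exp_moment TYPE('a)"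
  shows "(\<Sum>s\<in>S. c s * ln (heat \<delta> (\<lambda>x. exp (u s x)) (x s)))
    \<le> (\<Sum>t\<in>T. d t * ln (heat \<delta> (\<lambda>x. exp (v t x)) (A x t))) + E + (\<Sum>s\<in>S. c s) * K * \<delta>\<^sup>2"
proof -
  define \<eta> where "\<eta> = (\<lambda>s. h s (x s))"
  have A\<eta>: "A (\<lambda>s. x s + \<delta> *\<^sub>R \<eta> s) t = A x t + \<delta> *\<^sub>R A \<eta> t" if "t \<in> T" for t
    using that by (simp add: A_add A_scaleR)
  have "(\<Sum>s\<in>S. c s * ln (heat \<delta> (\<lambda>x. exp (u s x)) (x s)))
    \<le> (\<Sum>s\<in>S. c s * (heat \<delta> (u s) (x s + \<delta> *\<^sub>R \<eta> s) - \<delta> / 2 * (norm (\<eta> s))\<^sup>2 + K * \<delta>\<^sup>2))"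
    unfolding K_def \<eta>_def
    by (intro sum_mono mult_left_mono heat_exp_upper[OF u(1) u(2) \<delta>]) (auto simp: c_pos less_imp_le)
  also have "\<dots> = (\<Sum>s\<in>S. c s * heat \<delta> (u s) (x s + \<delta> *\<^sub>R \<eta> s)) - \<delta> / 2 * (\<Sum>s\<in>S. c s * (norm (\<eta> s))\<^sup>2) + (\<Sum>s\<in>S. c s) * K * \<delta>\<^sup>2"
    by (simp add: algebra_simps sum.distrib sum_subtractf sum_distrib_left sum_distrib_right sum_divide_distrib)
  also have "\<dots> \<le> (\<Sum>t\<in>T. d t * heat \<delta> (v t) (A x t + \<delta> *\<^sub>R A \<eta> t)) + E - \<delta> / 2 * (\<Sum>t\<in>T. d t * (norm (A \<eta> t))\<^sup>2) + (\<Sum>s\<in>S. c s) * K * \<delta>\<^sup>2"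
  proof -
    have "(\<Sum>s\<in>S. c s * heat \<delta> (u s) (x s + \<delta> *\<^sub>R \<eta> s)) \<le> (\<Sum>t\<in>T. d t * heat \<delta> (v t) (A (\<lambda>s. x s + \<delta> *\<^sub>R \<eta> s) t)) + E"
      by (rule heat_ineq[of u B v E]) (use u v le in \<open>auto simp: C11_def\<close>)
    moreover have "\<delta> / 2 * (\<Sum>t\<in>T. d t * (norm (A \<eta> t))\<^sup>2) \<le> \<delta> / 2 * (\<Sum>s\<in>S. c s * (norm (\<eta> s))\<^sup>2)"
      using \<delta> by (intro mult_left_mono A_contr) auto
    ultimately show ?thesis by (simp add: A\<eta>)
  qed
  also have "\<dots> = (\<Sum>t\<in>T. d t * (heat \<delta> (v t) (A x t + \<delta> *\<^sub>R A \<eta> t) - \<delta> / 2 * (norm (A \<eta> t))\<^sup>2)) + E + (\<Sum>s\<in>S. c s) * K * \<delta>\<^sup>2"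
    by (simp add: algebra_simps sum.distrib sum_subtractf sum_distrib_left sum_distrib_right sum_divide_distrib)
  also have "\<dots> \<le> (\<Sum>t\<in>T. d t * ln (heat \<delta> (\<lambda>x. exp (v t x)) (A x t))) + E + (\<Sum>s\<in>S. c s) * K * \<delta>\<^sup>2"
    by (intro add_right_mono sum_mono mult_left_mono heat_exp_lower[OF v \<delta>(1)]) (auto simp: d_pos less_imp_le)
  finally show ?thesis .
qed

text \<open>
Iterating \<open>one_step\<close> over \<open>N\<close> intervals of length \<open>\<tau> / N\<close> accumulates an error of \<open>N * O((\<tau> / N)\<^sup>2)\<close>,
which vanishes as \<open>N\<close> grows. The semigroup law identifies \<open>k\<close> steps of length \<open>\<delta>\<close> with the flow
at time \<open>k * \<delta>\<close>.
\<close>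

lemma heat_flow_mollified:
  assumes u: "\<And>s. s \<in> S \<Longrightarrow> u s \<in> borel_measurable borel" "\<And>s x. s \<in> S \<Longrightarrow> \<bar>u s x\<bar> \<le> B"
    and v: "\<And>t. t \<in> T \<Longrightarrow> v t \<in> borel_measurable borel" "\<And>t x. t \<in> T \<Longrightarrow> \<bar>v t x\<bar> \<le> B"
    and le: "\<And>x. (\<Sum>s\<in>S. c s * u s (x s)) \<le> (\<Sum>t\<in>T. d t * v t (A x t))"
    and \<epsilon>: "0 < \<epsilon>" and \<tau>: "0 < \<tau>"
  shows "(\<Sum>s\<in>S. c s * ln (heat \<tau> (\<lambda>x. exp (heat \<epsilon> (u s) x)) (x s)))
    \<le> (\<Sum>t\<in>T. d t * ln (heat \<tau> (\<lambda>x. exp (heat \<epsilon> (v t) x)) (A x t)))"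
proof -
  define U where "U r s = (\<lambda>x. ln (heat r (\<lambda>x. exp (heat \<epsilon> (u s) x)) x))" for r s
  define V where "V r t = (\<lambda>x. ln (heat r (\<lambda>x. exp (heat \<epsilon> (v t) x)) x))" for r t
  have bdd: "\<bar>heat \<epsilon> f x\<bar> \<le> B" if "f \<in> borel_measurable borel" "\<And>x. \<bar>f x\<bar> \<le> B" for f :: "'a \<Rightarrow> real" and x
    using heat_norm_le[of f B \<epsilon> x] that by auto
  have exp_ln_heat: "exp (ln (heat r (\<lambda>x. exp (heat \<epsilon> f x)) x)) = heat r (\<lambda>x. exp (heat \<epsilon> f x)) x"
    and ln_heat_bd: "\<bar>ln (heat r (\<lambda>x. exp (heat \<epsilon> f x)) x)\<bar> \<le> B"
    if f: "f \<in> borel_measurable borel" "\<And>x. \<bar>f x\<bar> \<le> B" for f :: "'a \<Rightarrow> real" and x r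
  proof -
    have m: "heat \<epsilon> f \<in> borel_measurable borel" using f by measurable
    note b = heat_exp_pos[OF m bdd[OF f], of r x]
    have p: "0 < heat r (\<lambda>x. exp (heat \<epsilon> f x)) x" using b(1) exp_gt_zero[of "- B"] by linarith
    then show "exp (ln (heat r (\<lambda>x. exp (heat \<epsilon> f x)) x)) = heat r (\<lambda>x. exp (heat \<epsilon> f x)) x" by simp
    show "\<bar>ln (heat r (\<lambda>x. exp (heat \<epsilon> f x)) x)\<bar> \<le> B"
    proof -
      have "ln (heat r (\<lambda>x. exp (heat \<epsilon> f x)) x) \<le> ln (exp B)"
        using b p by (subst ln_le_cancel_iff) auto
      moreover have "- B \<le> ln (heat r (\<lambda>x. exp (heat \<epsilon> f x)) x)"
        using b p by (simp add: ln_ge_iff)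
      ultimately show ?thesis by simp
    qed
  qed
  have "\<exists>L. \<forall>s\<in>S. \<forall>r. \<exists>h. C11 L (U r s) h"
  proof -
    have "\<forall>s\<in>S. \<exists>L. \<forall>r. \<exists>h. C11 L (U r s) h"
      unfolding U_def using ln_heat_exp_C11[OF u \<epsilon>] by blast
    then obtain L where L: "\<And>s r. s \<in> S \<Longrightarrow> \<exists>h. C11 (L s) (U r s) h" by metis
    have "L s \<le> (\<Sum>s\<in>S. \<bar>L s\<bar>)" if "s \<in> S" for s
      using member_le_sum[OF that, of "\<lambda>s. \<bar>L s\<bar>"] finite_S by auto
    then show ?thesis using L C11_mono by meson
  qed
  then obtain L where L: "\<And>s r. s \<in> S \<Longrightarrow> \<exists>h. C11 L (U r s) h" by blast
  define a where "a = 2 * L + 2 * L ^ 3 + L\<^sup>2"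
  define K where "K = 128 * a\<^sup>2 * exp (1 / 4) * gauss_exp_moment TYPE('a)"
  define C where "C = (\<Sum>s\<in>S. c s) * K"
  have steps: "(\<Sum>s\<in>S. c s * U (real k * \<delta>) s (x s)) \<le> (\<Sum>t\<in>T. d t * V (real k * \<delta>) t (A x t)) + real k * (C * \<delta>\<^sup>2)"
    if \<delta>: "0 \<le> \<delta>" "\<delta> \<le> 1" "a * \<delta> \<le> 1 / 8" for k \<delta> x
  proof (induction k arbitrary: x)
    case 0
    show ?case using heat_ineq[OF u v, where E=0 and \<delta>=\<epsilon> and x=x] le by (simp add: U_def V_def)
  next
    case (Suc k)
    have "\<forall>s\<in>S. \<exists>h. C11 L (U (real k * \<delta>) s) h" using L by blast
    then obtain h where h: "\<And>s. s \<in> S \<Longrightarrow> C11 L (U (real k * \<delta>) s) (h s)" by metis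
    have hh: "heat \<delta> (\<lambda>x. exp (ln (heat (real k * \<delta>) (\<lambda>x. exp (heat \<epsilon> f x)) x))) = heat (real (Suc k) * \<delta>) (\<lambda>x. exp (heat \<epsilon> f x))"
      if f: "f \<in> borel_measurable borel" "\<And>x. \<bar>f x\<bar> \<le> B" for f :: "'a \<Rightarrow> real"
    proof -
      have m: "heat \<epsilon> f \<in> borel_measurable borel" using f by measurable
      have "heat \<delta> (heat (real k * \<delta>) (\<lambda>x. exp (heat \<epsilon> f x))) = heat (\<delta> + real k * \<delta>) (\<lambda>x. exp (heat \<epsilon> f x))"
        by (rule heat_heat[of _ "exp B"]) (use \<delta> exp_bounded_measurable[OF m bdd[OF f]] in auto)
      then show ?thesis by (simp add: exp_ln_heat[OF f] algebra_simps)
    qed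
    have "(\<Sum>s\<in>S. c s * ln (heat \<delta> (\<lambda>x. exp (U (real k * \<delta>) s x)) (x s)))
      \<le> (\<Sum>t\<in>T. d t * ln (heat \<delta> (\<lambda>x. exp (V (real k * \<delta>) t x)) (A x t))) + real k * (C * \<delta>\<^sup>2) + C * \<delta>\<^sup>2"
      unfolding C_def K_def a_def
    proof (rule one_step[OF h])
      show "\<bar>U (real k * \<delta>) s x\<bar> \<le> B" if "s \<in> S" for s x
        unfolding U_def using u that by (intro ln_heat_bd) auto
      show "\<bar>V (real k * \<delta>) s x\<bar> \<le> B" if "s \<in> T" for s x
        unfolding V_def using v that by (intro ln_heat_bd) auto
      show "V (real k * \<delta>) s \<in> borel_measurable borel" if "s \<in> T" for s
      proof -
        note v(1)[OF that, measurable]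
        show ?thesis unfolding V_def by measurable
      qed
    qed (use \<delta> Suc in \<open>auto simp: a_def C_def K_def\<close>)
    also have "(\<Sum>s\<in>S. c s * ln (heat \<delta> (\<lambda>x. exp (U (real k * \<delta>) s x)) (x s))) = (\<Sum>s\<in>S. c s * U (real (Suc k) * \<delta>) s (x s))"
      unfolding U_def by (intro sum.cong refl arg_cong2[of _ _ _ _ "(*)"] arg_cong[of _ _ ln] fun_cong[OF hh]) (use u in auto)
    also have "(\<Sum>t\<in>T. d t * ln (heat \<delta> (\<lambda>x. exp (V (real k * \<delta>) t x)) (A x t))) = (\<Sum>t\<in>T. d t * V (real (Suc k) * \<delta>) t (A x t))"
      unfolding V_def by (intro sum.cong refl arg_cong2[of _ _ _ _ "(*)"] arg_cong[of _ _ ln] fun_cong[OF hh]) (use v in auto)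
    finally show ?case by (simp add: algebra_simps)
  qed
  have "eventually (\<lambda>N. \<tau> / real N \<le> 1 \<and> a * (\<tau> / real N) \<le> 1 / 8 \<and> 0 < N) sequentially"
  proof -
    have "(\<lambda>N. \<tau> / real N) \<longlonglongrightarrow> 0" by (rule lim_const_over_n)
    from order_tendstoD(2)[OF this, of 1] order_tendstoD(2)[OF tendsto_mult_right_zero[OF this, of a], of "1 / 8"]
    have "eventually (\<lambda>N. \<tau> / real N < 1) sequentially" "eventually (\<lambda>N. a * (\<tau> / real N) < 1 / 8) sequentially"
      by simp_all
    then show ?thesis using eventually_gt_at_top[of 0] by eventually_elim auto
  qed
  then have ev: "eventually (\<lambda>N. (\<Sum>s\<in>S. c s * U \<tau> s (x s)) \<le> (\<Sum>t\<in>T. d t * V \<tau> t (A x t)) + C * \<tau>\<^sup>2 / real N) sequentially"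
  proof eventually_elim
    case (elim N)
    then show ?case using steps[of "\<tau> / real N" N x] \<tau> by (simp add: power_divide power2_eq_square)
  qed
  have "(\<lambda>N. (\<Sum>t\<in>T. d t * V \<tau> t (A x t)) + C * \<tau>\<^sup>2 / real N) \<longlonglongrightarrow> (\<Sum>t\<in>T. d t * V \<tau> t (A x t)) + 0"
    by (intro tendsto_add tendsto_const lim_const_over_n)
  from tendsto_lowerbound[OF this ev] show ?thesis by (simp add: U_def V_def)
qed

end

section \<open>Removing the mollification\<close>

lemma ennreal_heat:
  fixes w :: "'a::euclidean_space \<Rightarrow> real"
  assumes "w \<in> borel_measurable borel" "\<And>x. 0 \<le> w x" "\<And>x. w x \<le> B"
  shows "ennreal (heat t w x) = (\<integral>\<^sup>+z. ennreal (w (x + sqrt t *\<^sub>R z)) \<partial>gauss)"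
  unfolding heat_def
proof (rule nn_integral_eq_integral[symmetric])
  show "integrable gauss (\<lambda>z. w (x + sqrt t *\<^sub>R z))"
    by (rule heat_integrable[OF assms(1), of B]) (simp add: assms)
qed (simp add: assms)

lemma gauss_density_antimono: "norm (z::'a::euclidean_space) \<le> norm (w::'a) \<Longrightarrow> gauss_density w \<le> gauss_density z"
  unfolding gauss_density_def by (intro divide_right_mono) (auto simp: power_mono)

text \<open>
A narrow Gaussian is dominated by a multiple of a wider one: after rescaling the variable, the
densities compare pointwise because the Gaussian density decreases in \<open>|z|\<close>. This makes estimates
uniform in small changes of the time.
\<close>

lemma heat_time_comparison:
  fixes w :: "'a::euclidean_space \<Rightarrow> real"
  assumes wm[measurable]: "w \<in> borel_measurable borel" and w: "\<And>x. 0 \<le> w x" "\<And>x. w x \<le> B"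
    and t: "0 < t" "t \<le> T"
  shows "heat t w x \<le> sqrt (T / t) ^ DIM('a) * heat T w x"
proof -
  define r where "r = sqrt (T / t)"
  have r: "1 \<le> r" "sqrt T = r * sqrt t"
    using t by (auto simp: r_def real_sqrt_mult[symmetric])
  have "ennreal (heat t w x) = (\<integral>\<^sup>+z. ennreal (gauss_density z) * ennreal (w (x + sqrt t *\<^sub>R z)) \<partial>lborel)"
    by (simp add: ennreal_heat[OF wm w] nn_integral_gauss)
  also have "\<dots> = ennreal (r ^ DIM('a)) * (\<integral>\<^sup>+z. ennreal (gauss_density (r *\<^sub>R z)) * ennreal (w (x + sqrt t *\<^sub>R r *\<^sub>R z)) \<partial>lborel)"
    using r by (subst nn_integral_lborel_affine[of _ r 0]) auto
  also have "\<dots> \<le> ennreal (r ^ DIM('a)) * (\<integral>\<^sup>+z. ennreal (gauss_density z) * ennreal (w (x + sqrt T *\<^sub>R z)) \<partial>lborel)"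
  proof (intro mult_left_mono nn_integral_mono mult_mono ennreal_leI)
    fix z :: 'a
    have "norm z \<le> norm (r *\<^sub>R z)" using r by (simp add: mult_le_cancel_right1)
    then show "gauss_density (r *\<^sub>R z) \<le> gauss_density z" by (rule gauss_density_antimono)
  qed (simp_all add: r(2) mult.commute)
  also have "\<dots> = ennreal (r ^ DIM('a) * heat T w x)"
    using r by (simp add: ennreal_mult' ennreal_heat[OF wm w] nn_integral_gauss)
  finally have "ennreal (heat t w x) \<le> ennreal (r ^ DIM('a) * heat T w x)" .
  moreover have "0 \<le> heat T w x" unfolding heat_def using w by (intro integral_nonneg_AE) auto
  then have "0 \<le> r ^ DIM('a) * heat T w x" using r by simp
  ultimately show ?thesis unfolding r_def[symmetric] by (simp add: ennreal_le_iff)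
qed

lemma AE_gauss_affine:
  fixes x :: "'a::euclidean_space"
  assumes "AE y in lborel. P y" and s: "0 < s"
  shows "AE z in gauss. P (x + s *\<^sub>R z)"
proof -
  obtain N where N: "{y \<in> space lborel. \<not> P y} \<subseteq> N" "emeasure lborel N = 0" "N \<in> sets (lborel :: 'a measure)"
    using AE_E[OF assms(1)] by blast
  have [measurable]: "N \<in> sets borel" using N(3) by simp
  have "ennreal (s ^ DIM('a)) * (\<integral>\<^sup>+z. indicator N (x + s *\<^sub>R z) \<partial>lborel) = 0"
    using nn_integral_lborel_affine[of "indicator N" s x] s N(2) by simp
  then have "(\<integral>\<^sup>+z. indicator N (x + s *\<^sub>R z) \<partial>lborel) = 0" using zero_less_power[OF s, of "DIM('a)"] by (auto simp: ennreal_eq_0_iff)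
  then have "AE z in lborel. indicator N (x + s *\<^sub>R z) = (0::ennreal)"
    by (subst (asm) nn_integral_0_iff_AE) auto
  then have "AE z in gauss. indicator N (x + s *\<^sub>R z) = (0::ennreal)"
    unfolding gauss_def by (subst AE_density) auto
  then show ?thesis
  proof eventually_elim
    case (elim z)
    then have "x + s *\<^sub>R z \<notin> N" by (simp add: indicator_def split: if_splits)
    then show ?case using N(1) by auto
  qed
qed

lemma heat_AE_tendsto_0:
  fixes w :: "nat \<Rightarrow> 'a::euclidean_space \<Rightarrow> real"
  assumes [measurable]: "\<And>k. w k \<in> borel_measurable borel" and B: "\<And>k x. \<bar>w k x\<bar> \<le> B"
    and "AE y in lborel. (\<lambda>k. w k y) \<longlonglongrightarrow> 0" and t: "0 < t"
  shows "(\<lambda>k. heat t (w k) x) \<longlonglongrightarrow> 0"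
proof -
  have "(\<lambda>k. heat t (w k) x) \<longlonglongrightarrow> (\<integral>z. 0 \<partial>(gauss::'a measure))"
    unfolding heat_def
  proof (rule integral_dominated_convergence[where w="\<lambda>_. B"])
    show "AE z in gauss. (\<lambda>k. w k (x + sqrt t *\<^sub>R z)) \<longlonglongrightarrow> 0"
      using AE_gauss_affine[OF assms(3), of "sqrt t" x] t by simp
  qed (use B in auto)
  then show ?thesis by simp
qed

lemma heat_continuous_tendsto:
  fixes g :: "'a::euclidean_space \<Rightarrow> real"
  assumes g: "continuous_on UNIV g" and B: "\<And>x. \<bar>g x\<bar> \<le> B" and e: "\<epsilon> \<longlonglongrightarrow> 0"
  shows "(\<lambda>n. heat (\<epsilon> n) g x) \<longlonglongrightarrow> g x"
proof -
  have [measurable]: "g \<in> borel_measurable borel" using g by (rule borel_measurable_continuous_onI)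
  have "(\<lambda>n. heat (\<epsilon> n) g x) \<longlonglongrightarrow> (\<integral>z. g x \<partial>(gauss::'a measure))"
    unfolding heat_def
  proof (rule integral_dominated_convergence[where w="\<lambda>_. B"])
    have "(\<lambda>n. g (x + sqrt (\<epsilon> n) *\<^sub>R z)) \<longlonglongrightarrow> g (x + sqrt 0 *\<^sub>R z)" for z
    proof (rule continuous_on_tendsto_compose[OF g])
      show "(\<lambda>n. x + sqrt (\<epsilon> n) *\<^sub>R z) \<longlonglongrightarrow> x + sqrt 0 *\<^sub>R z"
        by (intro tendsto_add tendsto_scaleR tendsto_real_sqrt tendsto_const e)
    qed auto
    then show "AE z in gauss. (\<lambda>n. g (x + sqrt (\<epsilon> n) *\<^sub>R z)) \<longlonglongrightarrow> g x" by simp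
  qed (use B in auto)
  then show ?thesis by simp
qed

lemma bounded_AE_limit_of_continuous:
  fixes u :: "'a::euclidean_space \<Rightarrow> real"
  assumes "u \<in> borel_measurable borel" and B: "\<And>x. \<bar>u x\<bar> \<le> B"
  obtains g where "\<And>k::nat. continuous_on UNIV (g k)" "\<And>k x. \<bar>g k x\<bar> \<le> B"
    "AE y in lborel. (\<lambda>k. g k y) \<longlonglongrightarrow> u y"
proof -
  have "u \<in> borel_measurable lebesgue"
    using assms(1) by (intro measurable_completion) simp
  then have "u \<in> borel_measurable (lebesgue_on UNIV)" by (simp add: lebesgue_on_UNIV_eq)
  then have "u measurable_on UNIV" by (subst measurable_on_iff_borel_measurable) simp_all
  then obtain N g where N: "negligible N" and g: "\<And>n. continuous_on UNIV (g n)"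
    and lim: "\<And>x. x \<notin> N \<Longrightarrow> (\<lambda>n. g n x) \<longlonglongrightarrow> u x"
    unfolding measurable_on_def by auto
  define g' where "g' k x = max (- B) (min B (g k x))" for k x
  show ?thesis
  proof
    show "continuous_on UNIV (g' k)" for k
      unfolding g'_def by (intro continuous_intros g)
    show "\<bar>g' k x\<bar> \<le> B" for k x
      using abs_ge_zero[of "u x"] B[of x] unfolding g'_def by linarith
    have "AE y in lebesgue. y \<notin> N"
      using N by (simp add: negligible_iff_null_sets AE_not_in)
    then have "AE y in lebesgue. (\<lambda>k. g' k y) \<longlonglongrightarrow> u y"
    proof eventually_elim
      case (elim y)
      have "(\<lambda>k. g' k y) \<longlonglongrightarrow> max (- B) (min B (u y))"
        unfolding g'_def by (intro tendsto_intros lim elim)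
      moreover have "max (- B) (min B (u y)) = u y" using B[of y] by linarith
      ultimately show ?case by simp
    qed
    then show "AE y in lborel. (\<lambda>k. g' k y) \<longlonglongrightarrow> u y"
      by (simp add: AE_completion_iff)
  qed
qed

text \<open>
The function \<open>u\<close> is approximated almost everywhere by continuous \<open>g k\<close>. For \<open>g k\<close> the convergence is
pointwise. The difference \<open>w k = |u - g k|\<close> enters both directly and mollified, that is, averaged
against Gaussians of variance \<open>\<tau>\<close> and \<open>\<tau> + \<epsilon> n\<close>; both averages are dominated by the one of
variance \<open>2 * \<tau>\<close>, uniformly in \<open>n\<close>.
\<close>

lemma heat_mollify_L1:
  fixes u :: "'a::euclidean_space \<Rightarrow> real"
  assumes um[measurable]: "u \<in> borel_measurable borel" and B: "\<And>x. \<bar>u x\<bar> \<le> B"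
    and \<tau>: "0 < \<tau>" and e: "\<epsilon> \<longlonglongrightarrow> 0" "\<And>n. 0 < \<epsilon> n"
  shows "(\<lambda>n. heat \<tau> (\<lambda>y. \<bar>heat (\<epsilon> n) u y - u y\<bar>) x) \<longlonglongrightarrow> 0"
proof -
  obtain g where gc: "\<And>k::nat. continuous_on UNIV (g k)" and gB: "\<And>k x. \<bar>g k x\<bar> \<le> B"
    and glim: "AE y in lborel. (\<lambda>k. g k y) \<longlonglongrightarrow> u y"
    using bounded_AE_limit_of_continuous[OF um B] by blast
  have gm[measurable]: "g k \<in> borel_measurable borel" for k
    using gc by (rule borel_measurable_continuous_onI)
  define w where "w k y = \<bar>u y - g k y\<bar>" for k y
  have wm[measurable]: "w k \<in> borel_measurable borel" for k unfolding w_def by measurable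
  have w: "0 \<le> w k y" "w k y \<le> 2 * B" for k y
    using B[of y] gB[of k y] by (auto simp: w_def)
  have "AE y in lborel. (\<lambda>k. w k y) \<longlonglongrightarrow> 0"
    using glim unfolding w_def
  proof eventually_elim
    case (elim y)
    have "(\<lambda>k. \<bar>u y - g k y\<bar>) \<longlonglongrightarrow> \<bar>u y - u y\<bar>" by (intro tendsto_intros elim)
    then show ?case by simp
  qed
  then have wlim: "(\<lambda>k. heat (2 * \<tau>) (w k) x) \<longlonglongrightarrow> 0"
    using w \<tau> by (intro heat_AE_tendsto_0[of _ "2 * B"]) auto
  define C where "C = sqrt 2 ^ DIM('a)"
  have C: "0 < C" by (simp add: C_def)
  have hw: "heat t (w k) x \<le> C * heat (2 * \<tau>) (w k) x" if t: "\<tau> \<le> t" "t \<le> 2 * \<tau>" for t k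
  proof -
    have "heat t (w k) x \<le> sqrt (2 * \<tau> / t) ^ DIM('a) * heat (2 * \<tau>) (w k) x"
      using t \<tau> by (intro heat_time_comparison[OF wm w]) auto
    also have "\<dots> \<le> C * heat (2 * \<tau>) (w k) x"
      unfolding C_def
    proof (intro mult_right_mono power_mono)
      show "0 \<le> heat (2 * \<tau>) (w k) x" unfolding heat_def using w by (intro integral_nonneg_AE) auto
      show "sqrt (2 * \<tau> / t) \<le> sqrt 2" using t \<tau> by (simp add: field_simps)
    qed (use t \<tau> in auto)
    finally show ?thesis .
  qed
  have hb: "\<bar>heat r f y\<bar> \<le> b" if "f \<in> borel_measurable borel" "\<And>x. \<bar>f x\<bar> \<le> b" for r f y and b :: real
    using heat_norm_le[of f b r y] that by auto
  have bound: "heat \<tau> (\<lambda>y. \<bar>heat (\<epsilon> n) u y - u y\<bar>) x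
      \<le> 2 * C * heat (2 * \<tau>) (w k) x + heat \<tau> (\<lambda>y. \<bar>heat (\<epsilon> n) (g k) y - g k y\<bar>) x" if n: "\<epsilon> n \<le> \<tau>" for n k
  proof -
    let ?a = "\<lambda>y. heat (\<epsilon> n) (w k) y" and ?b = "\<lambda>y. \<bar>heat (\<epsilon> n) (g k) y - g k y\<bar>"
    have iu: "integrable gauss (\<lambda>z. u (y + sqrt t *\<^sub>R z))" for y t
      by (rule heat_integrable[OF um, of B]) (use B in auto)
    have ig: "integrable gauss (\<lambda>z. g k (y + sqrt t *\<^sub>R z))" for y t
      by (rule heat_integrable[OF gm, of _ B]) (use gB in auto)
    have pt: "\<bar>heat (\<epsilon> n) u y - u y\<bar> \<le> ?a y + ?b y + w k y" for y
    proof -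
      have "heat (\<epsilon> n) u y - heat (\<epsilon> n) (g k) y = (\<integral>z. u (y + sqrt (\<epsilon> n) *\<^sub>R z) - g k (y + sqrt (\<epsilon> n) *\<^sub>R z) \<partial>gauss)"
        using iu ig by (simp add: heat_def)
      also have "norm \<dots> \<le> ?a y"
        using integral_norm_bound[of gauss "\<lambda>z. u (y + sqrt (\<epsilon> n) *\<^sub>R z) - g k (y + sqrt (\<epsilon> n) *\<^sub>R z)"]
        by (simp add: heat_def w_def)
      finally show ?thesis unfolding w_def real_norm_def by linarith
    qed
    have am: "?a \<in> borel_measurable borel" and bm: "?b \<in> borel_measurable borel" by measurable
    have aB: "\<bar>?a y\<bar> \<le> 2 * B" for y by (rule hb[OF wm]) (use w in auto)
    have bB: "\<bar>?b y\<bar> \<le> 2 * B" for y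
      using hb[OF gm gB, of "\<epsilon> n" k y] gB[of k y] by auto
    have ia: "integrable gauss (\<lambda>z. ?a (x + sqrt \<tau> *\<^sub>R z))"
      by (rule heat_integrable[OF am, of "2 * B"]) (use aB in auto)
    have ib: "integrable gauss (\<lambda>z. ?b (x + sqrt \<tau> *\<^sub>R z))"
      by (rule heat_integrable[OF bm, of "2 * B"]) (use bB in auto)
    have iw: "integrable gauss (\<lambda>z. w k (x + sqrt \<tau> *\<^sub>R z))"
      by (rule heat_integrable[OF wm, of _ "2 * B"]) (use w in auto)
    have "heat \<tau> (\<lambda>y. \<bar>heat (\<epsilon> n) u y - u y\<bar>) x \<le> heat \<tau> (\<lambda>y. ?a y + ?b y + w k y) x"
    proof (rule heat_mono[where B="2 * B" and C="6 * B"])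
      show "norm \<bar>heat (\<epsilon> n) u y - u y\<bar> \<le> 2 * B" for y
        using hb[OF um B, of "\<epsilon> n" y] B[of y] by auto
      show "norm (?a y + ?b y + w k y) \<le> 6 * B" for y
        using aB[of y] bB[of y] w[of k y] by simp
    qed (use pt in auto)
    also have "\<dots> = heat \<tau> ?a x + heat \<tau> ?b x + heat \<tau> (w k) x"
      using ia ib iw by (simp add: heat_def[of \<tau>])
    also have "heat \<tau> ?a x = heat (\<tau> + \<epsilon> n) (w k) x"
    proof -
      have "heat \<tau> (heat (\<epsilon> n) (w k)) = heat (\<tau> + \<epsilon> n) (w k)"
        by (rule heat_heat[OF wm, of _ "2 * B"]) (use w \<tau> e(2)[of n] in auto)
      then show ?thesis by (rule fun_cong)
    qed
    finally show ?thesis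
      using hw[of "\<tau> + \<epsilon> n" k] hw[of \<tau> k] n \<tau> e(2)[of n] by simp
  qed
  have nn: "0 \<le> heat \<tau> (\<lambda>y. \<bar>heat (\<epsilon> n) u y - u y\<bar>) x" for n
    unfolding heat_def[of \<tau>] by (intro integral_nonneg_AE) auto
  show ?thesis
  proof (rule order_tendstoI)
    fix r :: real assume "r < 0"
    then show "eventually (\<lambda>n. r < heat \<tau> (\<lambda>y. \<bar>heat (\<epsilon> n) u y - u y\<bar>) x) sequentially"
      using nn by (auto intro: always_eventually order_less_le_trans)
  next
    fix r :: real assume r: "0 < r"
    have "eventually (\<lambda>k. heat (2 * \<tau>) (w k) x < r / (4 * C)) sequentially"
      using wlim r C by (intro order_tendstoD) auto
    then obtain k where k: "heat (2 * \<tau>) (w k) x < r / (4 * C)" by (auto simp: eventually_sequentially)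
    have "(\<lambda>n. heat \<tau> (\<lambda>y. \<bar>heat (\<epsilon> n) (g k) y - g k y\<bar>) x) \<longlonglongrightarrow> 0"
    proof (rule heat_AE_tendsto_0[of _ "2 * B"])
      show "\<bar>\<bar>heat (\<epsilon> n) (g k) y - g k y\<bar>\<bar> \<le> 2 * B" for n y
        using hb[OF gm gB, of "\<epsilon> n" k y] gB[of k y] by auto
      have "(\<lambda>n. \<bar>heat (\<epsilon> n) (g k) y - g k y\<bar>) \<longlonglongrightarrow> 0" for y
        using heat_continuous_tendsto[OF gc gB e(1), of k y] by (intro tendsto_rabs_zero) (simp add: LIM_zero)
      then show "AE y in lborel. (\<lambda>n. \<bar>heat (\<epsilon> n) (g k) y - g k y\<bar>) \<longlonglongrightarrow> 0" by simp
    qed (use \<tau> in auto)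
    then have "eventually (\<lambda>n. heat \<tau> (\<lambda>y. \<bar>heat (\<epsilon> n) (g k) y - g k y\<bar>) x < r / 2) sequentially"
      using r by (intro order_tendstoD) auto
    moreover have "eventually (\<lambda>n. \<epsilon> n < \<tau>) sequentially" using e(1) \<tau> by (intro order_tendstoD) auto
    ultimately show "eventually (\<lambda>n. heat \<tau> (\<lambda>y. \<bar>heat (\<epsilon> n) u y - u y\<bar>) x < r) sequentially"
    proof eventually_elim
      case (elim n)
      have "2 * C * heat (2 * \<tau>) (w k) x < r / 2" using k C by (simp add: field_simps)
      then show ?case using bound[of n k] elim by linarith
    qed
  qed
qed

lemma exp_lipschitz:
  fixes a b :: real
  assumes "a \<le> B" "b \<le> B"
  shows "\<bar>exp a - exp b\<bar> \<le> exp B * \<bar>a - b\<bar>"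
proof -
  have *: "exp a - exp b \<le> exp B * (a - b)" if "b \<le> a" "a \<le> B" for a b :: real
  proof -
    have "exp a - exp b = exp a * (1 - exp (b - a))" by (simp add: right_diff_distrib flip: exp_add)
    also have "\<dots> \<le> exp a * (a - b)"
      using exp_ge_add_one_self[of "b - a"] by (intro mult_left_mono) (linarith, simp)
    also have "\<dots> \<le> exp B * (a - b)" using that by (intro mult_right_mono) auto
    finally show ?thesis .
  qed
  show ?thesis
  proof (cases "b \<le> a")
    case True
    then have "exp b \<le> exp a" by simp
    then show ?thesis using *[OF True assms(1)] True by simp
  next
    case False
    then have "exp a \<le> exp b" by simp
    then show ?thesis using *[of a b] False assms by simp
  qed
qed

lemma heat_exp_mollify_tendsto:
  fixes u :: "'a::euclidean_space \<Rightarrow> real"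
  assumes um[measurable]: "u \<in> borel_measurable borel" and B: "\<And>x. \<bar>u x\<bar> \<le> B"
    and \<tau>: "0 < \<tau>" and e: "\<epsilon> \<longlonglongrightarrow> 0" "\<And>n. 0 < \<epsilon> n"
  shows "(\<lambda>n. heat \<tau> (\<lambda>y. exp (heat (\<epsilon> n) u y)) x) \<longlonglongrightarrow> heat \<tau> (\<lambda>y. exp (u y)) x"
proof -
  have hb: "\<bar>heat r u y\<bar> \<le> B" for r y
    using heat_norm_le[OF um, of B r y] B by auto
  have *: "norm (heat \<tau> (\<lambda>y. exp (heat (\<epsilon> n) u y)) x - heat \<tau> (\<lambda>y. exp (u y)) x)
    \<le> exp B * heat \<tau> (\<lambda>y. \<bar>heat (\<epsilon> n) u y - u y\<bar>) x" for n
  proof -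
    have i1: "integrable gauss (\<lambda>z. exp (heat (\<epsilon> n) u (x + sqrt \<tau> *\<^sub>R z)))"
      by (rule gauss_integrable_bounded[of _ "exp B"]) (simp_all add: abs_le_D1[OF hb])
    have i2: "integrable gauss (\<lambda>z. exp (u (x + sqrt \<tau> *\<^sub>R z)))"
      by (rule gauss_integrable_bounded[of _ "exp B"]) (simp_all add: abs_le_D1[OF B])
    have i3: "integrable gauss (\<lambda>z. \<bar>heat (\<epsilon> n) u (x + sqrt \<tau> *\<^sub>R z) - u (x + sqrt \<tau> *\<^sub>R z)\<bar>)"
    proof (rule gauss_integrable_bounded[of _ "2 * B"])
      show "norm \<bar>heat (\<epsilon> n) u (x + sqrt \<tau> *\<^sub>R z) - u (x + sqrt \<tau> *\<^sub>R z)\<bar> \<le> 2 * B" for z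
        using hb[of "\<epsilon> n" "x + sqrt \<tau> *\<^sub>R z"] B[of "x + sqrt \<tau> *\<^sub>R z"] by simp
    qed measurable
    have "heat \<tau> (\<lambda>y. exp (heat (\<epsilon> n) u y)) x - heat \<tau> (\<lambda>y. exp (u y)) x
      = (\<integral>z. exp (heat (\<epsilon> n) u (x + sqrt \<tau> *\<^sub>R z)) - exp (u (x + sqrt \<tau> *\<^sub>R z)) \<partial>gauss)"
      using i1 i2 by (simp add: heat_def[of \<tau>])
    also have "norm \<dots> \<le> (\<integral>z. norm (exp (heat (\<epsilon> n) u (x + sqrt \<tau> *\<^sub>R z)) - exp (u (x + sqrt \<tau> *\<^sub>R z))) \<partial>gauss)"
      by (rule integral_norm_bound)
    also have "\<dots> \<le> (\<integral>z. exp B * \<bar>heat (\<epsilon> n) u (x + sqrt \<tau> *\<^sub>R z) - u (x + sqrt \<tau> *\<^sub>R z)\<bar> \<partial>gauss)"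
    proof (rule Bochner_Integration.integral_mono)
      show "norm (exp (heat (\<epsilon> n) u (x + sqrt \<tau> *\<^sub>R z)) - exp (u (x + sqrt \<tau> *\<^sub>R z)))
        \<le> exp B * \<bar>heat (\<epsilon> n) u (x + sqrt \<tau> *\<^sub>R z) - u (x + sqrt \<tau> *\<^sub>R z)\<bar>" for z
        unfolding real_norm_def
        by (rule exp_lipschitz) (use hb[of "\<epsilon> n" "x + sqrt \<tau> *\<^sub>R z"] B[of "x + sqrt \<tau> *\<^sub>R z"] in auto)
    qed (intro integrable_norm Bochner_Integration.integrable_diff integrable_mult_right i1 i2 i3)+
    finally show ?thesis by (simp only: heat_def[of \<tau>] integral_mult_right_zero)
  qed
  have "(\<lambda>n. exp B * heat \<tau> (\<lambda>y. \<bar>heat (\<epsilon> n) u y - u y\<bar>) x) \<longlonglongrightarrow> 0"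
    by (rule tendsto_mult_right_zero[OF heat_mollify_L1[OF um B \<tau> e]])
  from Lim_null_comparison[OF always_eventually[OF allI[OF *]] this]
  show ?thesis by (rule LIM_zero_cancel)
qed

section \<open>Bounded functions, and the reduction to them\<close>

context translation_contraction begin

lemma heat_flow_bounded:
  assumes u: "\<And>s. s \<in> S \<Longrightarrow> u s \<in> borel_measurable borel" "\<And>s x. s \<in> S \<Longrightarrow> \<bar>u s x\<bar> \<le> B"
    and v: "\<And>t. t \<in> T \<Longrightarrow> v t \<in> borel_measurable borel" "\<And>t x. t \<in> T \<Longrightarrow> \<bar>v t x\<bar> \<le> B"
    and le: "\<And>x. (\<Sum>s\<in>S. c s * u s (x s)) \<le> (\<Sum>t\<in>T. d t * v t (A x t))"
    and \<tau>: "0 < \<tau>"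
  shows "(\<Sum>s\<in>S. c s * ln (heat \<tau> (\<lambda>x. exp (u s x)) (x s)))
    \<le> (\<Sum>t\<in>T. d t * ln (heat \<tau> (\<lambda>x. exp (v t x)) (A x t)))"
proof -
  define \<epsilon> where "\<epsilon> n = 1 / real (Suc n)" for n
  have \<epsilon>: "\<epsilon> \<longlonglongrightarrow> 0" "\<And>n. 0 < \<epsilon> n"
    unfolding \<epsilon>_def using LIMSEQ_Suc[OF lim_1_over_n] by auto
  have lim: "(\<lambda>n. ln (heat \<tau> (\<lambda>x. exp (heat (\<epsilon> n) f x)) y)) \<longlonglongrightarrow> ln (heat \<tau> (\<lambda>x. exp (f x)) y)"
    if f: "f \<in> borel_measurable borel" "\<And>x. \<bar>f x\<bar> \<le> B" for f :: "'a \<Rightarrow> real" and y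
  proof (rule tendsto_ln)
    show "(\<lambda>n. heat \<tau> (\<lambda>x. exp (heat (\<epsilon> n) f x)) y) \<longlonglongrightarrow> heat \<tau> (\<lambda>x. exp (f x)) y"
      by (rule heat_exp_mollify_tendsto[OF f \<tau> \<epsilon>])
    show "heat \<tau> (\<lambda>x. exp (f x)) y \<noteq> 0"
      using heat_exp_pos(1)[OF f, of \<tau> y] exp_gt_zero[of "- B"] by linarith
  qed
  show ?thesis
  proof (rule LIMSEQ_le)
    show "(\<lambda>n. \<Sum>s\<in>S. c s * ln (heat \<tau> (\<lambda>x. exp (heat (\<epsilon> n) (u s) x)) (x s)))
        \<longlonglongrightarrow> (\<Sum>s\<in>S. c s * ln (heat \<tau> (\<lambda>x. exp (u s x)) (x s)))"
      by (intro tendsto_sum tendsto_mult tendsto_const lim u)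
    show "(\<lambda>n. \<Sum>t\<in>T. d t * ln (heat \<tau> (\<lambda>x. exp (heat (\<epsilon> n) (v t) x)) (A x t)))
        \<longlonglongrightarrow> (\<Sum>t\<in>T. d t * ln (heat \<tau> (\<lambda>x. exp (v t x)) (A x t)))"
      by (intro tendsto_sum tendsto_mult tendsto_const lim v)
    show "\<exists>N. \<forall>n\<ge>N. (\<Sum>s\<in>S. c s * ln (heat \<tau> (\<lambda>x. exp (heat (\<epsilon> n) (u s) x)) (x s)))
      \<le> (\<Sum>t\<in>T. d t * ln (heat \<tau> (\<lambda>x. exp (heat (\<epsilon> n) (v t) x)) (A x t)))"
      using heat_flow_mollified[OF u v le \<epsilon>(2) \<tau>] by blast
  qed
qed

end

definition clamp_ereal :: "real \<Rightarrow> real \<Rightarrow> ereal \<Rightarrow> real" where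
  "clamp_ereal lo hi y = real_of_ereal (max (ereal lo) (min (ereal hi) y))"

lemma ereal_clamp: "ereal (clamp_ereal lo hi y) = max (ereal lo) (min (ereal hi) y)"
  by (cases y) (auto simp: clamp_ereal_def max_def min_def)

lemma clamp_ereal_bounds:
  assumes "lo \<le> hi" shows "lo \<le> clamp_ereal lo hi y" "clamp_ereal lo hi y \<le> hi"
proof -
  have "ereal lo \<le> ereal (clamp_ereal lo hi y)" "ereal (clamp_ereal lo hi y) \<le> ereal hi"
    unfolding ereal_clamp using assms by auto
  then show "lo \<le> clamp_ereal lo hi y" "clamp_ereal lo hi y \<le> hi" by simp_all
qed

lemma clamp_ereal_measurable [measurable]:
  assumes [measurable]: "f \<in> borel_measurable M"
  shows "(\<lambda>x. clamp_ereal lo hi (f x)) \<in> borel_measurable M"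
  unfolding clamp_ereal_def by measurable

text \<open>
Clamping all functions at levels \<open>- B\<close>, \<open>N\<close> on one side and \<open>- N\<close>, \<open>K\<close> on the other keeps
the inequality, provided \<open>N\<close> is large. If some \<open>a s\<close> is cut from above, its contribution of at least \<open>m * N\<close>
outweighs everything else, since the left-hand side is at most \<open>C * K\<close> and the remaining terms on the
right are bounded below by means of \<open>B\<close>. If some \<open>b t\<close> is cut from below, the left-hand side
lies below the least possible value \<open>- C * B\<close> of the right-hand side. In the remaining case clamping
raises every \<open>a s\<close> and lowers every \<open>b t\<close>.
\<close>

lemma clamp_sums_le:
  fixes a :: "'s \<Rightarrow> ereal" and b :: "'t \<Rightarrow> ereal"
  assumes fin: "finite S" "finite T"
    and c: "\<And>s. s \<in> S \<Longrightarrow> m \<le> c s" and d: "\<And>t. t \<in> T \<Longrightarrow> m \<le> d t" and m: "0 < m"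
    and mass: "(\<Sum>s\<in>S. c s) = C" "(\<Sum>t\<in>T. d t) = C"
    and b: "\<And>t. t \<in> T \<Longrightarrow> b t \<noteq> -\<infinity>"
    and le: "(\<Sum>t\<in>T. ereal (d t) * b t) \<le> (\<Sum>s\<in>S. ereal (c s) * a s)"
    and BK: "0 \<le> B" "0 \<le> K"
  defines "N \<equiv> C * (K + B) / m"
  shows "(\<Sum>t\<in>T. d t * clamp_ereal (- N) K (b t)) \<le> (\<Sum>s\<in>S. c s * clamp_ereal (- B) N (a s))"
proof -
  have c0: "0 < c s" if "s \<in> S" for s using c[OF that] m by linarith
  have d0: "0 < d t" if "t \<in> T" for t using d[OF that] m by linarith
  have C: "0 \<le> C" using mass(1) c0 by (auto intro: sum_nonneg less_imp_le)
  have N: "0 \<le> N" using C BK m by (simp add: N_def)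
  have mN: "m * N = C * K + C * B" using m by (simp add: N_def field_simps)
  define a' where "a' s = clamp_ereal (- B) N (a s)" for s
  define b' where "b' t = clamp_ereal (- N) K (b t)" for t
  have a': "- B \<le> a' s" "a' s \<le> N" for s using clamp_ereal_bounds[of "- B" N] BK N by (auto simp: a'_def)
  have b': "- N \<le> b' t" "b' t \<le> K" for t using clamp_ereal_bounds[of "- N" K] BK N by (auto simp: b'_def)
  have Sb: "- C * B \<le> (\<Sum>s\<in>S. c s * a' s)"
  proof -
    have "(\<Sum>s\<in>S. c s * (- B)) \<le> (\<Sum>s\<in>S. c s * a' s)"
      by (intro sum_mono mult_left_mono a' less_imp_le c0)
    then show ?thesis by (simp add: mass(1)[symmetric] sum_distrib_right sum_negf)
  qed
  have Tb: "(\<Sum>t\<in>T. d t * b' t) \<le> C * K"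
  proof -
    have "(\<Sum>t\<in>T. d t * b' t) \<le> (\<Sum>t\<in>T. d t * K)"
      by (intro sum_mono mult_left_mono b' less_imp_le d0)
    then show ?thesis by (simp add: mass(2)[symmetric] sum_distrib_right)
  qed
  show ?thesis
    unfolding a'_def[symmetric] b'_def[symmetric]
  proof (cases "\<exists>s\<in>S. ereal N \<le> a s")
    case True
    then obtain r where r: "r \<in> S" "ereal N \<le> a r" by blast
    have "ereal (a' r) = ereal N" unfolding a'_def ereal_clamp using r(2) N BK by (simp add: min_absorb1 max_def)
    then have ar: "a' r = N" by simp
    have "m * N \<le> c r * (a' r + B)" using ar c[OF r(1)] N BK m by (intro mult_mono) auto
    also have "\<dots> \<le> (\<Sum>s\<in>S. c s * (a' s + B))"
    proof (rule member_le_sum[OF r(1) _ fin(1)])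
      show "0 \<le> c s * (a' s + B)" if "s \<in> S - {r}" for s
        using a'(1)[of s] c0[of s] that by simp
    qed
    also have "\<dots> = (\<Sum>s\<in>S. c s * a' s) + C * B"
      by (simp add: mass(1)[symmetric] algebra_simps sum.distrib sum_distrib_left)
    finally show "(\<Sum>t\<in>T. d t * b' t) \<le> (\<Sum>s\<in>S. c s * a' s)" using mN Tb by linarith
  next
    case False
    have aa: "a s \<le> ereal (a' s)" if "s \<in> S" for s
      unfolding a'_def ereal_clamp using False that by (auto simp: not_le min_absorb2 less_imp_le)
    have "(\<Sum>s\<in>S. ereal (c s) * a s) \<le> (\<Sum>s\<in>S. ereal (c s) * ereal (a' s))"
      using c0 aa by (intro sum_mono ereal_mult_left_mono) (auto simp: less_imp_le)
    with le have le2: "(\<Sum>t\<in>T. ereal (d t) * b t) \<le> ereal (\<Sum>s\<in>S. c s * a' s)" by simp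
    have "b t \<noteq> \<infinity>" if t: "t \<in> T" for t
    proof
      assume "b t = \<infinity>"
      then have "(\<Sum>t\<in>T. ereal (d t) * b t) = \<infinity>"
        using t d0[OF t] fin(2) by (subst sum_Pinfty) auto
      then show False using le2 by simp
    qed
    then have "\<exists>y. b t = ereal y" if "t \<in> T" for t using b[OF that] that by (cases "b t") auto
    then obtain y where y: "\<And>t. t \<in> T \<Longrightarrow> b t = ereal (y t)" by metis
    have le3: "(\<Sum>t\<in>T. d t * y t) \<le> (\<Sum>s\<in>S. c s * a' s)" using le2 y by simp
    have by': "b' t = max (- N) (min K (y t))" if "t \<in> T" for t
    proof -
      have "ereal (b' t) = ereal (max (- N) (min K (y t)))"
        unfolding b'_def ereal_clamp using y[OF that] by (simp add: max_def min_def)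
      then show ?thesis by (simp only: ereal.inject)
    qed
    show "(\<Sum>t\<in>T. d t * b' t) \<le> (\<Sum>s\<in>S. c s * a' s)"
    proof (cases "\<exists>t\<in>T. y t \<le> - N")
      case True
      then obtain r where r: "r \<in> T" "y r \<le> - N" by blast
      have br: "b' r = - N" using by'[OF r(1)] r(2) by linarith
      have "m * N \<le> d r * (K - b' r)" using br d[OF r(1)] N BK m by (intro mult_mono) auto
      also have "\<dots> \<le> (\<Sum>t\<in>T. d t * (K - b' t))"
      proof (rule member_le_sum[OF r(1) _ fin(2)])
        show "0 \<le> d t * (K - b' t)" if "t \<in> T - {r}" for t
          using b'(2)[of t] d0[of t] that by simp
      qed
      also have "\<dots> = C * K - (\<Sum>t\<in>T. d t * b' t)"
        by (simp add: mass(2)[symmetric] algebra_simps sum_subtractf sum_distrib_left)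
      finally show ?thesis using mN Sb by simp
    next
      case False
      have "(\<Sum>t\<in>T. d t * b' t) \<le> (\<Sum>t\<in>T. d t * y t)"
      proof (intro sum_mono mult_left_mono)
        show "b' t \<le> y t" if "t \<in> T" for t using by'[OF that] False that by force
      qed (simp add: d0 less_imp_le)
      then show ?thesis using le3 by simp
    qed
  qed
qed

text \<open>
At the origin, the flow at time \<open>t\<close> is the normalised integral against \<open>exp (- |x|\<^sup>2 / (2 t))\<close>.
\<close>

lemma heat_eq_lebesgue:
  fixes w :: "'a::euclidean_space \<Rightarrow> real"
  assumes wm[measurable]: "w \<in> borel_measurable borel" and w: "\<And>x. 0 \<le> w x" "\<And>x. w x \<le> B" and t: "0 < t"
  shows "ennreal (sqrt (2 * pi * t) ^ DIM('a) * heat t w 0)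
    = (\<integral>\<^sup>+x. ennreal (exp (- (norm x)\<^sup>2 / (2 * t)) * w x) \<partial>lborel)"
proof -
  let ?k = "sqrt (2 * pi * t) ^ DIM('a)"
  have s: "sqrt (2 * pi * t) ^ DIM('a) = sqrt t ^ DIM('a) * sqrt (2 * pi) ^ DIM('a)"
    by (simp add: real_sqrt_mult power_mult_distrib)
  have "ennreal (?k * heat t w 0) = ennreal ?k * (\<integral>\<^sup>+z. ennreal (gauss_density z) * ennreal (w (sqrt t *\<^sub>R z)) \<partial>lborel)"
    using t by (subst ennreal_mult') (simp_all add: ennreal_heat[OF wm w] nn_integral_gauss)
  also have "\<dots> = ennreal (sqrt t ^ DIM('a)) * (ennreal (sqrt (2 * pi) ^ DIM('a)) * (\<integral>\<^sup>+z. ennreal (gauss_density z) * ennreal (w (sqrt t *\<^sub>R z)) \<partial>lborel))"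
    unfolding s using t by (simp add: ennreal_mult mult.assoc)
  also have "\<dots> = ennreal (sqrt t ^ DIM('a)) * (\<integral>\<^sup>+z. ennreal (exp (- (norm z)\<^sup>2 / 2) * w (sqrt t *\<^sub>R z)) \<partial>lborel)"
    by (subst nn_integral_cmult[symmetric])
      (auto simp: gauss_density_def ennreal_mult[symmetric] w intro!: arg_cong2[of _ _ _ _ "(*)"] nn_integral_cong)
  also have "\<dots> = (\<integral>\<^sup>+x. ennreal (exp (- (norm x)\<^sup>2 / (2 * t)) * w x) \<partial>lborel)"
    using t by (subst (2) nn_integral_lborel_affine[of _ "sqrt t" 0]) (simp_all add: power_mult_distrib)
  finally show ?thesis .
qed

lemma gauss_integral_scaled:
  assumes "0 < t"
  shows "(\<integral>\<^sup>+x. ennreal (exp (- (norm (x::'a::euclidean_space))\<^sup>2 / (2 * t))) \<partial>lborel) = ennreal (sqrt (2 * pi * t) ^ DIM('a))"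
  using heat_eq_lebesgue[of "\<lambda>_::'a. 1" 1 t] assms by simp

lemma ereal_exp_measurable [measurable]:
  assumes [measurable]: "f \<in> borel_measurable M"
  shows "(\<lambda>x. ereal_exp (f x)) \<in> borel_measurable M"
  unfolding ereal_exp_def by measurable

lemma clamp_exp_ge:
  assumes "0 \<le> B"
  shows "min (ereal_exp (- y)) (ennreal (exp B)) \<le> ennreal (exp (- clamp_ereal (- B) N y))"
  by (cases y) (auto simp: clamp_ereal_def ereal_exp_def max_def min_def intro!: ennreal_leI)

lemma clamp_exp_le:
  "ennreal (exp (- clamp_ereal (- N) K y)) \<le> ereal_exp (- y) + ennreal (exp (- K))"
  by (cases y) (auto simp: clamp_ereal_def ereal_exp_def max_def min_def add_increasing add_increasing2 intro!: ennreal_leI)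

context translation_contraction begin

text \<open>
The inequality at time \<open>\<tau>\<close> and at the configuration \<open>0\<close>, for clamped functions. On the side of
\<open>S\<close>, clamping from above only increases \<open>exp (- f s)\<close>, so that it dominates the integrand in the hypothesis on \<open>p\<close>.
On the side of \<open>T\<close>, clamping adds at most \<open>exp (- K)\<close> to \<open>exp (- g t)\<close>, with a total integral of at most \<open>\<eta>\<close>.
\<close>

lemma truncated_inequality:
  assumes f: "\<And>s. s \<in> S \<Longrightarrow> f s \<in> borel_measurable borel"
    and g: "\<And>t. t \<in> T \<Longrightarrow> g t \<in> borel_measurable borel" "\<And>t x. t \<in> T \<Longrightarrow> g t x \<noteq> -\<infinity>"
    and le: "\<And>x. (\<Sum>t\<in>T. ereal (d t) * g t (A x t)) \<le> (\<Sum>s\<in>S. ereal (c s) * f s (x s))"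
    and B: "0 \<le> B" and \<tau>: "0 < \<tau>" and \<eta>: "0 < \<eta>"
    and p: "\<And>s. s \<in> S \<Longrightarrow> 0 < p s"
      "\<And>s. s \<in> S \<Longrightarrow> ennreal (p s) \<le> (\<integral>\<^sup>+x. ennreal (exp (- (norm x)\<^sup>2 / (2 * \<tau>))) * min (ereal_exp (- f s x)) (ennreal (exp B)) \<partial>lborel)"
    and q: "\<And>t. t \<in> T \<Longrightarrow> 0 \<le> q t" "\<And>t. t \<in> T \<Longrightarrow> (\<integral>\<^sup>+x. ereal_exp (- g t x) \<partial>lborel) \<le> ennreal (q t)"
  shows "(\<Sum>s\<in>S. c s * ln (p s)) \<le> (\<Sum>t\<in>T. d t * ln (q t + \<eta>))"
proof -
  define \<kappa> where "\<kappa> = sqrt (2 * pi * \<tau>) ^ DIM('a)"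
  have \<kappa>: "0 < \<kappa>" using \<tau> by (simp add: \<kappa>_def)
  \<comment> \<open>Chosen such that the added constant \<open>exp (- K)\<close> has Gaussian integral at most \<open>\<eta>\<close>.\<close>
  define K where "K = max 0 (ln (\<kappa> / \<eta>))"
  have K: "0 \<le> K" "exp (- K) * \<kappa> \<le> \<eta>"
  proof -
    have "exp (- K) \<le> exp (- ln (\<kappa> / \<eta>))" by (simp add: K_def)
    also have "\<dots> = \<eta> / \<kappa>" using \<kappa> \<eta> by (simp add: exp_minus)
    finally show "exp (- K) * \<kappa> \<le> \<eta>" using \<kappa> by (simp add: field_simps)
  qed (simp add: K_def)
  \<comment> \<open>Inserting \<open>1\<close> covers the case of empty \<open>S\<close> and \<open>T\<close>.\<close>
  define m where "m = Min (insert 1 (c ` S \<union> d ` T))"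
  have m: "0 < m" "\<And>s. s \<in> S \<Longrightarrow> m \<le> c s" "\<And>t. t \<in> T \<Longrightarrow> m \<le> d t"
    unfolding m_def using finite_S finite_T c_pos d_pos by (auto simp: Min_gr_iff)
  define C where "C = (\<Sum>s\<in>S. c s)"
  define N where "N = C * (K + B) / m"
  have C0: "0 \<le> C" unfolding C_def using c_pos by (auto intro: sum_nonneg less_imp_le)
  then have N: "0 \<le> N" using K B m by (simp add: N_def)
  define u where "u s x = - clamp_ereal (- B) N (f s x)" for s x
  define v where "v t x = - clamp_ereal (- N) K (g t x)" for t x
  have um: "u s \<in> borel_measurable borel" if "s \<in> S" for s
    using f[OF that] unfolding u_def by measurable
  have vm: "v t \<in> borel_measurable borel" if "t \<in> T" for t
    using g(1)[OF that] unfolding v_def by measurable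
  have ub: "\<bar>u s x\<bar> \<le> B + N + K" for s x
    using clamp_ereal_bounds[of "- B" N "f s x"] B N K unfolding u_def by linarith
  have vb: "\<bar>v t x\<bar> \<le> B + N + K" for t x
    using clamp_ereal_bounds[of "- N" K "g t x"] B N K unfolding v_def by linarith
  have uv: "(\<Sum>s\<in>S. c s * u s (x s)) \<le> (\<Sum>t\<in>T. d t * v t (A x t))" for x
    using clamp_sums_le[OF finite_S finite_T m(2,3,1) C_def[symmetric] mass[symmetric, folded C_def] g(2) le[of x] B K(1)]
    unfolding u_def v_def N_def by (simp add: sum_negf)
  have A0: "A (\<lambda>_. 0) t = 0" if "t \<in> T" for t using A_const[OF that] .
  have main: "(\<Sum>s\<in>S. c s * ln (heat \<tau> (\<lambda>x. exp (u s x)) 0)) \<le> (\<Sum>t\<in>T. d t * ln (heat \<tau> (\<lambda>x. exp (v t x)) 0))"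
    using heat_flow_bounded[OF um ub vm vb uv \<tau>, of "\<lambda>_. 0"] by (simp add: A0)
  have hs: "p s / \<kappa> \<le> heat \<tau> (\<lambda>x. exp (u s x)) 0" if s: "s \<in> S" for s
  proof -
    note f[OF s, measurable] um[OF s, measurable]
    have pos: "0 < heat \<tau> (\<lambda>x. exp (u s x)) 0"
      using heat_exp_pos(1)[OF um[OF s] ub, of \<tau> 0] exp_gt_zero[of "- (B + N + K)"] by linarith
    have "ennreal (p s) \<le> (\<integral>\<^sup>+x. ennreal (exp (- (norm x)\<^sup>2 / (2 * \<tau>)) * exp (u s x)) \<partial>lborel)"
      by (rule order_trans[OF p(2)[OF s]], rule nn_integral_mono)
        (auto simp: ennreal_mult u_def intro!: mult_left_mono clamp_exp_ge[OF B])
    also have "\<dots> = ennreal (\<kappa> * heat \<tau> (\<lambda>x. exp (u s x)) 0)"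
      unfolding \<kappa>_def by (rule heat_eq_lebesgue[symmetric, of _ "exp (B + N + K)"])
        (use \<tau> abs_le_D1[OF ub] in auto)
    finally show ?thesis using pos \<kappa> by (simp add: ennreal_le_iff field_simps)
  qed
  have ht: "heat \<tau> (\<lambda>x. exp (v t x)) 0 \<le> (q t + \<eta>) / \<kappa>" "0 < heat \<tau> (\<lambda>x. exp (v t x)) 0" if t: "t \<in> T" for t
  proof -
    note g(1)[OF t, measurable] vm[OF t, measurable]
    show "0 < heat \<tau> (\<lambda>x. exp (v t x)) 0"
      using heat_exp_pos(1)[OF vm[OF t] vb, of \<tau> 0] exp_gt_zero[of "- (B + N + K)"] by linarith
    have "ennreal (\<kappa> * heat \<tau> (\<lambda>x. exp (v t x)) 0) = (\<integral>\<^sup>+x. ennreal (exp (- (norm x)\<^sup>2 / (2 * \<tau>)) * exp (v t x)) \<partial>lborel)"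
      unfolding \<kappa>_def by (rule heat_eq_lebesgue[of _ "exp (B + N + K)"])
        (use \<tau> abs_le_D1[OF vb] in auto)
    also have "\<dots> \<le> (\<integral>\<^sup>+x. ereal_exp (- g t x) + ennreal (exp (- K)) * ennreal (exp (- (norm x)\<^sup>2 / (2 * \<tau>))) \<partial>lborel)"
    proof (rule nn_integral_mono)
      fix x :: 'a
      have e: "exp (- (norm x)\<^sup>2 / (2 * \<tau>)) \<le> 1" using \<tau> by simp
      have "ennreal (exp (- (norm x)\<^sup>2 / (2 * \<tau>)) * exp (v t x))
        \<le> ennreal (exp (- (norm x)\<^sup>2 / (2 * \<tau>))) * (ereal_exp (- g t x) + ennreal (exp (- K)))"
        by (auto simp: ennreal_mult v_def intro!: mult_left_mono clamp_exp_le)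
      also have "\<dots> \<le> ereal_exp (- g t x) + ennreal (exp (- K)) * ennreal (exp (- (norm x)\<^sup>2 / (2 * \<tau>)))"
        using mult_right_mono[of "ennreal (exp (- (norm x)\<^sup>2 / (2 * \<tau>)))" 1 "ereal_exp (- g t x)"] e
        by (simp add: distrib_left mult.commute[of _ "ennreal (exp (- K))"] add_right_mono)
      finally show "ennreal (exp (- (norm x)\<^sup>2 / (2 * \<tau>)) * exp (v t x))
        \<le> ereal_exp (- g t x) + ennreal (exp (- K)) * ennreal (exp (- (norm x)\<^sup>2 / (2 * \<tau>)))" .
    qed
    also have "\<dots> = (\<integral>\<^sup>+x. ereal_exp (- g t x) \<partial>lborel) + ennreal (exp (- K) * \<kappa>)"
      using gauss_integral_scaled[OF \<tau>, where 'a='a] less_imp_le[OF \<tau>]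
      by (simp add: nn_integral_add nn_integral_cmult \<kappa>_def ennreal_mult)
    also have "\<dots> \<le> ennreal (q t) + ennreal \<eta>"
      by (intro add_mono q t ennreal_leI K)
    also have "\<dots> = ennreal (q t + \<eta>)" using q(1)[OF t] \<eta> by simp
    finally have "\<kappa> * heat \<tau> (\<lambda>x. exp (v t x)) 0 \<le> q t + \<eta>"
      using \<eta> q(1)[OF t] by (subst (asm) ennreal_le_iff) auto
    then show "heat \<tau> (\<lambda>x. exp (v t x)) 0 \<le> (q t + \<eta>) / \<kappa>"
      using \<kappa> by (simp add: field_simps)
  qed
  have "(\<Sum>s\<in>S. c s * ln (p s)) - C * ln \<kappa> = (\<Sum>s\<in>S. c s * ln (p s / \<kappa>))"
  proof -
    have "c s * ln (p s / \<kappa>) = c s * ln (p s) - c s * ln \<kappa>" if "s \<in> S" for s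
      using p(1)[OF that] \<kappa> by (simp add: ln_div right_diff_distrib)
    then have "(\<Sum>s\<in>S. c s * ln (p s / \<kappa>)) = (\<Sum>s\<in>S. c s * ln (p s) - c s * ln \<kappa>)"
      by (intro sum.cong refl)
    then show ?thesis by (simp only: C_def sum_subtractf sum_distrib_right)
  qed
  also have "\<dots> \<le> (\<Sum>s\<in>S. c s * ln (heat \<tau> (\<lambda>x. exp (u s x)) 0))"
  proof (intro sum_mono mult_left_mono)
    show "ln (p s / \<kappa>) \<le> ln (heat \<tau> (\<lambda>x. exp (u s x)) 0)" if "s \<in> S" for s
    proof -
      have "0 < p s / \<kappa>" using p(1)[OF that] \<kappa> by simp
      then show ?thesis using hs[OF that] by (subst ln_le_cancel_iff) auto
    qed
  qed (simp add: c_pos less_imp_le)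
  also note main
  also have "(\<Sum>t\<in>T. d t * ln (heat \<tau> (\<lambda>x. exp (v t x)) 0)) \<le> (\<Sum>t\<in>T. d t * ln ((q t + \<eta>) / \<kappa>))"
  proof (intro sum_mono mult_left_mono)
    show "ln (heat \<tau> (\<lambda>x. exp (v t x)) 0) \<le> ln ((q t + \<eta>) / \<kappa>)" if "t \<in> T" for t
      using ht[OF that] by (subst ln_le_cancel_iff) auto
  qed (simp add: d_pos less_imp_le)
  also have "\<dots> = (\<Sum>t\<in>T. d t * ln (q t + \<eta>)) - C * ln \<kappa>"
  proof -
    have "d t * ln ((q t + \<eta>) / \<kappa>) = d t * ln (q t + \<eta>) - d t * ln \<kappa>" if "t \<in> T" for t
      using add_nonneg_pos[OF q(1)[OF that] \<eta>] \<kappa> by (simp add: ln_div right_diff_distrib)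
    then have "(\<Sum>t\<in>T. d t * ln ((q t + \<eta>) / \<kappa>)) = (\<Sum>t\<in>T. d t * ln (q t + \<eta>) - d t * ln \<kappa>)"
      by (intro sum.cong refl)
    then show ?thesis by (simp only: C_def mass sum_subtractf sum_distrib_right)
  qed
  finally show ?thesis by simp
qed

end

text \<open>
In the exponentiated form the limit \<open>\<eta> \<rightarrow> 0\<close> exists even if some \<open>q t\<close> vanishes. The limit is then
\<open>0\<close>, which is impossible as it is bounded below by \<open>exp X\<close>.
\<close>

lemma sum_ln_limit:
  fixes q :: "'t \<Rightarrow> real"
  assumes fin: "finite T" and d: "\<And>t. t \<in> T \<Longrightarrow> 0 < d t" and q: "\<And>t. t \<in> T \<Longrightarrow> 0 \<le> q t"
    and le: "\<And>\<eta>. 0 < \<eta> \<Longrightarrow> X \<le> (\<Sum>t\<in>T. d t * ln (q t + \<eta>))"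
  shows "\<forall>t\<in>T. 0 < q t" "X \<le> (\<Sum>t\<in>T. d t * ln (q t))"
proof -
  have ex: "(\<Prod>t\<in>T. (y t) powr d t) = exp (\<Sum>t\<in>T. d t * ln (y t))" if "\<And>t. t \<in> T \<Longrightarrow> 0 < y t" for y
    unfolding exp_sum[OF fin] by (intro prod.cong refl) (use that in \<open>force simp: powr_def\<close>)
  have lim: "((\<lambda>\<eta>. \<Prod>t\<in>T. (q t + \<eta>) powr d t) \<longlongrightarrow> (\<Prod>t\<in>T. q t powr d t)) (at_right 0)"
  proof (rule tendsto_prod)
    fix t assume t: "t \<in> T"
    have "((\<lambda>\<eta>. q t + \<eta>) \<longlongrightarrow> q t + 0) (at_right 0)" by (intro tendsto_intros)
    then show "((\<lambda>\<eta>. (q t + \<eta>) powr d t) \<longlongrightarrow> q t powr d t) (at_right 0)"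
      using d[OF t] q[OF t] by (intro tendsto_powr' tendsto_const) (auto simp: eventually_at_right_less intro!: eventually_at_right_less[THEN eventually_mono])
  qed
  have "eventually (\<lambda>\<eta>. exp X \<le> (\<Prod>t\<in>T. (q t + \<eta>) powr d t)) (at_right 0)"
    using eventually_at_right_less[of 0]
  proof eventually_elim
    case (elim \<eta>)
    then have "(\<Prod>t\<in>T. (q t + \<eta>) powr d t) = exp (\<Sum>t\<in>T. d t * ln (q t + \<eta>))"
      using q by (intro ex) (simp add: add_nonneg_pos)
    then show ?case using le[OF elim] by simp
  qed
  from tendsto_lowerbound[OF lim this] have le0: "exp X \<le> (\<Prod>t\<in>T. q t powr d t)" by simp
  show pos: "\<forall>t\<in>T. 0 < q t"
  proof (rule ccontr)
    assume "\<not> (\<forall>t\<in>T. 0 < q t)"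
    then obtain t where t: "t \<in> T" "q t = 0" using q by force
    then have "(\<Prod>t\<in>T. q t powr d t) = 0" using fin by (intro prod_zero) auto
    then show False using le0 exp_gt_zero[of X] by linarith
  qed
  show "X \<le> (\<Sum>t\<in>T. d t * ln (q t))" using le0 ex[of q] pos by simp
qed

section \<open>From the Gaussian to the Lebesgue measure\<close>

lemma nn_integral_truncation_tendsto:
  fixes f :: "'a::euclidean_space \<Rightarrow> ereal"
  assumes f[measurable]: "f \<in> borel_measurable borel" and fm: "\<And>x. f x \<noteq> -\<infinity>"
  shows "(\<lambda>k. \<integral>\<^sup>+x. ennreal (exp (- (norm x)\<^sup>2 / (2 * real (Suc k)))) * min (ereal_exp (- f x)) (ennreal (exp (real k))) \<partial>lborel)
    \<longlonglongrightarrow> (\<integral>\<^sup>+x. ereal_exp (- f x) \<partial>lborel)"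
proof (rule nn_integral_LIMSEQ)
  show "incseq (\<lambda>k x. ennreal (exp (- (norm x)\<^sup>2 / (2 * real (Suc k)))) * min (ereal_exp (- f x)) (ennreal (exp (real k))))"
    unfolding incseq_def le_fun_def
  proof (intro allI impI mult_mono)
    fix i j :: nat and x :: 'a assume ij: "i \<le> j"
    have "(norm x)\<^sup>2 / (2 * real (Suc j)) \<le> (norm x)\<^sup>2 / (2 * real (Suc i))"
      using ij by (intro divide_left_mono) auto
    then show "ennreal (exp (- (norm x)\<^sup>2 / (2 * real (Suc i)))) \<le> ennreal (exp (- (norm x)\<^sup>2 / (2 * real (Suc j))))"
      by (intro ennreal_leI) simp
    show "min (ereal_exp (- f x)) (ennreal (exp (real i))) \<le> min (ereal_exp (- f x)) (ennreal (exp (real j)))"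
      using ij by (intro min.mono order_refl ennreal_leI) simp
  qed auto
  fix x :: 'a
  obtain r where r: "0 \<le> r" "ereal_exp (- f x) = ennreal r"
    using fm[of x] by (cases "f x") (auto simp: ereal_exp_def intro: that[of "exp _"] that[of 0])
  obtain n :: nat where n: "r \<le> real n" using real_arch_simple by blast
  have "eventually (\<lambda>k. ennreal (exp (- (norm x)\<^sup>2 / (2 * real (Suc k))) * r)
      = ennreal (exp (- (norm x)\<^sup>2 / (2 * real (Suc k)))) * min (ereal_exp (- f x)) (ennreal (exp (real k)))) sequentially"
    using eventually_ge_at_top[of n]
  proof eventually_elim
    case (elim k)
    have "r \<le> exp (real k)" using n elim exp_ge_add_one_self[of "real k"] by linarith
    then have "min (ereal_exp (- f x)) (ennreal (exp (real k))) = ennreal r"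
      unfolding r(2) by (intro min_absorb1 ennreal_leI)
    then show ?case using r(1) by (simp add: ennreal_mult)
  qed
  moreover have "(\<lambda>k. ennreal (exp (- (norm x)\<^sup>2 / (2 * real (Suc k))) * r)) \<longlonglongrightarrow> ennreal (exp 0 * r)"
  proof (intro tendsto_ennrealI tendsto_mult tendsto_const tendsto_exp)
    have "(\<lambda>k. (- (norm x)\<^sup>2 / 2) / real k) \<longlonglongrightarrow> 0" by (rule lim_const_over_n)
    from LIMSEQ_Suc[OF this] show "(\<lambda>k. - (norm x)\<^sup>2 / (2 * real (Suc k))) \<longlonglongrightarrow> 0" by simp
  qed
  ultimately show "(\<lambda>k. ennreal (exp (- (norm x)\<^sup>2 / (2 * real (Suc k)))) * min (ereal_exp (- f x)) (ennreal (exp (real k))))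
      \<longlonglongrightarrow> ereal_exp (- f x)"
    unfolding r(2) by (auto intro: Lim_transform_eventually)
qed simp

context translation_contraction begin

text \<open>
If each \<open>p s\<close> is strictly below the integral \<open>I s\<close>, then it is also below the truncated Gaussian
integral for a late enough time and a high enough truncation level, so \<open>\<Sum> c s * ln (p s) \<le> D\<close> with a bound \<open>D\<close> independent of \<open>p\<close>. Were
some \<open>I s\<close> infinite, \<open>p s\<close> could be arbitrarily large, which contradicts this bound.
\<close>

lemma log_integral_inequality:
  assumes f: "\<And>s. s \<in> S \<Longrightarrow> f s \<in> borel_measurable borel" "\<And>s x. s \<in> S \<Longrightarrow> f s x \<noteq> -\<infinity>"
    and g: "\<And>t. t \<in> T \<Longrightarrow> g t \<in> borel_measurable borel" "\<And>t x. t \<in> T \<Longrightarrow> g t x \<noteq> -\<infinity>"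
    and le: "\<And>x. (\<Sum>t\<in>T. ereal (d t) * g t (A x t)) \<le> (\<Sum>s\<in>S. ereal (c s) * f s (x s))"
  defines "I \<equiv> \<lambda>s. \<integral>\<^sup>+x. ereal_exp (- f s x) \<partial>lborel"
    and "J \<equiv> \<lambda>t. \<integral>\<^sup>+x. ereal_exp (- g t x) \<partial>lborel"
  assumes I: "\<And>s. s \<in> S \<Longrightarrow> 0 < I s" and J: "\<And>t. t \<in> T \<Longrightarrow> J t < \<infinity>"
  shows "\<And>s. s \<in> S \<Longrightarrow> I s < \<infinity>" "\<And>t. t \<in> T \<Longrightarrow> 0 < J t"
    "(\<Sum>s\<in>S. c s * ln (enn2real (I s))) \<le> (\<Sum>t\<in>T. d t * ln (enn2real (J t)))"
proof -
  define q where "q t = enn2real (J t)" for t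
  have q: "J t = ennreal (q t)" if "t \<in> T" for t using J[OF that] by (simp add: q_def)
  have below_eta: "(\<Sum>s\<in>S. c s * ln (p s)) \<le> (\<Sum>t\<in>T. d t * ln (q t + \<eta>))"
    if p: "\<And>s. s \<in> S \<Longrightarrow> 0 < p s" "\<And>s. s \<in> S \<Longrightarrow> ennreal (p s) < I s" and \<eta>: "0 < \<eta>" for p \<eta>
  proof -
    define i where "i k s = (\<integral>\<^sup>+x. ennreal (exp (- (norm x)\<^sup>2 / (2 * real (Suc k)))) * min (ereal_exp (- f s x)) (ennreal (exp (real k))) \<partial>lborel)" for k s
    have "eventually (\<lambda>k. ennreal (p s) < i k s) sequentially" if s: "s \<in> S" for s
      unfolding i_def using p(2)[OF s] nn_integral_truncation_tendsto[OF f(1)[OF s] f(2)[OF s]]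
      unfolding I_def by (intro order_tendstoD) auto
    then have "eventually (\<lambda>k. \<forall>s\<in>S. ennreal (p s) < i k s) sequentially"
      using finite_S by (intro eventually_ball_finite) auto
    then obtain k where k: "\<And>s. s \<in> S \<Longrightarrow> ennreal (p s) < i k s"
      by (auto simp: eventually_sequentially)
    show ?thesis
    proof (rule truncated_inequality[OF f(1) g le, where B = "real k" and \<tau> = "real (Suc k)"])
      show "ennreal (p s) \<le> (\<integral>\<^sup>+x. ennreal (exp (- (norm x)\<^sup>2 / (2 * real (Suc k)))) * min (ereal_exp (- f s x)) (ennreal (exp (real k))) \<partial>lborel)"
        if "s \<in> S" for s using k[OF that] by (simp add: i_def)
      show "(\<integral>\<^sup>+x. ereal_exp (- g t x) \<partial>lborel) \<le> ennreal (q t)" if "t \<in> T" for t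
        using q[OF that] by (simp add: J_def)
      show "0 \<le> q t" for t by (simp add: q_def)
    qed (use p \<eta> in auto)
  qed
  define p0 where "p0 s = (if I s = \<infinity> then 1 else enn2real (I s) / 2)" for s
  have p0: "0 < p0 s" "ennreal (p0 s) < I s" if "s \<in> S" for s
  proof -
    show p: "0 < p0 s" using I[OF that] by (auto simp: p0_def enn2real_positive_iff less_top)
    show "ennreal (p0 s) < I s"
    proof (cases "I s = \<infinity>")
      case False
      then have "I s = ennreal (2 * p0 s)" by (simp add: p0_def less_top)
      then show ?thesis using p by (simp add: ennreal_less_iff)
    qed (simp add: p0_def)
  qed
  have qnn: "0 \<le> q t" for t by (simp add: q_def)
  have qpos: "\<forall>t\<in>T. 0 < q t"
    using sum_ln_limit(1)[OF finite_T d_pos qnn below_eta[OF p0]] by blast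
  then show "0 < J t" if "t \<in> T" for t using q[OF that] that by simp
  define D where "D = (\<Sum>t\<in>T. d t * ln (q t))"
  have below: "(\<Sum>s\<in>S. c s * ln (p s)) \<le> D"
    if p: "\<And>s. s \<in> S \<Longrightarrow> 0 < p s" "\<And>s. s \<in> S \<Longrightarrow> ennreal (p s) < I s" for p
    unfolding D_def using sum_ln_limit(2)[OF finite_T d_pos qnn below_eta[OF p]] by blast
  show Ifin: "I s < \<infinity>" if s: "s \<in> S" for s
  proof (rule ccontr)
    assume "\<not> I s < \<infinity>"
    then have inf: "I s = \<infinity>" by (metis infinity_ennreal_def top.not_eq_extremum)
    define r where "r = (\<Sum>i\<in>S - {s}. c i * ln (p0 i))"
    \<comment> \<open>Large enough for \<open>c s * ln R + r\<close> to exceed \<open>D\<close>.\<close>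
    define R where "R = exp ((D - r) / c s + 1)"
    have "(\<Sum>i\<in>S. c i * ln ((p0(s := R)) i)) \<le> D"
    proof (rule below)
      fix s' assume "s' \<in> S"
      then show "0 < (p0(s := R)) s'" "ennreal ((p0(s := R)) s') < I s'"
        using p0 inf by (auto simp: R_def)
    qed
    also have "(\<Sum>i\<in>S. c i * ln ((p0(s := R)) i)) = c s * ln R + r"
      unfolding r_def using s finite_S by (simp add: sum.remove)
    also have "c s * ln R = D - r + c s" using c_pos[OF s] by (simp add: R_def field_simps)
    finally show False using c_pos[OF s] by simp
  qed
  define y where "y s = enn2real (I s)" for s
  have y: "I s = ennreal (y s)" "0 < y s" if "s \<in> S" for s
    using Ifin[OF that] I[OF that] by (auto simp: y_def enn2real_positive_iff)
  have "(\<Sum>s\<in>S. c s * ln (y s)) \<le> D"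
  proof (rule field_le_epsilon)
    fix e :: real assume e: "0 < e"
    define C where "C = (\<Sum>s\<in>S. c s)"
    have C: "0 \<le> C" unfolding C_def using c_pos by (auto intro: sum_nonneg less_imp_le)
    \<comment> \<open>Scaling every \<open>y s\<close> by \<open>exp (- \<rho>)\<close> costs \<open>C * \<rho> \<le> e\<close>; the summand \<open>1\<close> avoids dividing by \<open>0\<close>.\<close>
    define \<rho> where "\<rho> = e / (C + 1)"
    have \<rho>: "0 < \<rho>" "C * \<rho> \<le> e" using e C by (auto simp: \<rho>_def field_simps)
    have "(\<Sum>s\<in>S. c s * ln (exp (- \<rho>) * y s)) \<le> D"
    proof (rule below)
      fix s assume s: "s \<in> S"
      show "0 < exp (- \<rho>) * y s" using y[OF s] by simp
      have "exp (- \<rho>) * y s < 1 * y s" using \<rho> y[OF s] by (intro mult_strict_right_mono) auto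
      then show "ennreal (exp (- \<rho>) * y s) < I s" using y[OF s] by (simp add: ennreal_less_iff)
    qed
    moreover have "(\<Sum>s\<in>S. c s * ln (exp (- \<rho>) * y s)) = (\<Sum>s\<in>S. c s * ln (y s)) - C * \<rho>"
    proof -
      have "c s * ln (exp (- \<rho>) * y s) = c s * ln (y s) - c s * \<rho>" if "s \<in> S" for s
        using y[OF that] by (simp add: ln_mult algebra_simps)
      then show ?thesis by (simp add: sum_subtractf C_def sum_distrib_right)
    qed
    ultimately show "(\<Sum>s\<in>S. c s * ln (y s)) \<le> D + e" using \<rho>(2) by linarith
  qed
  then show "(\<Sum>s\<in>S. c s * ln (enn2real (I s))) \<le> (\<Sum>t\<in>T. d t * ln (enn2real (J t)))"
    by (simp add: D_def y_def q_def)
qed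

end

section \<open>Measures of finite support\<close>

text \<open>
Writing the measure as the image of a point measure makes the integration theory of point measures available.
The \<open>\<sigma>\<close>-algebra may fail to separate the points of \<open>S\<close>; nevertheless measurable functions are integrated
by evaluating them at these points.
\<close>

definition atomic_measure :: "'a measure \<Rightarrow> 'a set \<Rightarrow> ('a \<Rightarrow> real) \<Rightarrow> bool" where
  "atomic_measure M S c \<longleftrightarrow> finite S \<and> S \<subseteq> space M \<and> (\<forall>s\<in>S. 0 < c s)
     \<and> distr (point_measure S (\<lambda>s. ennreal (c s))) M (\<lambda>s. s) = M"

lemma finitely_supported_atomic:
  assumes "finitely_supported M"
  obtains S c where "atomic_measure M S c"
proof -
  obtain S c where S: "finite S" "S \<subseteq> space M" "\<And>s. s \<in> S \<Longrightarrow> 0 < c s"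
    and e: "\<And>B. B \<in> sets M \<Longrightarrow> emeasure M B = (\<Sum>s\<in>S. ennreal (c s) * emeasure (return M s) B)"
    using assms unfolding finitely_supported_def by blast
  have m: "(\<lambda>s. s) \<in> point_measure S (\<lambda>s. ennreal (c s)) \<rightarrow>\<^sub>M M"
    using S(2) by (auto simp: measurable_def space_point_measure sets_point_measure)
  have "distr (point_measure S (\<lambda>s. ennreal (c s))) M (\<lambda>s. s) = M"
  proof (rule measure_eqI)
    fix B assume "B \<in> sets (distr (point_measure S (\<lambda>s. ennreal (c s))) M (\<lambda>s. s))"
    then have B: "B \<in> sets M" by simp
    have "emeasure (distr (point_measure S (\<lambda>s. ennreal (c s))) M (\<lambda>s. s)) B
      = emeasure (point_measure S (\<lambda>s. ennreal (c s))) (B \<inter> S)"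
      using B m by (simp add: emeasure_distr space_point_measure)
    also have "\<dots> = (\<Sum>s\<in>B \<inter> S. ennreal (c s))"
      using S(1) by (intro emeasure_point_measure_finite) auto
    also have "\<dots> = (\<Sum>s\<in>S. ennreal (c s) * indicator B s)"
      using S(1) by (simp add: Int_commute[of B S] sum.inter_restrict indicator_def if_distrib cong: if_cong)
    also have "\<dots> = emeasure M B"
      unfolding e[OF B] using B S(2) by (intro sum.cong refl) (auto simp: emeasure_return)
    finally show "emeasure (distr (point_measure S (\<lambda>s. ennreal (c s))) M (\<lambda>s. s)) B = emeasure M B" .
  qed simp
  then show ?thesis using S that[of S c] by (auto simp: atomic_measure_def)
qed

lemma atomic_measurable: "atomic_measure M S c \<Longrightarrow> (\<lambda>s. s) \<in> point_measure S (\<lambda>s. ennreal (c s)) \<rightarrow>\<^sub>M M"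
  by (auto simp: atomic_measure_def measurable_def space_point_measure sets_point_measure)

lemma nn_integral_atomic:
  assumes M: "atomic_measure M S c" and h: "h \<in> borel_measurable M"
  shows "(\<integral>\<^sup>+s. h s \<partial>M) = (\<Sum>s\<in>S. ennreal (c s) * h s)"
proof -
  have "(\<integral>\<^sup>+s. h s \<partial>M) = (\<integral>\<^sup>+s. h s \<partial>distr (point_measure S (\<lambda>s. ennreal (c s))) M (\<lambda>s. s))"
    using M by (simp add: atomic_measure_def)
  also have "\<dots> = (\<integral>\<^sup>+s. h s \<partial>point_measure S (\<lambda>s. ennreal (c s)))"
    using h by (intro nn_integral_distr atomic_measurable[OF M]) simp
  also have "\<dots> = (\<Sum>s\<in>S. ennreal (c s) * h s)"
    using M by (simp add: atomic_measure_def nn_integral_point_measure_finite mult.commute)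
  finally show ?thesis .
qed

text \<open>
An exceptional null set lies in the \<open>\<sigma>\<close>-algebra and therefore avoids every point of positive mass.
\<close>

lemma atomic_AE:
  assumes M: "atomic_measure M S c" and P: "AE s in M. P s" and s: "s \<in> S"
  shows "P s"
proof -
  obtain N where N: "{s \<in> space M. \<not> P s} \<subseteq> N" "emeasure M N = 0" "N \<in> sets M"
    using AE_E[OF P] by blast
  have "(\<Sum>s\<in>S. ennreal (c s) * indicator N s) = 0"
    using nn_integral_atomic[OF M, of "indicator N"] N by simp
  moreover have "finite S" "0 < c s" using M s by (auto simp: atomic_measure_def)
  ultimately have "ennreal (c s) * indicator N s = (0::ennreal)"
    using s by (subst (asm) sum_nonneg_eq_0_iff) auto
  then have "s \<notin> N" using \<open>0 < c s\<close> by (auto simp: ennreal_eq_0_iff)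
  then show ?thesis using N(1) M s by (auto simp: atomic_measure_def)
qed

lemma atomic_integral:
  fixes h :: "'a \<Rightarrow> real"
  assumes M: "atomic_measure M S c" and h: "h \<in> borel_measurable M"
  shows "integrable M h" "(\<integral>s. h s \<partial>M) = (\<Sum>s\<in>S. c s * h s)"
proof -
  have fin: "finite S" and c: "\<And>s. s \<in> S \<Longrightarrow> 0 \<le> c s"
    and eq: "distr (point_measure S (\<lambda>s. ennreal (c s))) M (\<lambda>s. s) = M"
    using M by (auto simp: atomic_measure_def intro: less_imp_le)
  show "integrable M h"
    using integrable_distr_eq[OF atomic_measurable[OF M] h] fin
    by (simp add: eq integrable_point_measure_finite)
  have "(\<integral>s. h s \<partial>M) = (\<integral>s. h s \<partial>distr (point_measure S (\<lambda>s. ennreal (c s))) M (\<lambda>s. s))"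
    by (simp only: eq)
  also have "\<dots> = (\<Sum>s\<in>S. c s * h s)"
    by (subst integral_distr[OF atomic_measurable[OF M] h])
      (use fin c in \<open>simp add: lebesgue_integral_point_measure_finite\<close>)
  finally show "(\<integral>s. h s \<partial>M) = (\<Sum>s\<in>S. c s * h s)" .
qed

lemma atomic_L2:
  assumes M: "atomic_measure M S c"
  shows "L2 M = (borel_measurable M :: ('a \<Rightarrow> 'b::euclidean_space) set)"
proof -
  have "integrable M (\<lambda>s. (norm (\<alpha> s))\<^sup>2)" if "\<alpha> \<in> borel_measurable M" for \<alpha> :: "'a \<Rightarrow> 'b"
    by (rule atomic_integral(1)[OF M]) (use that in measurable)
  then show ?thesis by (auto simp: L2_def)
qed

lemma atomic_L2_norm:
  fixes \<alpha> :: "'a \<Rightarrow> 'b::euclidean_space"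
  assumes M: "atomic_measure M S c" and "\<alpha> \<in> borel_measurable M"
  shows "L2_norm M \<alpha> = sqrt (\<Sum>s\<in>S. c s * (norm (\<alpha> s))\<^sup>2)"
  unfolding L2_norm_def using assms(2) by (subst atomic_integral(2)[OF M]) auto

lemma atomic_nn_integral_infinity:
  assumes M: "atomic_measure M S c" and h[measurable]: "h \<in> borel_measurable M" and r: "r \<in> S" "h r = \<infinity>"
  shows "(\<integral>\<^sup>+s. e2ennreal (h s) \<partial>M) = \<infinity>"
proof -
  have fin: "finite S" and c: "0 < c r" using M r by (auto simp: atomic_measure_def)
  have "ennreal (c r) * e2ennreal (h r) \<le> (\<Sum>s\<in>S. ennreal (c s) * e2ennreal (h s))"
    using r fin by (intro member_le_sum) auto
  also have "\<dots> = (\<integral>\<^sup>+s. e2ennreal (h s) \<partial>M)"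
    by (rule nn_integral_atomic[OF M, symmetric]) measurable
  finally have "ennreal (c r) * e2ennreal (h r) \<le> (\<integral>\<^sup>+s. e2ennreal (h s) \<partial>M)" .
  moreover have "ennreal (c r) * e2ennreal (h r) = \<infinity>"
    using r c by (simp add: e2ennreal_infty ennreal_mult_top)
  ultimately show ?thesis by (simp add: top.extremum_unique)
qed

lemma atomic_ereal_integral:
  assumes M: "atomic_measure M S c" and h[measurable]: "h \<in> borel_measurable M" and ninf: "\<And>s. s \<in> S \<Longrightarrow> h s \<noteq> -\<infinity>"
  shows "ereal_integral M h = (\<Sum>s\<in>S. ereal (c s) * h s)"
proof -
  have fin: "finite S" and c: "\<And>s. s \<in> S \<Longrightarrow> 0 < c s" using M by (auto simp: atomic_measure_def)
  have pos: "(\<integral>\<^sup>+s. e2ennreal (h s) \<partial>M) = (\<Sum>s\<in>S. ennreal (c s) * e2ennreal (h s))"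
    by (rule nn_integral_atomic[OF M]) measurable
  have neg: "(\<integral>\<^sup>+s. e2ennreal (- h s) \<partial>M) = (\<Sum>s\<in>S. ennreal (c s) * e2ennreal (- h s))"
    by (rule nn_integral_atomic[OF M]) measurable
  show ?thesis
  proof (cases "\<exists>s\<in>S. h s = \<infinity>")
    case True
    then obtain r where r: "r \<in> S" "h r = \<infinity>" by blast
    have "(\<integral>\<^sup>+s. e2ennreal (h s) \<partial>M) = \<infinity>"
      by (rule atomic_nn_integral_infinity[OF M h r])
    moreover have "(\<Sum>s\<in>S. ereal (c s) * h s) = \<infinity>"
      using r c[OF r(1)] fin by (subst sum_Pinfty) auto
    ultimately show ?thesis by (simp add: ereal_integral_def)
  next
    case False
    then have "\<exists>y. h s = ereal y" if "s \<in> S" for s using ninf[OF that] that by (cases "h s") auto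
    then obtain y where y: "\<And>s. s \<in> S \<Longrightarrow> h s = ereal (y s)" by metis
    have "(\<Sum>s\<in>S. ennreal (c s) * e2ennreal (h s)) = (\<Sum>s\<in>S. ennreal (c s * max 0 (y s)))"
      by (intro sum.cong refl) (simp add: y ennreal_mult less_imp_le c e2ennreal_ereal ennreal_max_0')
    also have "\<dots> = ennreal (\<Sum>s\<in>S. c s * max 0 (y s))" using c by (intro sum_ennreal) (simp add: less_imp_le)
    finally have 1: "enn2ereal (\<integral>\<^sup>+s. e2ennreal (h s) \<partial>M) = ereal (\<Sum>s\<in>S. c s * max 0 (y s))"
      using c by (simp add: pos enn2ereal_ennreal sum_nonneg less_imp_le)
    have "(\<Sum>s\<in>S. ennreal (c s) * e2ennreal (- h s)) = (\<Sum>s\<in>S. ennreal (c s * max 0 (- y s)))"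
      by (intro sum.cong refl) (simp add: y ennreal_mult less_imp_le c e2ennreal_ereal ennreal_max_0')
    also have "\<dots> = ennreal (\<Sum>s\<in>S. c s * max 0 (- y s))" using c by (intro sum_ennreal) (simp add: less_imp_le)
    finally have 2: "enn2ereal (\<integral>\<^sup>+s. e2ennreal (- h s) \<partial>M) = ereal (\<Sum>s\<in>S. c s * max 0 (- y s))"
      using c by (simp add: neg enn2ereal_ennreal sum_nonneg less_imp_le)
    have "(\<Sum>s\<in>S. c s * max 0 (y s)) - (\<Sum>s\<in>S. c s * max 0 (- y s)) = (\<Sum>s\<in>S. c s * y s)"
      by (subst sum_subtractf[symmetric]) (intro sum.cong refl, simp add: max_def)
    then show ?thesis by (simp add: ereal_integral_def 1 2 y)
  qed
qed

section \<open>Operators between spaces of square-integrable functions\<close>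

text \<open>
A configuration on the finite set \<open>S\<close> is represented by a measurable function in order to apply the
operator to it. The complement of \<open>S\<close> is a null set, so the extension by \<open>0\<close> determines the class.
\<close>

definition extend_zero :: "'s set \<Rightarrow> ('s \<Rightarrow> 'a::zero) \<Rightarrow> 's \<Rightarrow> 'a" where
  "extend_zero S x = (\<lambda>s. if s \<in> S then x s else 0)"

lemma extend_zero_measurable:
  fixes x :: "'s::t1_space \<Rightarrow> 'a::euclidean_space"
  assumes "sets M = sets borel" and S: "finite S"
  shows "extend_zero S x \<in> borel_measurable M"
proof -
  have [measurable]: "{s} \<in> sets M" for s using assms(1) by simp
  have "(\<lambda>r. \<Sum>s\<in>S. indicator {s} r *\<^sub>R x s) \<in> borel_measurable M" by measurable
  also have "(\<lambda>r. \<Sum>s\<in>S. indicator {s} r *\<^sub>R x s) = extend_zero S x"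
  proof
    fix r
    have "(\<Sum>s\<in>S. indicator {s} r *\<^sub>R x s) = (\<Sum>s\<in>S. if r = s then x s else 0)"
      by (intro sum.cong refl) auto
    then show "(\<Sum>s\<in>S. indicator {s} r *\<^sub>R x s) = extend_zero S x r"
      using S by (simp add: extend_zero_def)
  qed
  finally show ?thesis .
qed

text \<open>
The operator norm is a supremum of reals, which bounds the individual quotients only if the set of
quotients is bounded. Continuity at \<open>0\<close> provides this: with the \<open>\<delta>\<close> belonging to \<open>\<epsilon> = 1\<close>, all
quotients are at most \<open>2 / \<delta>\<close> by homogeneity. Quotients with denominator \<open>0\<close> have the value \<open>0\<close>.
\<close>

lemma atomic_L2_contraction:
  fixes A :: "('s \<Rightarrow> 'a::euclidean_space) \<Rightarrow> 't \<Rightarrow> 'b::euclidean_space"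
  assumes M: "atomic_measure M S c" and N: "atomic_measure N T d"
    and lin: "L2_linear M N A" and cont: "L2_continuous M N A" and on: "L2_onorm M N A \<le> 1"
    and \<alpha>: "\<alpha> \<in> L2 M" and nz: "L2_norm M \<alpha> \<noteq> 0"
  shows "L2_norm N (A \<alpha>) \<le> L2_norm M \<alpha>"
proof -
  have Am: "A \<beta> \<in> borel_measurable N" if "\<beta> \<in> L2 M" for \<beta>
  proof -
    have "A \<beta> \<in> L2 N" using lin that unfolding L2_linear_def by blast
    then show ?thesis unfolding atomic_L2[OF N] .
  qed
  have scale: "A (\<lambda>s. r *\<^sub>R \<beta> s) t = r *\<^sub>R A \<beta> t" if "\<beta> \<in> L2 M" "t \<in> T" for r \<beta> t
  proof (rule atomic_AE[OF N _ that(2)])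
    show "AE t in N. A (\<lambda>s. r *\<^sub>R \<beta> s) t = r *\<^sub>R A \<beta> t"
      using lin that(1) unfolding L2_linear_def by blast
  qed
  have rL2: "(\<lambda>s. r *\<^sub>R \<beta> s) \<in> L2 M" if "\<beta> \<in> L2 M" for r and \<beta> :: "'s \<Rightarrow> 'a"
    using that unfolding atomic_L2[OF M] by measurable
  have normM: "L2_norm M (\<lambda>s. r *\<^sub>R \<beta> s) = \<bar>r\<bar> * L2_norm M \<beta>" if "\<beta> \<in> L2 M" for r and \<beta> :: "'s \<Rightarrow> 'a"
  proof -
    have "(\<Sum>s\<in>S. c s * (norm (r *\<^sub>R \<beta> s))\<^sup>2) = r\<^sup>2 * (\<Sum>s\<in>S. c s * (norm (\<beta> s))\<^sup>2)"
      by (simp add: power_mult_distrib sum_distrib_left mult_ac)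
    then show ?thesis
      using atomic_L2_norm[OF M, of \<beta>] atomic_L2_norm[OF M, of "\<lambda>s. r *\<^sub>R \<beta> s"] that rL2[OF that, of r]
      by (simp add: atomic_L2[OF M] real_sqrt_mult)
  qed
  have norm0: "0 \<le> L2_norm M \<beta>" for \<beta> :: "'s \<Rightarrow> 'a"
    unfolding L2_norm_def by (simp add: integral_nonneg_AE)
  have z: "(\<lambda>_. 0) \<in> L2 M" unfolding atomic_L2[OF M] by simp
  have A0: "A (\<lambda>_. 0) t = 0" if "t \<in> T" for t using scale[OF z that, of 0] by simp
  obtain \<delta> where \<delta>: "0 < \<delta>" "\<And>\<beta>. \<beta> \<in> L2 M \<Longrightarrow> L2_norm M \<beta> < \<delta> \<Longrightarrow> L2_norm N (\<lambda>t. A \<beta> t - A (\<lambda>_. 0) t) < 1"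
    using cont[unfolded L2_continuous_def, rule_format, OF z zero_less_one] by auto
  have small: "L2_norm N (A \<beta>) < 1" if \<beta>: "\<beta> \<in> L2 M" "L2_norm M \<beta> < \<delta>" for \<beta>
  proof -
    have "L2_norm N (\<lambda>t. A \<beta> t - A (\<lambda>_. 0) t) = L2_norm N (A \<beta>)"
      using Am[OF \<beta>(1)] Am[OF z] by (simp add: atomic_L2_norm[OF N] A0)
    then show ?thesis using \<delta>(2)[OF \<beta>(1)] \<beta>(2) by simp
  qed
  have normN: "L2_norm N (A (\<lambda>s. r *\<^sub>R \<beta> s)) = \<bar>r\<bar> * L2_norm N (A \<beta>)" if "\<beta> \<in> L2 M" for r \<beta>
  proof -
    have "(\<Sum>t\<in>T. d t * (norm (A (\<lambda>s. r *\<^sub>R \<beta> s) t))\<^sup>2) = r\<^sup>2 * (\<Sum>t\<in>T. d t * (norm (A \<beta> t))\<^sup>2)"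
      using scale[OF that] by (simp add: power_mult_distrib sum_distrib_left mult_ac)
    then show ?thesis
      using atomic_L2_norm[OF N Am[OF that]] atomic_L2_norm[OF N Am[OF rL2[OF that, of r]]]
      by (simp add: real_sqrt_mult)
  qed
  have "bdd_above ((\<lambda>\<beta>. L2_norm N (A \<beta>) / L2_norm M \<beta>) ` L2 M)"
  proof (rule bdd_aboveI2)
    fix \<beta> :: "'s \<Rightarrow> 'a" assume \<beta>: "\<beta> \<in> L2 M"
    show "L2_norm N (A \<beta>) / L2_norm M \<beta> \<le> 2 / \<delta>"
    proof (cases "L2_norm M \<beta> = 0")
      case False
      then have p: "0 < L2_norm M \<beta>" using norm0[of \<beta>] by simp
      define r where "r = \<delta> / (2 * L2_norm M \<beta>)"
      have r: "0 < r" "r * L2_norm M \<beta> < \<delta>" using \<delta>(1) p by (auto simp: r_def)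
      have "L2_norm N (A (\<lambda>s. r *\<^sub>R \<beta> s)) < 1"
        using r by (intro small rL2 \<beta>) (simp add: normM[OF \<beta>])
      then have "r * L2_norm N (A \<beta>) < 1" using r by (simp add: normN[OF \<beta>])
      then show ?thesis using \<delta>(1) p by (simp add: r_def field_simps)
    qed (use \<delta>(1) in simp)
  qed
  then have "L2_norm N (A \<alpha>) / L2_norm M \<alpha> \<le> L2_onorm M N A"
    unfolding L2_onorm_def using \<alpha> by (rule cSUP_upper2[OF _ _ order_refl])
  then have "L2_norm N (A \<alpha>) / L2_norm M \<alpha> \<le> 1" using on by linarith
  then show ?thesis using nz norm0[of \<alpha>] by (simp add: divide_le_eq_1)
qed

text \<open>
Identities that hold almost everywhere hold at the points of \<open>T\<close>. A constant function and its
restriction to \<open>S\<close>, extended by \<open>0\<close>, represent the same class because the complement of \<open>S\<close> is a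
null set; this is where points have to be closed and \<open>M\<close> has to be a Borel measure.
\<close>

lemma translation_contraction_of_operator:
  fixes A :: "('s::t1_space \<Rightarrow> 'a::euclidean_space) \<Rightarrow> 't \<Rightarrow> 'a"
  assumes M: "atomic_measure M S c" and N: "atomic_measure N T d" and borel: "sets M = sets borel"
    and mass: "emeasure M (space M) = emeasure N (space N)"
    and lin: "L2_linear M N A" and cont: "L2_continuous M N A" and on: "L2_onorm M N A \<le> 1"
    and const: "\<And>v. AE t in N. A (\<lambda>_. v) t = v"
  shows "translation_contraction S T c d (\<lambda>x. A (extend_zero S x))"
proof -
  have S: "finite S" "S \<subseteq> space M" "\<And>s. s \<in> S \<Longrightarrow> 0 < c s"
    and T: "finite T" "T \<subseteq> space N" "\<And>t. t \<in> T \<Longrightarrow> 0 < d t"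
    using M N by (auto simp: atomic_measure_def)
  have E: "extend_zero S x \<in> L2 M" for x :: "'s \<Rightarrow> 'a"
    unfolding atomic_L2[OF M] by (rule extend_zero_measurable[OF borel S(1)])
  have Am: "A \<beta> \<in> borel_measurable N" if "\<beta> \<in> L2 M" for \<beta>
  proof -
    have "A \<beta> \<in> L2 N" using lin that unfolding L2_linear_def by blast
    then show ?thesis unfolding atomic_L2[OF N] .
  qed
  have descends: "AE t in N. A \<alpha> t = A \<beta> t"
    if "\<alpha> \<in> L2 M" "\<beta> \<in> L2 M" "AE s in M. \<alpha> s = \<beta> s" for \<alpha> \<beta>
    using lin that unfolding L2_linear_def by simp
  have total: "emeasure M (space M) = ennreal (\<Sum>s\<in>S. c s)" "emeasure N (space N) = ennreal (\<Sum>t\<in>T. d t)"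
    using nn_integral_atomic[OF M, of "\<lambda>_. 1"] nn_integral_atomic[OF N, of "\<lambda>_. 1"] S T
    by (simp_all add: sum_ennreal less_imp_le)
  have const': "A (extend_zero S (\<lambda>_. v)) t = v" if t: "t \<in> T" for v t
  proof -
    have [measurable]: "- S \<in> sets M"
      using borel finite_imp_closed[OF S(1)] by (simp add: borel_open closed_def)
    have "emeasure M (- S) = 0"
      using nn_integral_atomic[OF M, of "indicator (- S)"] by (simp add: nn_integral_indicator)
    then have "AE s in M. s \<notin> - S" by (intro AE_not_in) auto
    then have "AE s in M. extend_zero S (\<lambda>_. v) s = v" by eventually_elim (simp add: extend_zero_def)
    moreover have "(\<lambda>_. v) \<in> L2 M" unfolding atomic_L2[OF M] by simp
    ultimately have "AE t in N. A (extend_zero S (\<lambda>_. v)) t = A (\<lambda>_. v) t"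
      using descends[OF E] by blast
    then have "AE t in N. A (extend_zero S (\<lambda>_. v)) t = v" using const[of v] by eventually_elim simp
    then show ?thesis by (rule atomic_AE[OF N _ t])
  qed
  show ?thesis
  proof
    show "finite S" "finite T" by fact+
    show "0 < c s" if "s \<in> S" for s using S that by blast
    show "0 < d t" if "t \<in> T" for t using T that by blast
    show "(\<Sum>s\<in>S. c s) = (\<Sum>t\<in>T. d t)"
      using mass S(3) T(3) unfolding total by (subst (asm) ennreal_inj) (auto intro: sum_nonneg less_imp_le)
    show "A (extend_zero S (\<lambda>s. x s + y s)) t = A (extend_zero S x) t + A (extend_zero S y) t" if "t \<in> T" for x y t
    proof (rule atomic_AE[OF N _ that])
      have "extend_zero S (\<lambda>s. x s + y s) = (\<lambda>s. extend_zero S x s + extend_zero S y s)"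
        by (auto simp: extend_zero_def)
      then show "AE t in N. A (extend_zero S (\<lambda>s. x s + y s)) t = A (extend_zero S x) t + A (extend_zero S y) t"
        using lin E unfolding L2_linear_def by metis
    qed
    show "A (extend_zero S (\<lambda>s. r *\<^sub>R x s)) t = r *\<^sub>R A (extend_zero S x) t" if "t \<in> T" for r x t
    proof (rule atomic_AE[OF N _ that])
      have "extend_zero S (\<lambda>s. r *\<^sub>R x s) = (\<lambda>s. r *\<^sub>R extend_zero S x s)"
        by (auto simp: extend_zero_def)
      then show "AE t in N. A (extend_zero S (\<lambda>s. r *\<^sub>R x s)) t = r *\<^sub>R A (extend_zero S x) t"
        using lin E unfolding L2_linear_def by metis
    qed
    show "A (extend_zero S (\<lambda>_. v)) t = v" if "t \<in> T" for v t using const'[OF that] .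
    show "(\<Sum>t\<in>T. d t * (norm (A (extend_zero S x) t))\<^sup>2) \<le> (\<Sum>s\<in>S. c s * (norm (x s))\<^sup>2)" for x
    proof -
      have nM: "L2_norm M (extend_zero S x) = sqrt (\<Sum>s\<in>S. c s * (norm (x s))\<^sup>2)"
        using E[of x] unfolding atomic_L2[OF M] by (simp add: atomic_L2_norm[OF M] extend_zero_def)
      show ?thesis
      proof (cases "L2_norm M (extend_zero S x) = 0")
        case True
        then have "(\<Sum>s\<in>S. c s * (norm (x s))\<^sup>2) = 0" using nM by simp
        then have "\<forall>s\<in>S. c s * (norm (x s))\<^sup>2 = 0"
          using S by (subst (asm) sum_nonneg_eq_0_iff) (auto simp: less_imp_le)
        then have "x s = 0" if "s \<in> S" for s using S(3)[OF that] that by auto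
        then have "extend_zero S x = extend_zero S (\<lambda>_. 0)" by (auto simp: extend_zero_def)
        then have "(\<Sum>t\<in>T. d t * (norm (A (extend_zero S x) t))\<^sup>2) = 0" using const'[of _ 0] by simp
        then show ?thesis using S(3) by (simp add: sum_nonneg less_imp_le)
      next
        case False
        show ?thesis
          using atomic_L2_contraction[OF M N lin cont on E False]
          unfolding atomic_L2_norm[OF N Am[OF E]] nM by simp
      qed
    qed
  qed
qed

theorem theorem1p6:
  fixes M1 :: "'s :: polish_space measure"
    and M2 :: "'t measure"
    and A :: "('s \<Rightarrow> real ^ 'n) \<Rightarrow> ('t \<Rightarrow> real ^ 'n)"
    and f :: "'s \<Rightarrow> real ^ 'n \<Rightarrow> ereal"
    and g :: "'t \<Rightarrow> real ^ 'n \<Rightarrow> ereal"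
  assumes "sets M1 = sets borel"
    and "finitely_supported M1" and "finitely_supported M2"
    and "emeasure M1 (space M1) = emeasure M2 (space M2)"
    and "emeasure M1 (space M1) < \<infinity>"
    and "L2_linear M1 M2 A" and "L2_continuous M1 M2 A"
    and "L2_onorm M1 M2 A \<le> 1"
    and "\<And>v. AE t in M2. A (\<lambda>_. v) t = v"
    and "\<And>s x. s \<in> space M1 \<Longrightarrow> f s x \<noteq> -\<infinity>"
    and "\<And>t x. t \<in> space M2 \<Longrightarrow> g t x \<noteq> -\<infinity>"
    and "\<And>s. s \<in> space M1 \<Longrightarrow> f s \<in> borel_measurable borel"
    and "\<And>t. t \<in> space M2 \<Longrightarrow> g t \<in> borel_measurable borel"
    and "(\<lambda>(s, x). f s x) \<in> borel_measurable (M1 \<Otimes>\<^sub>M borel)"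
    and "(\<lambda>(t, x). g t x) \<in> borel_measurable (M2 \<Otimes>\<^sub>M borel)"
    and "semi_integrable M1 (\<lambda>s. ennreal_ln (\<integral>\<^sup>+x. ereal_exp (- f s x) \<partial>lborel))"
    and "semi_integrable M2 (\<lambda>t. ennreal_ln (\<integral>\<^sup>+x. ereal_exp (- g t x) \<partial>lborel))"
    and "\<And>\<alpha>. \<alpha> \<in> L2 M1 \<Longrightarrow>
           ereal_integral M2 (\<lambda>t. g t (A \<alpha> t)) \<le> ereal_integral M1 (\<lambda>s. f s (\<alpha> s))"
  shows "ereal_integral M2 (\<lambda>t. - ennreal_ln (\<integral>\<^sup>+x. ereal_exp (- g t x) \<partial>lborel))
       \<le> ereal_integral M1 (\<lambda>s. - ennreal_ln (\<integral>\<^sup>+x. ereal_exp (- f s x) \<partial>lborel))"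
proof -
  obtain S c where M: "atomic_measure M1 S c" using finitely_supported_atomic[OF assms(2)] by blast
  obtain T d where N: "atomic_measure M2 T d" using finitely_supported_atomic[OF assms(3)] by blast
  have S: "finite S" "S \<subseteq> space M1" "\<And>s. s \<in> S \<Longrightarrow> 0 < c s"
    and T: "finite T" "T \<subseteq> space M2" "\<And>t. t \<in> T \<Longrightarrow> 0 < d t"
    using M N by (auto simp: atomic_measure_def)
  interpret translation_contraction S T c d "\<lambda>x. A (extend_zero S x)"
    by (rule translation_contraction_of_operator[OF M N assms(1,4,6,7,8,9)])
  define I where "I s = (\<integral>\<^sup>+x. ereal_exp (- f s x) \<partial>lborel)" for s
  define J where "J t = (\<integral>\<^sup>+x. ereal_exp (- g t x) \<partial>lborel)" for t
  note semiI = assms(16)[folded I_def] and semiJ = assms(17)[folded J_def]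
  have mI[measurable]: "(\<lambda>s. ennreal_ln (I s)) \<in> borel_measurable M1"
    and mJ[measurable]: "(\<lambda>t. ennreal_ln (J t)) \<in> borel_measurable M2"
    using semiI semiJ unfolding semi_integrable_def by blast+
  have le: "(\<Sum>t\<in>T. ereal (d t) * g t (A (extend_zero S x) t)) \<le> (\<Sum>s\<in>S. ereal (c s) * f s (x s))" for x
  proof -
    let ?a = "extend_zero S x"
    have am[measurable]: "?a \<in> borel_measurable M1" by (rule extend_zero_measurable[OF assms(1) S(1)])
    then have a: "?a \<in> L2 M1" by (simp add: atomic_L2[OF M])
    then have "A ?a \<in> L2 M2" using assms(6) unfolding L2_linear_def by blast
    then have Am[measurable]: "A ?a \<in> borel_measurable M2" unfolding atomic_L2[OF N] .
    have fm: "(\<lambda>s. f s (?a s)) \<in> borel_measurable M1"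
      using measurable_compose[OF measurable_Pair[OF measurable_ident am] assms(14)] by simp
    have gm: "(\<lambda>t. g t (A ?a t)) \<in> borel_measurable M2"
      using measurable_compose[OF measurable_Pair[OF measurable_ident Am] assms(15)] by simp
    have "(\<Sum>t\<in>T. ereal (d t) * g t (A ?a t)) = ereal_integral M2 (\<lambda>t. g t (A ?a t))"
      by (rule atomic_ereal_integral[OF N gm, symmetric]) (use T assms(11) in \<open>simp add: subset_iff\<close>)
    also have "\<dots> \<le> ereal_integral M1 (\<lambda>s. f s (?a s))" by (rule assms(18)[OF a])
    also have "\<dots> = (\<Sum>s\<in>S. ereal (c s) * f s (?a s))"
      by (rule atomic_ereal_integral[OF M fm]) (use S assms(10) in \<open>simp add: subset_iff\<close>)
    finally show ?thesis by (simp add: extend_zero_def)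
  qed
  have infI: "(\<integral>\<^sup>+s. e2ennreal (h s) \<partial>M1) = \<infinity>" if "s \<in> S" "h s = \<infinity>" "h \<in> borel_measurable M1" for h s
    by (rule atomic_nn_integral_infinity[OF M that(3,1,2)])
  have infJ: "(\<integral>\<^sup>+t. e2ennreal (h t) \<partial>M2) = \<infinity>" if "t \<in> T" "h t = \<infinity>" "h \<in> borel_measurable M2" for h t
    by (rule atomic_nn_integral_infinity[OF N that(3,1,2)])
  show ?thesis
    unfolding I_def[symmetric] J_def[symmetric]
  \<comment> \<open>If some \<open>J t\<close> is infinite or some \<open>I s\<close> vanishes, semi-integrability decides the value of the corresponding side.\<close>
  proof (cases "\<exists>t\<in>T. J t = \<infinity>")
    case True
    then obtain t where t: "t \<in> T" "J t = \<infinity>" by blast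
    have "ennreal_ln (J t) = \<infinity>" using t by (simp add: ennreal_ln_def)
    then have 1: "(\<integral>\<^sup>+t. e2ennreal (ennreal_ln (J t)) \<partial>M2) = \<infinity>" using infJ[OF t(1) _ mJ] by blast
    then have "(\<integral>\<^sup>+t. e2ennreal (- ennreal_ln (J t)) \<partial>M2) < \<infinity>"
      using semiJ unfolding semi_integrable_def by auto
    then have "enn2ereal (\<integral>\<^sup>+t. e2ennreal (- ennreal_ln (J t)) \<partial>M2) \<noteq> \<infinity>"
      by (cases "\<integral>\<^sup>+t. e2ennreal (- ennreal_ln (J t)) \<partial>M2") (auto simp: enn2ereal_ennreal)
    then have "ereal_integral M2 (\<lambda>t. - ennreal_ln (J t)) = -\<infinity>"
      using 1 by (cases "enn2ereal (\<integral>\<^sup>+t. e2ennreal (- ennreal_ln (J t)) \<partial>M2)") (auto simp: ereal_integral_def)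
    then show "ereal_integral M2 (\<lambda>t. - ennreal_ln (J t)) \<le> ereal_integral M1 (\<lambda>s. - ennreal_ln (I s))" by simp
  next
    case Jfin: False
    show "ereal_integral M2 (\<lambda>t. - ennreal_ln (J t)) \<le> ereal_integral M1 (\<lambda>s. - ennreal_ln (I s))"
    proof (cases "\<exists>s\<in>S. I s = 0")
      case True
      then obtain s where s: "s \<in> S" "I s = 0" by blast
      have "- ennreal_ln (I s) = \<infinity>" using s by (simp add: ennreal_ln_def)
      then have "(\<integral>\<^sup>+s. e2ennreal (- ennreal_ln (I s)) \<partial>M1) = \<infinity>" by (intro infI[OF s(1)]) measurable
      then have "ereal_integral M1 (\<lambda>s. - ennreal_ln (I s)) = \<infinity>" by (simp add: ereal_integral_def)
      then show ?thesis by simp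
    next
      case False
      have Ipos: "0 < I s" if "s \<in> S" for s using False that by (metis gr_zeroI)
      have Jf: "J t < \<infinity>" if "t \<in> T" for t using Jfin that by (metis infinity_ennreal_def top.not_eq_extremum)
      have fS: "f s \<in> borel_measurable borel" "f s x \<noteq> -\<infinity>" if "s \<in> S" for s x
        using assms(10,12) S that by blast+
      have gT: "g t \<in> borel_measurable borel" "g t x \<noteq> -\<infinity>" if "t \<in> T" for t x
        using assms(11,13) T that by blast+
      note L = log_integral_inequality[OF fS gT le Ipos[unfolded I_def] Jf[unfolded J_def], folded I_def J_def]
      have Ifin: "I s < \<infinity>" if "s \<in> S" for s by (rule L(1)) (use that in auto)
      have Jpos: "0 < J t" if "t \<in> T" for t by (rule L(2)) (use that in auto)
      have logs: "(\<Sum>s\<in>S. c s * ln (enn2real (I s))) \<le> (\<Sum>t\<in>T. d t * ln (enn2real (J t)))"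
        by (rule L(3))
      have Iln: "- ennreal_ln (I s) = ereal (- ln (enn2real (I s)))" if "s \<in> S" for s
        using Ipos[OF that] Ifin[OF that] by (auto simp: ennreal_ln_def)
      have Jln: "- ennreal_ln (J t) = ereal (- ln (enn2real (J t)))" if "t \<in> T" for t
        using Jf[OF that] Jpos[OF that] by (auto simp: ennreal_ln_def)
      have "ereal_integral M2 (\<lambda>t. - ennreal_ln (J t)) = (\<Sum>t\<in>T. ereal (d t) * - ennreal_ln (J t))"
        by (rule atomic_ereal_integral[OF N]) (simp_all add: Jln)
      also have "\<dots> = ereal (- (\<Sum>t\<in>T. d t * ln (enn2real (J t))))"
        by (simp add: Jln sum_negf)
      also have "\<dots> \<le> ereal (- (\<Sum>s\<in>S. c s * ln (enn2real (I s))))"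
        using logs by simp
      also have "\<dots> = (\<Sum>s\<in>S. ereal (c s) * - ennreal_ln (I s))"
        by (simp add: Iln sum_negf)
      also have "\<dots> = ereal_integral M1 (\<lambda>s. - ennreal_ln (I s))"
        by (rule atomic_ereal_integral[OF M, symmetric]) (simp_all add: Iln)
      finally show ?thesis .
    qed
  qed
qed

end
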